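(* Let $\nu\in\mathbb{Z}$ with $\nu\geq 1$, or $\nu=\infty$. Let $\Psi\in\mathbb{S}_+(\mathbb{T})$ be rational and let $G(z)=(zI-A)^{-1}B$ be a filter bank with $I\in\mathrm{Range}\,\Gamma$. Then the problem $$\text{minimize } \mathcal{S}_\nu(\Phi\|\Psi)\ \text{ over the set } \Big\{\Phi\in\mathbb{S}_+(\mathbb{T})\;:\;\int G\Phi G^*=I\Big\}$$ admits a unique solution. Moreover, if $1\leq\nu<\infty$, this solution is a rational function (on $\mathbb{T}$) of degree at most $\deg[\Psi]+2n\nu$.
   Context: $\mathbb{T}$ is the unit circle; integrals $\int$ without limits are over $\vartheta\in[-\pi,\pi)$ with respect to $d\vartheta/2\pi$, the integrand being evaluated at $z=e^{j\vartheta}$. $\mathbb{S}_+(\mathbb{T})$ is the set of spectral densities on $\mathbb{T}$ (of real-valued scalar stationary processes) that are bounded and coercive, i.e. measurable real functions $\Phi$ with $\Phi(e^{-j\vartheta})=\Phi(e^{j\vartheta})$ and $\mu\leq\Phi\leq M$ on $\mathbb{T}$ for some constants $0<\mu\leq M<\infty$ (functions equal a.e. are identified). Filter bank: $A\in\mathbb{R}^{n\times n}$ has all eigenvalues in the open unit disc, $B\in\mathbb{R}^n$, $(A,B)$ is reachable, $n>1$. On $\mathbb{T}$, $G^*$ is the conjugate transpose of $G$. $\mathcal{Q}_n$ is the space of real symmetric $n\times n$ matrices with inner product $\langle X,Y\rangle=\mathrm{tr}(XY)$. $\Gamma$ is the linear operator $\Phi\mapsto\int G\Phi G^*$ from the real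 linear span of $\mathbb{S}_+(\mathbb{T})$ to $\mathcal{Q}_n$, and $\mathrm{Range}\,\Gamma\subseteq\mathcal{Q}_n$ is its range. The Kullback-Leibler divergence is $\mathcal{S}_{\mathrm{KL}}(\Phi_1\|\Phi_2)=\int \Phi_1\log(\Phi_1/\Phi_2)-\Phi_1+\Phi_2$. The divergence $\mathcal{S}_\nu$ is defined by $\mathcal{S}_1(\Phi\|\Psi)=\mathcal{S}_{\mathrm{KL}}(\Psi\|\Phi)$; $\mathcal{S}_\nu(\Phi\|\Psi)=\int \frac{\nu^2}{1-\nu}\Phi^{\frac{\nu-1}{\nu}}\Psi^{\frac1\nu}+\nu\Phi+\frac{\nu}{\nu-1}\Psi$ for integers $1<\nu<\infty$; $\mathcal{S}_\infty(\Phi\|\Psi)=\mathcal{S}_{\mathrm{KL}}(\Phi\|\Psi)$. "Rational" means being the restriction to $\mathbb{T}$ of a rational function of $z$; $\deg$ denotes the degree of a rational function (the maximum of the degrees of numerator and denominator in lowest terms). *)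

theory Defs
  imports "HOL-Analysis.Analysis" "HOL-Computational_Algebra.Field_as_Ring" "HOL-Computational_Algebra.Polynomial_Factorial"
begin

(* Functions on the unit circle are represented by functions on the complex plane whose values off
   the circle are irrelevant. The angle \<theta> parametrises the circle by cis \<theta> = e^(j\<theta>). *)

definition circle_int :: "(complex \<Rightarrow> 'a) \<Rightarrow> 'a::{banach, second_countable_topology}" where
  "circle_int f = (1 / (2 * pi)) *\<^sub>R (LINT \<theta>|lebesgue_on {-pi..<pi}. f (cis \<theta>))"

definition circle_ae_eq :: "(complex \<Rightarrow> real) \<Rightarrow> (complex \<Rightarrow> real) \<Rightarrow> bool" where
  "circle_ae_eq \<Phi> \<Phi>' \<longleftrightarrow> (AE \<theta> in lebesgue_on {-pi..<pi}. \<Phi> (cis \<theta>) = \<Phi>' (cis \<theta>))"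

definition S_plus :: "(complex \<Rightarrow> real) set" where
  "S_plus = {\<Phi>. (\<lambda>\<theta>. \<Phi> (cis \<theta>)) \<in> borel_measurable (lebesgue_on {-pi..<pi}) \<and>
                 (\<forall>z. norm z = 1 \<longrightarrow> \<Phi> (cnj z) = \<Phi> z) \<and>
                 (\<exists>\<mu> M. 0 < \<mu> \<and> (\<forall>z. norm z = 1 \<longrightarrow> \<mu> \<le> \<Phi> z \<and> \<Phi> z \<le> M))}"

(* Written out by hand since the function space carries no real_vector instance. *)
definition S_plus_span :: "(complex \<Rightarrow> real) set" where
  "S_plus_span = {\<Phi>. \<exists>\<F> c. finite \<F> \<and> \<F> \<subseteq> S_plus \<and> \<Phi> = (\<lambda>z. \<Sum>F\<in>\<F>. c F * F z)}"

definition complex_mat :: "real^'n^'m \<Rightarrow> complex^'n^'m" where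
  "complex_mat A = (\<chi> i j. complex_of_real (A $ i $ j))"

definition complex_vec :: "real^'n \<Rightarrow> complex^'n" where
  "complex_vec v = (\<chi> i. complex_of_real (v $ i))"

definition eigenvalues_in_unit_disc :: "real^'n^'n \<Rightarrow> bool" where
  "eigenvalues_in_unit_disc A \<longleftrightarrow>
     (\<forall>(l::complex) v. v \<noteq> 0 \<and> complex_mat A *v v = l *s v \<longrightarrow> norm l < 1)"

(* The columns B, A B, ..., A^(n-1) B of the reachability matrix span the state space. *)
definition reachable :: "real^'n^'n \<Rightarrow> real^'n \<Rightarrow> bool" where
  "reachable A B \<longleftrightarrow> span ((\<lambda>k. (((*v) A) ^^ k) B) ` {..<CARD('n)}) = UNIV"

definition filter_bank :: "real^'n^'n \<Rightarrow> real^'n \<Rightarrow> bool" where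
  "filter_bank A B \<longleftrightarrow> CARD('n) > 1 \<and> eigenvalues_in_unit_disc A \<and> reachable A B"

(* mat z is the scalar matrix z I. *)
definition transfer_fun :: "real^'n^'n \<Rightarrow> real^'n \<Rightarrow> complex \<Rightarrow> complex^'n" where
  "transfer_fun A B z = matrix_inv (mat z - complex_mat A) *v complex_vec B"

(* The real symmetric matrices are regarded as a subset of the complex ones, so that the
   integral of G \<Phi> G* is taken literally. *)
definition Gamma_op :: "real^'n^'n \<Rightarrow> real^'n \<Rightarrow> (complex \<Rightarrow> real) \<Rightarrow> complex^'n^'n" where
  "Gamma_op A B \<Phi> = circle_int (\<lambda>z. \<chi> i j.
     transfer_fun A B z $ i * complex_of_real (\<Phi> z) * cnj (transfer_fun A B z $ j))"

definition Range_Gamma :: "real^'n^'n \<Rightarrow> real^'n \<Rightarrow> (complex^'n^'n) set" where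
  "Range_Gamma A B = Gamma_op A B ` S_plus_span"

definition KL_div :: "(complex \<Rightarrow> real) \<Rightarrow> (complex \<Rightarrow> real) \<Rightarrow> real" where
  "KL_div \<Phi>\<^sub>1 \<Phi>\<^sub>2 = circle_int (\<lambda>z. \<Phi>\<^sub>1 z * ln (\<Phi>\<^sub>1 z / \<Phi>\<^sub>2 z) - \<Phi>\<^sub>1 z + \<Phi>\<^sub>2 z)"

(* Only used for \<nu> \<ge> 1. *)
definition S_div :: "enat \<Rightarrow> (complex \<Rightarrow> real) \<Rightarrow> (complex \<Rightarrow> real) \<Rightarrow> real" where
  "S_div \<nu> \<Phi> \<Psi> = (case \<nu> of
     \<infinity> \<Rightarrow> KL_div \<Phi> \<Psi>
   | enat k \<Rightarrow>
       if k = 1 then KL_div \<Psi> \<Phi>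
       else circle_int (\<lambda>z.
              (real k)\<^sup>2 / (1 - real k) * \<Phi> z powr ((real k - 1) / real k) * \<Psi> z powr (1 / real k)
              + real k * \<Phi> z + real k / (real k - 1) * \<Psi> z))"

definition feasible :: "real^'n^'n \<Rightarrow> real^'n \<Rightarrow> (complex \<Rightarrow> real) set" where
  "feasible A B = {\<Phi> \<in> S_plus. Gamma_op A B \<Phi> = mat 1}"

definition is_solution ::
    "enat \<Rightarrow> real^'n^'n \<Rightarrow> real^'n \<Rightarrow> (complex \<Rightarrow> real) \<Rightarrow> (complex \<Rightarrow> real) \<Rightarrow> bool" where
  "is_solution \<nu> A B \<Psi> \<Phi> \<longleftrightarrow> is_arg_min (\<lambda>\<Phi>. S_div \<nu> \<Phi> \<Psi>) (\<lambda>\<Phi>. \<Phi> \<in> feasible A B) \<Phi>"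

(* \<Phi> is the restriction to the circle of p / q, a fraction in lowest terms. *)
definition is_fraction_on_circle ::
    "(complex \<Rightarrow> real) \<Rightarrow> complex poly \<Rightarrow> complex poly \<Rightarrow> bool" where
  "is_fraction_on_circle \<Phi> p q \<longleftrightarrow> coprime p q \<and>
     (\<forall>z. norm z = 1 \<longrightarrow> poly q z \<noteq> 0 \<and> complex_of_real (\<Phi> z) = poly p z / poly q z)"

definition rational_on_circle :: "(complex \<Rightarrow> real) \<Rightarrow> bool" where
  "rational_on_circle \<Phi> \<longleftrightarrow> (\<exists>p q. is_fraction_on_circle \<Phi> p q)"

definition rational_deg :: "(complex \<Rightarrow> real) \<Rightarrow> nat" where
  "rational_deg \<Phi> = (THE d. \<exists>p q. is_fraction_on_circle \<Phi> p q \<and> d = max (degree p) (degree q))"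

lemma is_fraction_on_circle_cross_mult:
  assumes "is_fraction_on_circle \<Phi> p q" "is_fraction_on_circle \<Phi> p' q'"
  shows "p * q' = p' * q"
proof (rule ccontr)
  assume "p * q' \<noteq> p' * q"
  then have "finite {z. poly (p * q' - p' * q) z = 0}"
    by (intro poly_roots_finite) simp
  moreover have "sphere 0 1 \<subseteq> {z. poly (p * q' - p' * q) z = 0}"
  proof
    fix z :: complex assume "z \<in> sphere 0 1"
    then have "norm z = 1" by simp
    then have nz: "poly q z \<noteq> 0" "poly q' z \<noteq> 0"
      and "complex_of_real (\<Phi> z) = poly p z / poly q z"
        "complex_of_real (\<Phi> z) = poly p' z / poly q' z"
      using assms by (simp_all add: is_fraction_on_circle_def)
    then have "poly p z / poly q z = poly p' z / poly q' z" by metis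
    then have "poly p z * poly q' z = poly p' z * poly q z"
      using frac_eq_eq[OF nz] by blast
    then show "z \<in> {z. poly (p * q' - p' * q) z = 0}" by simp
  qed
  ultimately have "finite (sphere (0::complex) 1)"
    using finite_subset by blast
  moreover have "infinite (sphere (0::complex) 1)"
  proof
    assume "finite (sphere (0::complex) 1)"
    moreover have "{-1..1} \<subseteq> Re ` sphere 0 1"
    proof
      fix x :: real assume "x \<in> {-1..1}"
      then have "Re (cis (arccos x)) = x" by simp
      moreover have "cis (arccos x) \<in> sphere 0 1" by simp
      ultimately show "x \<in> Re ` sphere 0 1" by (metis imageI)
    qed
    ultimately have "finite {-1..1::real}"
      by (meson finite_imageI finite_subset)
    then show False using infinite_Icc[of "-1" "1::real"] by simp
  qed
  ultimately show False by simp
qed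

lemma is_fraction_on_circle_degree_unique:
  assumes "is_fraction_on_circle \<Phi> p q" "is_fraction_on_circle \<Phi> p' q'"
  shows "degree p = degree p' \<and> degree q = degree q'"
proof -
  have eq: "p * q' = p' * q"
    using is_fraction_on_circle_cross_mult[OF assms] .
  have cop: "coprime p q" "coprime p' q'"
    using assms by (auto simp: is_fraction_on_circle_def)
  have "p dvd p' * q" using eq by (metis dvd_triv_left)
  then have 1: "p dvd p'" using cop by (simp add: coprime_dvd_mult_left_iff)
  have "p' dvd p * q'" using eq by (metis dvd_triv_left)
  then have 2: "p' dvd p" using cop by (simp add: coprime_dvd_mult_left_iff)
  have "q dvd p * q'" using eq by (metis dvd_triv_right)
  then have 3: "q dvd q'" using cop by (simp add: coprime_dvd_mult_right_iff coprime_commute)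
  have "q' dvd p' * q" using eq by (metis dvd_triv_right)
  then have 4: "q' dvd q" using cop by (simp add: coprime_dvd_mult_right_iff coprime_commute)
  have "degree r = degree s" if "r dvd s" "s dvd r" for r s :: "complex poly"
  proof (cases "r = 0")
    case True
    then show ?thesis using that by simp
  next
    case False
    moreover from this have "s \<noteq> 0" using that(2) by auto
    ultimately show ?thesis using that by (meson dvd_imp_degree_le le_antisym)
  qed
  then show ?thesis using 1 2 3 4 by blast
qed

lemma rational_deg_eq:
  assumes "is_fraction_on_circle \<Phi> p q"
  shows "rational_deg \<Phi> = max (degree p) (degree q)"
  unfolding rational_deg_def
proof (rule the_equality)
  show "\<exists>p' q'. is_fraction_on_circle \<Phi> p' q' \<and>
          max (degree p) (degree q) = max (degree p') (degree q')"
    using assms by blast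
  show "d = max (degree p) (degree q)"
    if "\<exists>p' q'. is_fraction_on_circle \<Phi> p' q' \<and> d = max (degree p') (degree q')" for d
    using that is_fraction_on_circle_degree_unique[OF assms] by metis
qed

end

(* Stationarity of the Lagrangian forces the minimizer to be \<Psi> / (1 + q/\<nu>)^\<nu> (for \<nu> = \<infinity>: \<Psi> exp(-q)) with
   q = G* \<Lambda> G, and pointwise strict convexity of the divergence makes any feasible density of this form
   the unique minimizer; its rationality and degree can be read off. So the moments have to be matched by
   some \<Lambda>.

   First, some positive density is feasible. If I = \<Gamma>(\<Phi>0) with \<Phi>0 of any sign, then zG = AG + B gives
   |A'u| = |u| for u orthogonal to B, so with the orthogonal projection \<Pi> along B the matrix F = \<Pi> A
   satisfies FF' = \<Pi>. By reachability a power of F is a strict contraction. Hence B'G has no zero on the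
   circle, and expanding W = G / B'G in powers of F shows that \<Phi>1 = |B|^2 / |B'G|^2 is feasible.

   Given \<Phi>1, Brouwer's theorem solves the variational inequality of the dual gradient
   \<Lambda> \<mapsto> \<integral> (\<Phi>1 - \<Psi> / (1 + q/\<nu>)^\<nu>) G G* on a compact convex set of multipliers. Testing it with 0
   bounds \<integral> (w + 1/w) for w = 1 + q/\<nu>, uniformly in the set. The first term bounds \<Lambda>; since w is
   Lipschitz and 1/|t| is not integrable, the second keeps w away from 0. So no constraint is active on a
   large enough set, and the gradient vanishes. *)

theory Submission
  imports Defs
begin

section \<open>Moment equations on an interval of angles\<close>

text \<open>A fixed point replaces the minimisation of the dual functional, so that only continuity
  of its gradient is used and nothing is differentiated under an integral. For finite \<nu> the
  obstacle is the boundary of the set where w > 0: the gradient blows up there, and the solution of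
  a truncated problem might sit on the truncation. Excluding this requires constants fixed in a
  non-circular order. The bound C obtained by testing with 0 depends only on the bounds of the two
  densities, C bounds the multiplier, the multiplier bounds the Lipschitz constant of w, and the
  truncation level is chosen last. The term w in the tested inequality comes from a positive lower
  bound on the feasible density, which is why a density of arbitrary sign cannot take the place of
  \<Phi>1. The contraction argument for \<Phi>1 is always used in the same way: an error is
  unchanged or grows when x is replaced by F'x, while it is bounded by a multiple of |x|, so it must
  vanish.\<close>

abbreviation angle :: "real measure" where
  "angle \<equiv> lebesgue_on {-pi..<pi}"

section \<open>Integration over the interval of angles\<close>

lemma integrable_angle_bounded:
  fixes f :: "real \<Rightarrow> 'b::{banach, second_countable_topology}"
  assumes "f \<in> borel_measurable angle" "\<And>\<theta>. \<theta> \<in> {-pi..<pi} \<Longrightarrow> norm (f \<theta>) \<le> C"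
  shows "integrable angle f"
proof -
  interpret finite_measure angle
    by (intro finite_measure_lebesgue_on bounded_set_imp_lmeasurable) auto
  show ?thesis
    by (rule integrable_const_bound[where B = C]) (use assms in \<open>auto intro!: AE_I2\<close>)
qed

lemma borel_measurable_angle_continuous:
  assumes "continuous_on {-pi..pi} f"
  shows "f \<in> borel_measurable angle"
proof (rule continuous_imp_measurable_on_sets_lebesgue)
  show "continuous_on {-pi..<pi} f"
    using assms by (rule continuous_on_subset) auto
qed simp

lemma integrable_angle_continuous:
  fixes f :: "real \<Rightarrow> 'b::{banach, second_countable_topology}"
  assumes "continuous_on {-pi..pi} f"
  shows "integrable angle f"
proof -
  have "compact (f ` {-pi..pi})"
    using assms by (intro compact_continuous_image) auto
  then obtain C where "\<And>y. y \<in> f ` {-pi..pi} \<Longrightarrow> norm y \<le> C"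
    using compact_imp_bounded bounded_iff by metis
  then show ?thesis
    by (intro integrable_angle_bounded[where C = C] borel_measurable_angle_continuous assms) auto
qed

lemma integral_angle_eq_integral:
  fixes f :: "real \<Rightarrow> 'b::euclidean_space"
  assumes "integrable angle f"
  shows "(LINT \<theta>|angle. f \<theta>) = integral {-pi..pi} f"
proof -
  have "integral {-pi..pi} f = integral {-pi..<pi} f"
    by (rule integral_spike_set; rule negligible_subset[of "{pi}"]) auto
  then show ?thesis
    using lebesgue_integral_eq_integral[OF assms] by simp
qed

lemma continuous_eq_0_if_integral_angle_eq_0:
  fixes f :: "real \<Rightarrow> real"
  assumes cont: "continuous_on {-pi..pi} f" and nonneg: "\<And>\<theta>. \<theta> \<in> {-pi..pi} \<Longrightarrow> 0 \<le> f \<theta>"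
    and zero: "(LINT \<theta>|angle. f \<theta>) = 0" and \<theta>: "\<theta> \<in> {-pi..pi}"
  shows "f \<theta> = 0"
proof -
  have "f integrable_on {-pi..pi}"
    using integrable_continuous_real[OF cont] .
  moreover have "integral {-pi..pi} f = 0"
    using zero integral_angle_eq_integral[OF integrable_angle_continuous[OF cont]] by simp
  ultimately have "(f has_integral 0) (cbox (-pi) pi)"
    by (metis box_real(2) integrable_integral)
  moreover have "box (-pi) pi \<noteq> {}"
    using pi_gt_zero by (simp add: box_eq_empty not_le)
  ultimately show ?thesis
    using has_integral_0_cbox_imp_0[of "-pi" pi f \<theta>] cont nonneg \<theta> by auto
qed

text \<open>In the application \<open>M\<close> is \<open>gram_angle\<close>, \<open>\<phi>\<close>
  is the feasible density \<open>\<Phi>1\<close> and \<open>\<psi>\<close> is the prior, both read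
  along the circle. Lipschitz continuity of \<open>M\<close> is what forces the integral of 1/w to
  be large when w comes close to 0 at some angle.\<close>

locale moment_problem =
  fixes M :: "real \<Rightarrow> 'e::euclidean_space" and \<phi> \<psi> :: "real \<Rightarrow> real" and L lo hi :: real
  assumes lipschitz: "L-lipschitz_on {-pi..pi} M"
    and meas [measurable]: "\<phi> \<in> borel_measurable angle" "\<psi> \<in> borel_measurable angle"
    and lo_pos: "0 < lo"
    and \<phi>_bounds: "\<And>\<theta>. \<theta> \<in> {-pi..pi} \<Longrightarrow> lo \<le> \<phi> \<theta> \<and> \<phi> \<theta> \<le> hi"
    and \<psi>_bounds: "\<And>\<theta>. \<theta> \<in> {-pi..pi} \<Longrightarrow> lo \<le> \<psi> \<theta> \<and> \<psi> \<theta> \<le> hi"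
begin

text \<open>A component of the multiplier orthogonal to every \<open>M \<theta>\<close> does not
  change \<open>\<Lambda> \<bullet> M \<theta>\<close>. Only within this span can integrals of
  \<open>\<Lambda> \<bullet> M \<theta>\<close> control \<open>norm \<Lambda>\<close>.\<close>

definition V :: "'e set" where
  "V = span (M ` {-pi..pi})"

text \<open>Stationarity of the Lagrangian makes the minimizer \<open>\<psi> * g (\<Lambda> \<bullet> M)\<close>, where \<open>g t\<close> is
  \<open>1 / (1 + t / \<nu>) ^ \<nu>\<close> or, for \<open>\<nu> = \<infinity>\<close>, \<open>exp (- t)\<close>; \<open>\<phi>\<close> is some density with the required moments.\<close>

definition residual :: "(real \<Rightarrow> real) \<Rightarrow> 'e \<Rightarrow> 'e" where
  "residual g \<Lambda> = (LINT \<theta>|angle. (\<phi> \<theta> - \<psi> \<theta> * g (\<Lambda> \<bullet> M \<theta>)) *\<^sub>R M \<theta>)"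

lemma continuous_M: "continuous_on {-pi..pi} M"
  using lipschitz lipschitz_on_continuous_on by blast

lemma M_measurable [measurable]: "M \<in> borel_measurable angle"
  using continuous_M by (rule borel_measurable_angle_continuous)

lemma M_bounded: obtains S where "0 < S" "\<And>\<theta>. \<theta> \<in> {-pi..pi} \<Longrightarrow> norm (M \<theta>) \<le> S"
proof -
  have "compact (M ` {-pi..pi})"
    using continuous_M by (intro compact_continuous_image) auto
  then obtain C where "\<And>y. y \<in> M ` {-pi..pi} \<Longrightarrow> norm y \<le> C"
    using compact_imp_bounded bounded_iff by metis
  then have "\<And>\<theta>. \<theta> \<in> {-pi..pi} \<Longrightarrow> norm (M \<theta>) \<le> max 1 C"
    by (meson image_eqI le_max_iff_disj)
  then show thesis
    using that[of "max 1 C"] by simp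
qed

lemma continuous_margin:
  assumes "continuous_on {-pi..pi} (f :: real \<Rightarrow> real)" "\<And>\<theta>. \<theta> \<in> {-pi..pi} \<Longrightarrow> c < f \<theta>"
  obtains \<epsilon> where "0 < \<epsilon>" "\<And>\<theta>. \<theta> \<in> {-pi..pi} \<Longrightarrow> c + \<epsilon> \<le> f \<theta>"
proof -
  obtain t where "t \<in> {-pi..pi}" "\<And>\<theta>. \<theta> \<in> {-pi..pi} \<Longrightarrow> f t \<le> f \<theta>"
    using continuous_attains_inf[of "{-pi..pi}" f] assms(1) by auto
  then show thesis
    using that[of "f t - c"] assms(2)[of t] by auto
qed

text \<open>Continuity of \<open>g\<close> is asked only on a compact \<open>T\<close>, because 1 /
  (1 + t / k) ^ k is singular at t = -k. The weight \<open>h\<close> will be \<open>M\<close> itself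
  or the scalar \<open>\<Lambda> \<bullet> M \<theta>\<close>.\<close>

lemma weighted_integrable:
  assumes cont: "continuous_on T g" and "compact T" and T: "\<And>\<theta>. \<theta> \<in> {-pi..pi} \<Longrightarrow> \<Lambda> \<bullet> M \<theta> \<in> T"
    and h: "h \<in> borel_measurable angle" "\<And>\<theta>. \<theta> \<in> {-pi..<pi} \<Longrightarrow> norm (h \<theta> :: 'b::{banach, second_countable_topology}) \<le> H"
  shows "integrable angle (\<lambda>\<theta>. (\<phi> \<theta> - \<psi> \<theta> * g (\<Lambda> \<bullet> M \<theta>)) *\<^sub>R h \<theta>)"
proof -
  have "compact (g ` T)"
    using cont \<open>compact T\<close> by (rule compact_continuous_image)
  then obtain C where C: "\<And>y. y \<in> g ` T \<Longrightarrow> \<bar>y\<bar> \<le> C"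
    using compact_imp_bounded bounded_iff real_norm_def by metis
  have "continuous_on {-pi..pi} (\<lambda>\<theta>. g (\<Lambda> \<bullet> M \<theta>))"
    using T by (intro continuous_on_compose2[OF cont] continuous_intros continuous_M) auto
  then have [measurable]: "(\<lambda>\<theta>. g (\<Lambda> \<bullet> M \<theta>)) \<in> borel_measurable angle"
    by (rule borel_measurable_angle_continuous)
  note [measurable] = h(1)
  show ?thesis
  proof (rule integrable_angle_bounded)
    show "(\<lambda>\<theta>. (\<phi> \<theta> - \<psi> \<theta> * g (\<Lambda> \<bullet> M \<theta>)) *\<^sub>R h \<theta>) \<in> borel_measurable angle"
      by measurable
    fix \<theta> assume \<theta>: "\<theta> \<in> {-pi..<pi}"
    then have *: "\<theta> \<in> {-pi..pi}" by auto
    have "\<bar>\<phi> \<theta>\<bar> \<le> hi" "\<bar>\<psi> \<theta>\<bar> \<le> hi"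
      using \<phi>_bounds[OF *] \<psi>_bounds[OF *] lo_pos by auto
    moreover have "\<bar>g (\<Lambda> \<bullet> M \<theta>)\<bar> \<le> C"
      using C T[OF *] by blast
    ultimately have "\<bar>\<phi> \<theta>\<bar> + \<bar>\<psi> \<theta>\<bar> * \<bar>g (\<Lambda> \<bullet> M \<theta>)\<bar> \<le> hi + hi * C"
      using lo_pos by (intro add_mono mult_mono) auto
    then have "\<bar>\<phi> \<theta> - \<psi> \<theta> * g (\<Lambda> \<bullet> M \<theta>)\<bar> \<le> hi + hi * C"
      unfolding abs_mult[symmetric] by linarith
    then show "norm ((\<phi> \<theta> - \<psi> \<theta> * g (\<Lambda> \<bullet> M \<theta>)) *\<^sub>R h \<theta>) \<le> (hi + hi * C) * H"
      using h(2)[OF \<theta>] by (auto intro!: mult_mono)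
  qed
qed

lemma residual_inner:
  assumes "continuous_on T g" "compact T" "\<And>\<theta>. \<theta> \<in> {-pi..pi} \<Longrightarrow> \<Lambda> \<bullet> M \<theta> \<in> T"
  shows "residual g \<Lambda> \<bullet> x = (LINT \<theta>|angle. (\<phi> \<theta> - \<psi> \<theta> * g (\<Lambda> \<bullet> M \<theta>)) * (x \<bullet> M \<theta>))"
proof -
  obtain S where S: "\<And>\<theta>. \<theta> \<in> {-pi..pi} \<Longrightarrow> norm (M \<theta>) \<le> S"
    using M_bounded by blast
  have "integrable angle (\<lambda>\<theta>. (\<phi> \<theta> - \<psi> \<theta> * g (\<Lambda> \<bullet> M \<theta>)) *\<^sub>R M \<theta>)"
    by (rule weighted_integrable[OF assms, where H = S]) (use S in auto)
  from integral_inner_left[OF this, of x]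
  have "residual g \<Lambda> \<bullet> x = (LINT \<theta>|angle. ((\<phi> \<theta> - \<psi> \<theta> * g (\<Lambda> \<bullet> M \<theta>)) *\<^sub>R M \<theta>) \<bullet> x)"
    unfolding residual_def by (rule sym)
  then show ?thesis
    unfolding inner_scaleR_left inner_commute[of x] .
qed

text \<open>A vector orthogonal to every \<open>M \<theta>\<close> annihilates the integrand, so the
  residual has no component outside the span. Moving along it therefore never leaves
  \<open>V\<close>.\<close>

lemma residual_in_V:
  assumes "continuous_on T g" "compact T" "\<And>\<theta>. \<theta> \<in> {-pi..pi} \<Longrightarrow> \<Lambda> \<bullet> M \<theta> \<in> T"
  shows "residual g \<Lambda> \<in> V"
proof -
  obtain y z where yz: "y \<in> V" "\<And>w. w \<in> V \<Longrightarrow> orthogonal z w" "residual g \<Lambda> = y + z"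
    using orthogonal_subspace_decomp_exists[of "M ` {-pi..pi}" "residual g \<Lambda>"] unfolding V_def by metis
  have "residual g \<Lambda> \<bullet> z = (LINT \<theta>|angle. (\<phi> \<theta> - \<psi> \<theta> * g (\<Lambda> \<bullet> M \<theta>)) * (z \<bullet> M \<theta>))"
    by (rule residual_inner[OF assms])
  also have "\<dots> = (LINT \<theta>|angle. 0)"
  proof (rule Bochner_Integration.integral_cong)
    fix \<theta> assume "\<theta> \<in> space angle"
    then have "M \<theta> \<in> V" unfolding V_def by (intro span_base) auto
    then show "(\<phi> \<theta> - \<psi> \<theta> * g (\<Lambda> \<bullet> M \<theta>)) * (z \<bullet> M \<theta>) = 0"
      using yz(2) by (auto simp: orthogonal_def)
  qed simp
  finally have "z \<bullet> z = 0"
    using yz by (simp add: inner_add_right orthogonal_def inner_commute)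
  then show ?thesis using yz by simp
qed

lemma continuous_on_residual:
  assumes cont: "continuous_on T g" "compact T"
    and T: "\<And>\<Lambda> \<theta>. \<Lambda> \<in> K \<Longrightarrow> \<theta> \<in> {-pi..pi} \<Longrightarrow> \<Lambda> \<bullet> M \<theta> \<in> T"
  shows "continuous_on K (residual g)"
  unfolding continuous_on_sequentially
proof (intro allI ballI impI, elim conjE)
  fix X \<Lambda> assume \<Lambda>: "\<Lambda> \<in> K" and X: "\<forall>n. X n \<in> K" "X \<longlonglongrightarrow> \<Lambda>"
  obtain S where S: "0 < S" "\<And>\<theta>. \<theta> \<in> {-pi..pi} \<Longrightarrow> norm (M \<theta>) \<le> S"
    using M_bounded by blast
  have int: "integrable angle (\<lambda>\<theta>. (\<phi> \<theta> - \<psi> \<theta> * g (\<Lambda> \<bullet> M \<theta>)) *\<^sub>R M \<theta>)" if "\<Lambda> \<in> K" for \<Lambda>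
    by (rule weighted_integrable[OF cont T[OF that], where H = S]) (use S in auto)
  have "compact (g ` T)"
    using cont by (rule compact_continuous_image)
  then obtain C where C: "\<And>y. y \<in> g ` T \<Longrightarrow> \<bar>y\<bar> \<le> C"
    using compact_imp_bounded bounded_iff real_norm_def by metis
  show "(residual g \<circ> X) \<longlonglongrightarrow> residual g \<Lambda>"
    unfolding residual_def o_def
  proof (rule integral_dominated_convergence[where w = "\<lambda>_. (hi + hi * C) * S"])
    show "integrable angle (\<lambda>_. (hi + hi * C) * S)"
      by (rule integrable_angle_bounded[where C = "\<bar>(hi + hi * C) * S\<bar>"]) auto
    show "AE \<theta> in angle. (\<lambda>i. (\<phi> \<theta> - \<psi> \<theta> * g (X i \<bullet> M \<theta>)) *\<^sub>R M \<theta>)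
             \<longlonglongrightarrow> (\<phi> \<theta> - \<psi> \<theta> * g (\<Lambda> \<bullet> M \<theta>)) *\<^sub>R M \<theta>"
    proof (rule AE_I2)
      fix \<theta> assume "\<theta> \<in> space angle"
      then have *: "\<theta> \<in> {-pi..pi}" by auto
      have "(\<lambda>i. g (X i \<bullet> M \<theta>)) \<longlonglongrightarrow> g (\<Lambda> \<bullet> M \<theta>)"
        by (rule continuous_on_tendsto_compose[OF cont(1)])
           (use X \<Lambda> T * in \<open>auto intro!: tendsto_intros\<close>)
      then show "(\<lambda>i. (\<phi> \<theta> - \<psi> \<theta> * g (X i \<bullet> M \<theta>)) *\<^sub>R M \<theta>)
             \<longlonglongrightarrow> (\<phi> \<theta> - \<psi> \<theta> * g (\<Lambda> \<bullet> M \<theta>)) *\<^sub>R M \<theta>"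
        by (intro tendsto_intros)
    qed
    show "AE \<theta> in angle. norm ((\<phi> \<theta> - \<psi> \<theta> * g (X i \<bullet> M \<theta>)) *\<^sub>R M \<theta>) \<le> (hi + hi * C) * S" for i
    proof (rule AE_I2)
      fix \<theta> assume "\<theta> \<in> space angle"
      then have *: "\<theta> \<in> {-pi..pi}" by auto
      have "\<bar>\<phi> \<theta>\<bar> \<le> hi" "\<bar>\<psi> \<theta>\<bar> \<le> hi"
        using \<phi>_bounds[OF *] \<psi>_bounds[OF *] lo_pos by auto
      moreover have "\<bar>g (X i \<bullet> M \<theta>)\<bar> \<le> C"
        using C T[OF _ *] X by blast
      ultimately have "\<bar>\<phi> \<theta>\<bar> + \<bar>\<psi> \<theta>\<bar> * \<bar>g (X i \<bullet> M \<theta>)\<bar> \<le> hi + hi * C"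
      using lo_pos by (intro add_mono mult_mono) auto
    then have "\<bar>\<phi> \<theta> - \<psi> \<theta> * g (X i \<bullet> M \<theta>)\<bar> \<le> hi + hi * C"
        unfolding abs_mult[symmetric] by linarith
      then show "norm ((\<phi> \<theta> - \<psi> \<theta> * g (X i \<bullet> M \<theta>)) *\<^sub>R M \<theta>) \<le> (hi + hi * C) * S"
        using S(2)[OF *] by (auto intro!: mult_mono)
    qed
  qed (use int \<Lambda> X in \<open>auto simp: borel_measurable_integrable\<close>)
qed

text \<open>Brouwer's theorem gives a fixed point of the projected step from \<Lambda> to the point
  of \<open>K\<close> closest to \<Lambda> minus the residual. The obtuse-angle property of the
  closest point, read at the fixed point, is the inequality.\<close>

lemma variational_inequality:
  assumes cont: "continuous_on T g" "compact T"
    and T: "\<And>\<Lambda> \<theta>. \<Lambda> \<in> K \<Longrightarrow> \<theta> \<in> {-pi..pi} \<Longrightarrow> \<Lambda> \<bullet> M \<theta> \<in> T"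
    and K: "compact K" "convex K" "K \<noteq> {}"
  obtains \<Lambda> where "\<Lambda> \<in> K" "\<And>x. x \<in> K \<Longrightarrow> 0 \<le> residual g \<Lambda> \<bullet> (x - \<Lambda>)"
proof -
  let ?f = "\<lambda>\<Lambda>. closest_point K (\<Lambda> - residual g \<Lambda>)"
  have "closed K" using K compact_imp_closed by blast
  have "continuous_on K ?f"
    by (intro continuous_on_compose2[OF continuous_on_closest_point[OF K(2) \<open>closed K\<close> K(3), of UNIV]]
          continuous_intros continuous_on_residual[OF cont T]) auto
  moreover have "?f \<in> K \<rightarrow> K"
    using closest_point_in_set[OF \<open>closed K\<close> K(3)] by auto
  ultimately obtain \<Lambda> where \<Lambda>: "\<Lambda> \<in> K" "?f \<Lambda> = \<Lambda>"
    using brouwer[OF K(1,2,3)] by blast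
  show thesis
  proof (rule that[OF \<Lambda>(1)])
    fix x assume "x \<in> K"
    from closest_point_dot[OF K(2) \<open>closed K\<close> this, of "\<Lambda> - residual g \<Lambda>"] \<Lambda>(2)
    show "0 \<le> residual g \<Lambda> \<bullet> (x - \<Lambda>)"
      by simp
  qed
qed

text \<open>The norm bound provides compactness; the lower bound \<open>-b\<close> keeps the
  argument of \<open>g\<close> away from its singularity.\<close>

definition region :: "real \<Rightarrow> real \<Rightarrow> 'e set" where
  "region R b = {\<Lambda> \<in> V. norm \<Lambda> \<le> R \<and> (\<forall>\<theta>\<in>{-pi..pi}. -b \<le> \<Lambda> \<bullet> M \<theta>)}"

lemma region_eq: "region R b = V \<inter> cball 0 R \<inter> (\<Inter>\<theta>\<in>{-pi..pi}. {\<Lambda>. M \<theta> \<bullet> \<Lambda> \<ge> -b})"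
  by (auto simp: region_def inner_commute)

lemma compact_region: "compact (region R b)"
proof -
  have "closed (V \<inter> (\<Inter>\<theta>\<in>{-pi..pi}. {\<Lambda>. M \<theta> \<bullet> \<Lambda> \<ge> -b}))"
    by (intro closed_Int closed_INT ballI closed_halfspace_ge) (auto simp: V_def)
  then have "compact (cball 0 R \<inter> (V \<inter> (\<Inter>\<theta>\<in>{-pi..pi}. {\<Lambda>. M \<theta> \<bullet> \<Lambda> \<ge> -b})))"
    by (intro compact_Int_closed) auto
  then show ?thesis
    unfolding region_eq by (simp add: Int_ac)
qed

lemma convex_region: "convex (region R b)"
  unfolding region_eq
  by (intro convex_Int convex_INT convex_halfspace_ge convex_cball) (auto simp: V_def subspace_imp_convex)

lemma region_range:
  assumes S: "\<And>\<theta>. \<theta> \<in> {-pi..pi} \<Longrightarrow> norm (M \<theta>) \<le> S" and "\<Lambda> \<in> region R b" "\<theta> \<in> {-pi..pi}"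
  shows "\<Lambda> \<bullet> M \<theta> \<in> {-b..R * S}"
proof -
  have "\<Lambda> \<bullet> M \<theta> \<le> norm \<Lambda> * norm (M \<theta>)"
    by (rule norm_cauchy_schwarz)
  also have "\<dots> \<le> R * S"
  proof (rule mult_mono)
    show norm_le: "norm \<Lambda> \<le> R" using assms by (simp add: region_def)
    show "norm (M \<theta>) \<le> S" using assms by simp
    show "0 \<le> R" using norm_le norm_ge_zero order_trans by blast
  qed simp
  finally show ?thesis using assms by (auto simp: region_def)
qed

text \<open>Test the variational inequality with \<open>0\<close> and, when no constraint is active, with a small step
  against the residual, which lies in \<open>V\<close>.\<close>

lemma solution_if_interior:
  assumes cont: "\<And>T. continuous_on {-b..T} g" and b: "0 \<le> b" and R: "0 < R"
  obtains \<Lambda> where "\<Lambda> \<in> region R b"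
    "(LINT \<theta>|angle. (\<phi> \<theta> - \<psi> \<theta> * g (\<Lambda> \<bullet> M \<theta>)) * (\<Lambda> \<bullet> M \<theta>)) \<le> 0"
    "norm \<Lambda> < R \<Longrightarrow> (\<And>\<theta>. \<theta> \<in> {-pi..pi} \<Longrightarrow> -b < \<Lambda> \<bullet> M \<theta>) \<Longrightarrow> residual g \<Lambda> = 0"
proof -
  obtain S where S: "0 < S" "\<And>\<theta>. \<theta> \<in> {-pi..pi} \<Longrightarrow> norm (M \<theta>) \<le> S"
    using M_bounded by blast
  note range = region_range[of S _ R b, OF S(2)]
  have 0: "0 \<in> region R b"
    using b R by (auto simp: region_def V_def span_0)
  obtain \<Lambda> where \<Lambda>: "\<Lambda> \<in> region R b"
    and vi: "\<And>x. x \<in> region R b \<Longrightarrow> 0 \<le> residual g \<Lambda> \<bullet> (x - \<Lambda>)"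
    using variational_inequality[OF cont[of "R * S"] _ range compact_region convex_region] 0 by blast
  let ?F = "residual g \<Lambda>"
  have F: "?F \<in> V"
    by (rule residual_in_V[OF cont[of "R * S"] _ range]) (use \<Lambda> in auto)
  show thesis
  proof (rule that[OF \<Lambda>])
    have "?F \<bullet> \<Lambda> \<le> 0"
      using vi[OF 0] by simp
    then show "(LINT \<theta>|angle. (\<phi> \<theta> - \<psi> \<theta> * g (\<Lambda> \<bullet> M \<theta>)) * (\<Lambda> \<bullet> M \<theta>)) \<le> 0"
      using residual_inner[OF cont[of "R * S"], of \<Lambda> \<Lambda>] range \<Lambda> by auto
  next
    assume R': "norm \<Lambda> < R" and pos: "\<And>\<theta>. \<theta> \<in> {-pi..pi} \<Longrightarrow> -b < \<Lambda> \<bullet> M \<theta>"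
    have "continuous_on {-pi..pi} (\<lambda>\<theta>. \<Lambda> \<bullet> M \<theta>)"
      by (intro continuous_intros continuous_M)
    then obtain \<epsilon> where \<epsilon>: "0 < \<epsilon>" "\<And>\<theta>. \<theta> \<in> {-pi..pi} \<Longrightarrow> -b + \<epsilon> \<le> \<Lambda> \<bullet> M \<theta>"
      using continuous_margin pos by metis
    \<comment> \<open>The step has length at most \<open>R - norm \<Lambda>\<close>, the slack in
      the norm bound, and at most \<open>\<epsilon> / S\<close>, so that no
      \<open>\<Lambda> \<bullet> M \<theta>\<close> drops by more than \<open>\<epsilon>\<close>.
      The summand 1 keeps the denominator positive when the residual is 0.\<close>
    define s where "s = min (R - norm \<Lambda>) (\<epsilon> / S) / (norm ?F + 1)"
    have s: "0 < s"
      unfolding s_def using R' \<epsilon> S by (intro divide_pos_pos) (auto simp: add_nonneg_pos)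
    have "s * norm ?F \<le> s * (norm ?F + 1)"
      using s by simp
    also have "\<dots> = min (R - norm \<Lambda>) (\<epsilon> / S)"
      unfolding s_def by (simp add: add_nonneg_eq_0_iff)
    finally have sF: "s * norm ?F \<le> R - norm \<Lambda>" "s * norm ?F \<le> \<epsilon> / S"
      by auto
    have "\<Lambda> - s *\<^sub>R ?F \<in> region R b"
      unfolding region_def mem_Collect_eq
    proof (intro conjI ballI)
      show "\<Lambda> - s *\<^sub>R ?F \<in> V"
        using F \<Lambda> unfolding region_def V_def by (auto intro: span_diff span_scale)
      show "norm (\<Lambda> - s *\<^sub>R ?F) \<le> R"
        using norm_triangle_ineq4[of \<Lambda> "s *\<^sub>R ?F"] sF s by simp
      fix \<theta> assume \<theta>: "\<theta> \<in> {-pi..pi}"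
      have "(s *\<^sub>R ?F) \<bullet> M \<theta> \<le> norm (s *\<^sub>R ?F) * norm (M \<theta>)"
        by (rule norm_cauchy_schwarz)
      also have "\<dots> \<le> (\<epsilon> / S) * S"
        using sF(2) s S(2)[OF \<theta>] by (intro mult_mono) (use \<epsilon>(1) S(1) in auto)
      also have "\<dots> = \<epsilon>" using S by simp
      finally show "-b \<le> (\<Lambda> - s *\<^sub>R ?F) \<bullet> M \<theta>"
        using \<epsilon>(2)[OF \<theta>] by (simp add: inner_diff_left)
    qed
    from vi[OF this] have "s * (?F \<bullet> ?F) \<le> 0"
      by simp
    then show "?F = 0"
      using s inner_ge_zero[of ?F] by (auto simp: mult_le_0_iff order_antisym_conv)
  qed
qed

text \<open>The integral is absolutely homogeneous and continuous on the unit sphere of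
  \<open>V\<close>, and it is positive there: if it vanishes, \<Lambda> is orthogonal to every
  \<open>M \<theta>\<close>, hence to all of \<open>V\<close> and to itself. Its minimum on the
  compact sphere is the constant.\<close>

lemma norm_le_integral_abs:
  obtains c where "0 < c" "\<And>\<Lambda>. \<Lambda> \<in> V \<Longrightarrow> c * norm \<Lambda> \<le> (LINT \<theta>|angle. \<bar>\<Lambda> \<bullet> M \<theta>\<bar>)"
proof -
  let ?N = "\<lambda>\<Lambda>. LINT \<theta>|angle. \<bar>\<Lambda> \<bullet> M \<theta>\<bar>"
  let ?S = "V \<inter> sphere 0 1"
  have int: "integrable angle (\<lambda>\<theta>. \<bar>\<Lambda> \<bullet> M \<theta>\<bar>)" for \<Lambda>
    by (intro integrable_angle_continuous continuous_intros continuous_M)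
  have scale: "?N (r *\<^sub>R \<Lambda>) = \<bar>r\<bar> * ?N \<Lambda>" for r \<Lambda>
    by (simp add: abs_mult)
  obtain S where S: "0 < S" "\<And>\<theta>. \<theta> \<in> {-pi..pi} \<Longrightarrow> norm (M \<theta>) \<le> S"
    using M_bounded by blast
  have cont: "continuous_on ?S ?N"
    unfolding continuous_on_sequentially
  proof (intro allI ballI impI, elim conjE)
    fix X \<Lambda> assume \<Lambda>: "\<Lambda> \<in> ?S" and X: "\<forall>n. X n \<in> ?S" "X \<longlonglongrightarrow> \<Lambda>"
    show "(?N \<circ> X) \<longlonglongrightarrow> ?N \<Lambda>"
      unfolding o_def
    proof (rule integral_dominated_convergence[where w = "\<lambda>_. S"])
      show "integrable angle (\<lambda>_. S)"
        by (rule integrable_angle_bounded[where C = "\<bar>S\<bar>"]) auto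
      show "AE \<theta> in angle. (\<lambda>i. \<bar>X i \<bullet> M \<theta>\<bar>) \<longlonglongrightarrow> \<bar>\<Lambda> \<bullet> M \<theta>\<bar>"
        using X by (auto intro!: AE_I2 tendsto_intros)
      show "AE \<theta> in angle. norm \<bar>X i \<bullet> M \<theta>\<bar> \<le> S" for i
      proof (rule AE_I2)
        fix \<theta> assume "\<theta> \<in> space angle"
        then have *: "\<theta> \<in> {-pi..pi}" by auto
        have "\<bar>X i \<bullet> M \<theta>\<bar> \<le> norm (X i) * norm (M \<theta>)"
          by (rule Cauchy_Schwarz_ineq2)
        also have "norm (X i) = 1" using X by auto
        finally show "norm \<bar>X i \<bullet> M \<theta>\<bar> \<le> S"
          using S(2)[OF *] by auto
      qed
    qed measurable
  qed
  have pos: "0 < ?N \<Lambda>" if "\<Lambda> \<in> V" "\<Lambda> \<noteq> 0" for \<Lambda>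
  proof (rule ccontr)
    assume "\<not> 0 < ?N \<Lambda>"
    moreover have "0 \<le> ?N \<Lambda>" by simp
    ultimately have "?N \<Lambda> = 0" by simp
    have "\<bar>\<Lambda> \<bullet> M \<theta>\<bar> = 0" if "\<theta> \<in> {-pi..pi}" for \<theta>
      by (rule continuous_eq_0_if_integral_angle_eq_0[OF _ _ \<open>?N \<Lambda> = 0\<close> that])
         (auto intro!: continuous_intros continuous_M)
    then have "orthogonal \<Lambda> x" if "x \<in> V" for x
      using that unfolding V_def by (intro orthogonal_to_span[OF that[unfolded V_def]]) (auto simp: orthogonal_def)
    from this[OF \<open>\<Lambda> \<in> V\<close>] show False using \<open>\<Lambda> \<noteq> 0\<close> by (simp add: orthogonal_def)
  qed
  have "compact ?S"
    by (intro closed_Int_compact) (auto simp: V_def)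
  show thesis
  proof (cases "?S = {}")
    \<comment> \<open>\<open>V\<close> may be the zero space; then the sphere is empty and any
      positive constant serves.\<close>
    case True
    have "\<Lambda> = 0" if "\<Lambda> \<in> V" for \<Lambda>
    proof (rule ccontr)
      assume "\<Lambda> \<noteq> 0"
      then have "(1 / norm \<Lambda>) *\<^sub>R \<Lambda> \<in> ?S"
        using that unfolding V_def by (auto intro: span_scale)
      then show False using True by blast
    qed
    then have "1 * norm \<Lambda> \<le> ?N \<Lambda>" if "\<Lambda> \<in> V" for \<Lambda>
      using that by fastforce
    then show thesis using that[of 1] by simp
  next
    case False
    then obtain \<Lambda>0 where \<Lambda>0: "\<Lambda>0 \<in> ?S" "\<And>\<Lambda>. \<Lambda> \<in> ?S \<Longrightarrow> ?N \<Lambda>0 \<le> ?N \<Lambda>"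
      using continuous_attains_inf[OF \<open>compact ?S\<close> False cont] by blast
    show thesis
    proof (rule that[of "?N \<Lambda>0"])
      show "0 < ?N \<Lambda>0" using \<Lambda>0 by (intro pos) auto
      fix \<Lambda> assume "\<Lambda> \<in> V"
      show "?N \<Lambda>0 * norm \<Lambda> \<le> ?N \<Lambda>"
      proof (cases "\<Lambda> = 0")
        case False
        then have "(1 / norm \<Lambda>) *\<^sub>R \<Lambda> \<in> ?S"
          using \<open>\<Lambda> \<in> V\<close> unfolding V_def by (auto intro: span_scale)
        from \<Lambda>0(2)[OF this] show ?thesis
          using False unfolding scale by (simp add: field_simps)
      qed simp
    qed
  qed
qed

end

section \<open>Lower bounds for reciprocals and for the tested dual gradient\<close>

lemma measure_angle [simp]: "measure angle {-pi..<pi} = 2 * pi"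
  by (simp add: measure_restrict_space)

lemma integral_angle_const: "(LINT \<theta>|angle. (c::real)) = 2 * pi * c"
  by simp

text \<open>A quantitative form of the divergence of the integral of 1/|t| at 0: for fixed
  \<open>D\<close> the lower bound tends to infinity as \<open>\<epsilon>\<close> tends to
  0.\<close>

lemma integral_inverse_lipschitz_ge:
  fixes w :: "real \<Rightarrow> real"
  assumes cont: "continuous_on {-pi..pi} w" and pos: "\<And>\<theta>. \<theta> \<in> {-pi..pi} \<Longrightarrow> 0 < w \<theta>"
    and t: "t \<in> {-pi..pi}" and D: "0 < D" and \<epsilon>: "0 < \<epsilon>"
    and le: "\<And>\<theta>. \<theta> \<in> {-pi..pi} \<Longrightarrow> w \<theta> \<le> \<epsilon> + D * \<bar>\<theta> - t\<bar>"
  shows "ln (1 + D * pi / \<epsilon>) / D \<le> (LINT \<theta>|angle. 1 / w \<theta>)"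
proof -
  \<comment> \<open>One side of \<open>t\<close> is enough. Depending on its sign, the interval of
    length pi to the right or to the left of \<open>t\<close> fits into the domain.\<close>
  define a where "a = (if t \<le> 0 then t else t - pi)"
  have a: "{a..a + pi} \<subseteq> {-pi..pi}"
    using t by (auto simp: a_def)
  have ne: "w \<theta> \<noteq> 0" if "\<theta> \<in> {-pi..pi}" for \<theta>
    using pos[OF that] by simp
  have contw: "continuous_on {-pi..pi} (\<lambda>\<theta>. 1 / w \<theta>)"
    using ne by (intro continuous_intros cont) auto
  have ln_eq: "ln (\<epsilon> + D * pi) / D - ln \<epsilon> / D = ln (1 + D * pi / \<epsilon>) / D"
  proof -
    have "1 + D * pi / \<epsilon> = (\<epsilon> + D * pi) / \<epsilon>" using \<epsilon> by (simp add: field_simps)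
    then have "ln (1 + D * pi / \<epsilon>) = ln (\<epsilon> + D * pi) - ln \<epsilon>"
      using \<epsilon> D by (metis ln_divide_pos add_pos_pos mult_pos_pos pi_gt_zero)
    then show ?thesis by (simp add: diff_divide_distrib)
  qed
  have "((\<lambda>\<theta>. 1 / (\<epsilon> + D * \<bar>\<theta> - t\<bar>)) has_integral ln (1 + D * pi / \<epsilon>) / D) {a..a + pi}"
  proof (cases "t \<le> 0")
    case True
    have "((\<lambda>\<theta>. 1 / (\<epsilon> + D * (\<theta> - t))) has_integral
        ln (\<epsilon> + D * (t + pi - t)) / D - ln (\<epsilon> + D * (t - t)) / D) {t..t + pi}"
    proof (rule fundamental_theorem_of_calculus)
      fix x assume "x \<in> {t..t + pi}"
      then have "0 < \<epsilon> + D * (x - t)" using \<epsilon> D by (simp add: add_pos_nonneg)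
      then have "((\<lambda>\<theta>. ln (\<epsilon> + D * (\<theta> - t)) / D) has_real_derivative 1 / (\<epsilon> + D * (x - t))) (at x)"
        using D by (auto intro!: derivative_eq_intros)
      then show "((\<lambda>\<theta>. ln (\<epsilon> + D * (\<theta> - t)) / D) has_vector_derivative 1 / (\<epsilon> + D * (x - t)))
          (at x within {t..t + pi})"
        using has_field_derivative_at_within has_real_derivative_iff_has_vector_derivative by blast
    qed simp
    then have "((\<lambda>\<theta>. 1 / (\<epsilon> + D * (\<theta> - t))) has_integral ln (1 + D * pi / \<epsilon>) / D) {t..t + pi}"
      using ln_eq by simp
    moreover have "a = t" using True by (simp add: a_def)
    ultimately show ?thesis
      by (auto elim!: has_integral_eq[rotated])
  next
    case False
    have "((\<lambda>\<theta>. 1 / (\<epsilon> + D * (t - \<theta>))) has_integral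
        - ln (\<epsilon> + D * (t - t)) / D - - ln (\<epsilon> + D * (t - (t - pi))) / D) {t - pi..t}"
    proof (rule fundamental_theorem_of_calculus)
      fix x assume "x \<in> {t - pi..t}"
      then have "0 < \<epsilon> + D * (t - x)" using \<epsilon> D by (simp add: add_pos_nonneg)
      then have "((\<lambda>\<theta>. - ln (\<epsilon> + D * (t - \<theta>)) / D) has_real_derivative 1 / (\<epsilon> + D * (t - x))) (at x)"
        using D by (auto intro!: derivative_eq_intros)
      then show "((\<lambda>\<theta>. - ln (\<epsilon> + D * (t - \<theta>)) / D) has_vector_derivative 1 / (\<epsilon> + D * (t - x)))
          (at x within {t - pi..t})"
        using has_field_derivative_at_within has_real_derivative_iff_has_vector_derivative by blast
    qed simp
    then have "((\<lambda>\<theta>. 1 / (\<epsilon> + D * (t - \<theta>))) has_integral ln (1 + D * pi / \<epsilon>) / D) {t - pi..t}"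
      using ln_eq by simp
    moreover have "a = t - pi" using False by (simp add: a_def)
    ultimately show ?thesis
      by (auto elim!: has_integral_eq[rotated])
  qed
  then have int: "(\<lambda>\<theta>. 1 / (\<epsilon> + D * \<bar>\<theta> - t\<bar>)) integrable_on {a..a + pi}"
    and "ln (1 + D * pi / \<epsilon>) / D = integral {a..a + pi} (\<lambda>\<theta>. 1 / (\<epsilon> + D * \<bar>\<theta> - t\<bar>))"
    by (auto simp: integral_unique)
  note this(2)
  also have "\<dots> \<le> integral {a..a + pi} (\<lambda>\<theta>. 1 / w \<theta>)"
  proof (rule integral_le[OF int])
    show "(\<lambda>\<theta>. 1 / w \<theta>) integrable_on {a..a + pi}"
      using contw a by (intro integrable_continuous_real) (rule continuous_on_subset)
    fix \<theta> assume "\<theta> \<in> {a..a + pi}"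
    then have "\<theta> \<in> {-pi..pi}" using a by blast
    then show "1 / (\<epsilon> + D * \<bar>\<theta> - t\<bar>) \<le> 1 / w \<theta>"
      using pos le by (intro divide_left_mono) (auto intro!: mult_pos_pos order.strict_trans2[OF pos le])
  qed
  also have "\<dots> \<le> integral {-pi..pi} (\<lambda>\<theta>. 1 / w \<theta>)"
    using a contw pos
    by (intro integral_subset_le integrable_continuous_real) (auto intro: continuous_on_subset less_imp_le)
  also have "\<dots> = (LINT \<theta>|angle. 1 / w \<theta>)"
    by (rule integral_angle_eq_integral[OF integrable_angle_continuous[OF contw], symmetric])
  finally show ?thesis .
qed

text \<open>With t = k (w - 1) this bounds the integrand of the tested residual up to the factor k.
  Replacing w ^ k by w only decreases (1 - w) / w ^ k, on either side of w = 1. Then \<phi> w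
  supplies the growth at infinity, \<psi> / w the barrier at 0, and the remaining terms cost at most
  hi each.\<close>

lemma power_gradient_ge:
  fixes w :: real
  assumes w: "0 < w" and k: "1 \<le> k" and lo: "0 < lo"
    and \<phi>: "lo \<le> \<phi>" "\<phi> \<le> hi" and \<psi>: "lo \<le> \<psi>" "\<psi> \<le> hi"
  shows "lo * (w + 1 / w) - 2 * hi \<le> (\<phi> - \<psi> * (1 / w ^ k)) * (w - 1)"
proof -
  have "1 / w - 1 \<le> (1 / w ^ k) * (1 - w)"
  proof (cases "w \<le> 1")
    case True
    then have "w ^ k \<le> w" using power_decreasing[of 1 k w] w k by simp
    then have "1 / w \<le> 1 / w ^ k" using w by (intro divide_left_mono) auto
    then have "(1 / w) * (1 - w) \<le> (1 / w ^ k) * (1 - w)"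
      using True by (intro mult_right_mono) auto
    then show ?thesis using w by (simp add: field_simps)
  next
    case False
    then have "w \<le> w ^ k" using power_increasing[of 1 k w] w k by simp
    then have "1 / w ^ k \<le> 1 / w" using w by (intro divide_left_mono) auto
    then have "(1 / w) * (1 - w) \<le> (1 / w ^ k) * (1 - w)"
      using False by (intro mult_right_mono_neg) auto
    then show ?thesis using w by (simp add: field_simps)
  qed
  then have "\<psi> * (1 / w - 1) \<le> \<psi> * ((1 / w ^ k) * (1 - w))"
    using lo \<psi> by (intro mult_left_mono) auto
  moreover have "lo * w \<le> \<phi> * w" "lo * (1 / w) \<le> \<psi> * (1 / w)"
    using w \<phi> \<psi> by (intro mult_right_mono; simp)+
  moreover have "(\<phi> - \<psi> * x) * (w - 1) = \<phi> * w - \<phi> + \<psi> * (x * (1 - w))" for x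
    by (simp add: algebra_simps)
  from this[of "1 / w ^ k"]
  have "(\<phi> - \<psi> * (1 / w ^ k)) * (w - 1) = \<phi> * w - \<phi> + \<psi> * ((1 / w ^ k) * (1 - w))" .
  moreover have "lo * (w + 1 / w) = lo * w + lo * (1 / w)" "\<psi> * (1 / w - 1) = \<psi> * (1 / w) - \<psi>"
    by (simp_all add: algebra_simps)
  ultimately show ?thesis
    using \<phi> \<psi> by linarith
qed

text \<open>For t \<ge> 0 the term \<phi> t grows while t exp (- t) stays below 1. For t < 0 the
  exponential is bounded below by its tangent, which already gives a quadratic term that beats the
  linear one.\<close>

lemma exp_gradient_ge:
  fixes t :: real
  assumes lo: "0 < lo" and \<phi>: "lo \<le> \<phi>" "\<phi> \<le> hi" and \<psi>: "lo \<le> \<psi>" "\<psi> \<le> hi"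
  shows "lo * \<bar>t\<bar> - (hi + hi\<^sup>2 / lo) \<le> (\<phi> - \<psi> * exp (- t)) * t"
proof (cases "0 \<le> t")
  case True
  have "t * exp (- t) \<le> 1"
  proof -
    have "t \<le> exp t" using exp_ge_add_one_self[of t] by linarith
    then show ?thesis by (simp add: exp_minus field_simps)
  qed
  then have "\<psi> * (t * exp (- t)) \<le> hi * 1"
    using True lo \<psi> by (intro mult_mono) auto
  moreover have "lo * t \<le> \<phi> * t" using True \<phi> by (intro mult_right_mono)
  moreover have "0 \<le> hi\<^sup>2 / lo" using lo by simp
  ultimately show ?thesis using True by (simp add: algebra_simps)
next
  case False
  define u where "u = - t"
  have u: "0 < u" using False by (simp add: u_def)
  have "lo * (1 + u) \<le> \<psi> * exp u"
    using u lo \<psi> by (intro mult_mono exp_ge_add_one_self) auto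
  then have main: "(lo * (1 + u) - hi) * u \<le> (\<psi> * exp u - \<phi>) * u"
    using u \<phi> by (intro mult_right_mono) auto
  \<comment> \<open>Completing the square absorbs the linear term in \<open>u\<close>; the constant
    \<open>hi\<^sup>2 / lo\<close> originates here.\<close>
  have "0 \<le> (lo * u - hi)\<^sup>2 / lo" using lo by simp
  moreover have "(lo * u - hi)\<^sup>2 / lo = lo * u\<^sup>2 - 2 * hi * u + hi\<^sup>2 / lo"
    using lo by (simp add: power2_eq_square right_diff_distrib left_diff_distrib
        diff_divide_distrib add_divide_distrib)
  ultimately have "0 \<le> lo * u\<^sup>2 - 2 * hi * u + hi\<^sup>2 / lo"
    by linarith
  moreover have "0 \<le> lo * u\<^sup>2" using lo by simp
  moreover have "0 < hi" "0 \<le> hi\<^sup>2 / lo" "0 < hi * u" using lo \<phi> u by auto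
  moreover have "(lo * (1 + u) - hi) * u = lo * u + lo * u\<^sup>2 - hi * u"
    by (simp add: algebra_simps power2_eq_square)
  ultimately have "lo * u - (hi + hi\<^sup>2 / lo) \<le> (\<psi> * exp u - \<phi>) * u"
    using main by linarith
  then show ?thesis using False by (simp add: u_def algebra_simps)
qed

section \<open>A priori bounds and solvability of the moment equations\<close>

context moment_problem begin

text \<open>The majorant \<open>u\<close> will be w + 1/w for finite \<nu> and
  \<open>\<bar>\<Lambda> \<bullet> M \<theta>\<bar>\<close> itself in the exponential case.\<close>

lemma norm_le_of_integral_bound:
  assumes c: "0 < c" "c * norm \<Lambda> \<le> (LINT \<theta>|angle. \<bar>\<Lambda> \<bullet> M \<theta>\<bar>)"
    and bound: "\<And>\<theta>. \<theta> \<in> {-pi..pi} \<Longrightarrow> \<bar>\<Lambda> \<bullet> M \<theta>\<bar> \<le> r * u \<theta> + s"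
    and u: "integrable angle u" "(LINT \<theta>|angle. u \<theta>) \<le> C" and "0 \<le> r"
  shows "norm \<Lambda> \<le> (r * C + 2 * pi * s) / c"
proof -
  have s: "integrable angle (\<lambda>_. s)"
    by (rule integrable_angle_continuous) auto
  have "c * norm \<Lambda> \<le> (LINT \<theta>|angle. r * u \<theta> + s)"
    by (rule order_trans[OF c(2)], rule integral_mono)
       (use bound u s in \<open>auto intro!: integrable_angle_continuous continuous_intros continuous_M\<close>)
  also have "\<dots> = r * (LINT \<theta>|angle. u \<theta>) + 2 * pi * s"
    using u s by simp
  also have "\<dots> \<le> r * C + 2 * pi * s"
    using u \<open>0 \<le> r\<close> by (intro add_mono mult_left_mono) auto
  finally show ?thesis using c by (simp add: field_simps)
qed

text \<open>The margin \<open>\<epsilon>\<close> is delivered together with the solution because the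
  moment equation alone does not exclude zeros or sign changes of 1 + \<Lambda> \<bullet> M / k, and
  the resulting density has to be positive.\<close>

lemma moment_equation_power:
  fixes k :: nat
  assumes k: "1 \<le> k"
  obtains \<Lambda> \<epsilon> where "0 < \<epsilon>" "\<And>\<theta>. \<theta> \<in> {-pi..pi} \<Longrightarrow> \<epsilon> \<le> 1 + \<Lambda> \<bullet> M \<theta> / k"
    "residual (\<lambda>t. 1 / (1 + t / k) ^ k) \<Lambda> = 0"
proof -
  let ?g = "\<lambda>t. 1 / (1 + t / k) ^ k"
  have kpos: "0 < real k" using k by simp
  have hi: "0 < hi" using \<phi>_bounds[of 0] lo_pos by (simp add: order.strict_trans2)
  have L: "0 \<le> L" using lipschitz lipschitz_on_nonneg by blast
  obtain c where c: "0 < c" "\<And>\<Lambda>. \<Lambda> \<in> V \<Longrightarrow> c * norm \<Lambda> \<le> (LINT \<theta>|angle. \<bar>\<Lambda> \<bullet> M \<theta>\<bar>)"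
    using norm_le_integral_abs by blast
  \<comment> \<open>Integrating \<open>power_gradient_ge\<close> over an interval of length 2 pi
    bounds lo times the integral of w + 1/w by 2 pi times 2 hi. Neither \<open>R\<close> nor
    \<open>\<epsilon>\<close> enters.\<close>
  define C where "C = 4 * pi * hi / lo"
  have C: "0 < C" using hi lo_pos by (simp add: C_def)
  \<comment> \<open>The bound for \<open>norm \<Lambda>\<close> that follows from \<open>C\<close>,
    plus 1 so that the norm constraint is strictly inactive.\<close>
  define R where "R = (k * C + 2 * pi * k) / c + 1"
  have R: "0 < R" using C c kpos by (simp add: R_def add_nonneg_pos)
  \<comment> \<open>A Lipschitz constant of w valid for every multiplier of norm at most
    \<open>R\<close>; the summand 1 makes it positive even if \<open>L\<close> is 0.\<close>
  define D where "D = R * L / k + 1"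
  have D: "0 < D" using R L kpos by (simp add: D_def add_nonneg_pos)
  \<comment> \<open>Solved from ln (1 + D pi / \<epsilon>) / D \<ge> C + 1, which contradicts the
    integral bound \<open>C\<close>. Staying below 1 keeps \<open>b\<close> nonnegative, so that 0
    satisfies the constraints. The \<open>b\<close> below is chosen so that t \<ge> -b means 1 + t /
    k \<ge> \<epsilon>.\<close>
  define \<epsilon> where "\<epsilon> = min (1/2) (D * pi / exp (D * (C + 1)))"
  have \<epsilon>: "0 < \<epsilon>" "\<epsilon> < 1" using D by (auto simp: \<epsilon>_def)
  define b where "b = k * (1 - \<epsilon>)"
  have b: "0 \<le> b" using \<epsilon> kpos by (simp add: b_def)
  have pos: "\<epsilon> \<le> 1 + t / k" if "-b \<le> t" for t
    using that kpos by (simp add: b_def field_simps)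
  have cont: "continuous_on {-b..T} ?g" for T
    using \<epsilon> kpos by (intro continuous_intros) (auto dest!: pos)
  obtain \<Lambda> where \<Lambda>: "\<Lambda> \<in> region R b"
    and le0: "(LINT \<theta>|angle. (\<phi> \<theta> - \<psi> \<theta> * ?g (\<Lambda> \<bullet> M \<theta>)) * (\<Lambda> \<bullet> M \<theta>)) \<le> 0"
    and sol: "norm \<Lambda> < R \<Longrightarrow> (\<And>\<theta>. \<theta> \<in> {-pi..pi} \<Longrightarrow> -b < \<Lambda> \<bullet> M \<theta>) \<Longrightarrow> residual ?g \<Lambda> = 0"
    using solution_if_interior[OF cont b R] by blast
  define w where "w \<theta> = 1 + \<Lambda> \<bullet> M \<theta> / k" for \<theta>
  have M_eq: "\<Lambda> \<bullet> M \<theta> = k * (w \<theta> - 1)" for \<theta> using kpos by (simp add: w_def)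
  have w: "\<epsilon> \<le> w \<theta>" if "\<theta> \<in> {-pi..pi}" for \<theta>
    using \<Lambda> that unfolding w_def region_def by (intro pos) auto
  have w0: "0 < w \<theta>" if "\<theta> \<in> {-pi..pi}" for \<theta>
    using w[OF that] \<epsilon> by simp
  have contw: "continuous_on {-pi..pi} w"
    unfolding w_def using kpos by (intro continuous_intros continuous_M) auto
  have contw': "continuous_on {-pi..pi} (\<lambda>\<theta>. 1 / w \<theta>)"
    using w0 by (intro continuous_intros contw) force
  have int: "integrable angle (\<lambda>\<theta>. w \<theta> + 1 / w \<theta>)" "integrable angle w" "integrable angle (\<lambda>\<theta>. 1 / w \<theta>)"
    by (intro integrable_angle_continuous continuous_intros contw contw')+
  obtain S where S: "0 < S" "\<And>\<theta>. \<theta> \<in> {-pi..pi} \<Longrightarrow> norm (M \<theta>) \<le> S"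
    using M_bounded by blast
  \<comment> \<open>The right-hand side is the residual tested with \<Lambda>, nonpositive by the
    variational inequality at 0; the pointwise bound turns this into a bound on w + 1/w.\<close>
  have "(LINT \<theta>|angle. k * (lo * (w \<theta> + 1 / w \<theta>) - 2 * hi))
      \<le> (LINT \<theta>|angle. (\<phi> \<theta> - \<psi> \<theta> * ?g (\<Lambda> \<bullet> M \<theta>)) * (\<Lambda> \<bullet> M \<theta>))"
  proof (rule integral_mono)
    show "integrable angle (\<lambda>\<theta>. k * (lo * (w \<theta> + 1 / w \<theta>) - 2 * hi))"
      by (intro integrable_angle_continuous continuous_intros contw contw')
    have "integrable angle (\<lambda>\<theta>. (\<phi> \<theta> - \<psi> \<theta> * ?g (\<Lambda> \<bullet> M \<theta>)) *\<^sub>R (\<Lambda> \<bullet> M \<theta>))"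
      using region_range[OF S(2) \<Lambda>]
      by (intro weighted_integrable[OF cont[of "R * S"], where H = "max (R * S) b"]) force+
    then show "integrable angle (\<lambda>\<theta>. (\<phi> \<theta> - \<psi> \<theta> * ?g (\<Lambda> \<bullet> M \<theta>)) * (\<Lambda> \<bullet> M \<theta>))"
      by simp
    fix \<theta> assume "\<theta> \<in> space angle"
    then have *: "\<theta> \<in> {-pi..pi}" by auto
    have "lo * (w \<theta> + 1 / w \<theta>) - 2 * hi \<le> (\<phi> \<theta> - \<psi> \<theta> * (1 / w \<theta> ^ k)) * (w \<theta> - 1)"
      using power_gradient_ge[OF w0[OF *] k lo_pos] \<phi>_bounds[OF *] \<psi>_bounds[OF *] by blast
    then have "k * (lo * (w \<theta> + 1 / w \<theta>) - 2 * hi) \<le> k * ((\<phi> \<theta> - \<psi> \<theta> * (1 / w \<theta> ^ k)) * (w \<theta> - 1))"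
      using kpos by (intro mult_left_mono) auto
    also have "\<dots> = (\<phi> \<theta> - \<psi> \<theta> * ?g (\<Lambda> \<bullet> M \<theta>)) * (\<Lambda> \<bullet> M \<theta>)"
      unfolding M_eq w_def[symmetric] using kpos by (simp add: mult_ac)
    finally show "k * (lo * (w \<theta> + 1 / w \<theta>) - 2 * hi)
        \<le> (\<phi> \<theta> - \<psi> \<theta> * ?g (\<Lambda> \<bullet> M \<theta>)) * (\<Lambda> \<bullet> M \<theta>)" .
  qed
  also note le0
  also have "(LINT \<theta>|angle. k * (lo * (w \<theta> + 1 / w \<theta>) - 2 * hi))
      = k * (lo * (LINT \<theta>|angle. w \<theta> + 1 / w \<theta>) - 2 * pi * (2 * hi))"
    using int integrable_angle_continuous[of "\<lambda>_. 2 * hi"] by simp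
  finally have "lo * (LINT \<theta>|angle. w \<theta> + 1 / w \<theta>) \<le> 2 * pi * (2 * hi)"
    using kpos by (simp add: mult_le_0_iff)
  then have intC: "(LINT \<theta>|angle. w \<theta> + 1 / w \<theta>) \<le> C"
    using lo_pos by (simp add: C_def field_simps)
  have "norm \<Lambda> \<le> (k * C + 2 * pi * k) / c"
  proof (rule norm_le_of_integral_bound[OF c(1) c(2) _ int(1) intC])
    show "\<Lambda> \<in> V" using \<Lambda> by (simp add: region_def)
    fix \<theta> assume \<theta>: "\<theta> \<in> {-pi..pi}"
    have "\<bar>w \<theta> - 1\<bar> \<le> w \<theta> + 1" using w0[OF \<theta>] by linarith
    also have "\<dots> \<le> (w \<theta> + 1 / w \<theta>) + 1" using w0[OF \<theta>] by simp
    finally have "k * \<bar>w \<theta> - 1\<bar> \<le> k * ((w \<theta> + 1 / w \<theta>) + 1)"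
      using kpos by (intro mult_left_mono) auto
    then show "\<bar>\<Lambda> \<bullet> M \<theta>\<bar> \<le> k * (w \<theta> + 1 / w \<theta>) + k"
      unfolding M_eq abs_mult distrib_left[of "real k" _ 1] using kpos by simp
  qed (use kpos in simp)
  then have "norm \<Lambda> < R" by (simp add: R_def)
  \<comment> \<open>An active constraint at \<open>t\<close> means w t \<le> \<epsilon>. By the
    Lipschitz bound w stays small near \<open>t\<close>, and the integral of 1/w would reach C +
    1.\<close>
  moreover have "-b < \<Lambda> \<bullet> M t" if t: "t \<in> {-pi..pi}" for t
  proof (rule ccontr)
    assume "\<not> -b < \<Lambda> \<bullet> M t"
    then have "w t \<le> \<epsilon>"
      using kpos by (simp add: w_def b_def field_simps)
    have lip: "w \<theta> \<le> \<epsilon> + D * \<bar>\<theta> - t\<bar>" if \<theta>: "\<theta> \<in> {-pi..pi}" for \<theta>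
    proof -
      have "\<Lambda> \<bullet> (M \<theta> - M t) \<le> norm \<Lambda> * norm (M \<theta> - M t)"
        by (rule norm_cauchy_schwarz)
      also have "\<dots> \<le> R * (L * \<bar>\<theta> - t\<bar>)"
        using lipschitz_onD[OF lipschitz \<theta> t] \<open>norm \<Lambda> < R\<close> R
        by (intro mult_mono) (auto simp: dist_norm)
      finally have "w \<theta> - w t \<le> (R * L / k) * \<bar>\<theta> - t\<bar>"
        using kpos by (simp add: w_def inner_diff_right field_simps)
      also have "\<dots> \<le> D * \<bar>\<theta> - t\<bar>"
        by (intro mult_right_mono) (auto simp: D_def)
      finally show ?thesis using \<open>w t \<le> \<epsilon>\<close> by linarith
    qed
    have "exp (D * (C + 1)) \<le> D * pi / \<epsilon>"
    proof -
      have "\<epsilon> * exp (D * (C + 1)) \<le> D * pi"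
        using \<epsilon>_def by (simp add: min_def field_simps split: if_splits)
      then show ?thesis using \<epsilon> by (simp add: field_simps)
    qed
    then have "exp (D * (C + 1)) \<le> 1 + D * pi / \<epsilon>" by simp
    then have "D * (C + 1) \<le> ln (1 + D * pi / \<epsilon>)"
      by (subst ln_ge_iff) (auto intro: less_le_trans[OF exp_gt_zero])
    then have "C + 1 \<le> ln (1 + D * pi / \<epsilon>) / D"
      using D by (simp add: field_simps)
    also have "\<dots> \<le> (LINT \<theta>|angle. 1 / w \<theta>)"
      by (rule integral_inverse_lipschitz_ge[OF contw w0 t D \<epsilon>(1) lip])
    also have "\<dots> \<le> (LINT \<theta>|angle. w \<theta> + 1 / w \<theta>)"
      by (rule integral_mono) (use int w0 in \<open>auto intro: less_imp_le\<close>)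
    also note intC
    finally show False by simp
  qed
  ultimately have "residual ?g \<Lambda> = 0" by (rule sol)
  then show thesis
    using that[of \<epsilon> \<Lambda>] \<epsilon> w by (simp add: w_def)
qed

text \<open>The exponential has no singularity, so the only danger is an unbounded multiplier, and
  the integral bound on \<open>\<bar>\<Lambda> \<bullet> M \<theta>\<bar>\<close> excludes
  it.\<close>

lemma moment_equation_exp:
  obtains \<Lambda> where "residual (\<lambda>t. exp (- t)) \<Lambda> = 0"
proof -
  let ?g = "\<lambda>t::real. exp (- t)"
  have hi: "0 < hi" using \<phi>_bounds[of 0] lo_pos by (simp add: order.strict_trans2)
  obtain c where c: "0 < c" "\<And>\<Lambda>. \<Lambda> \<in> V \<Longrightarrow> c * norm \<Lambda> \<le> (LINT \<theta>|angle. \<bar>\<Lambda> \<bullet> M \<theta>\<bar>)"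
    using norm_le_integral_abs by blast
  define K where "K = hi + hi\<^sup>2 / lo"
  define C where "C = 2 * pi * K / lo"
  have C: "0 < C" using hi lo_pos by (simp add: C_def K_def add_pos_pos)
  define R where "R = C / c + 1"
  have R: "0 < R" using C c by (simp add: R_def add_nonneg_pos)
  obtain S where S: "0 < S" "\<And>\<theta>. \<theta> \<in> {-pi..pi} \<Longrightarrow> norm (M \<theta>) \<le> S"
    using M_bounded by blast
  \<comment> \<open>With this value the lower constraint follows strictly from
    \<open>norm \<Lambda> < R\<close> by Cauchy-Schwarz, so it is never active by itself.\<close>
  define b where "b = R * S"
  have b: "0 \<le> b" using R S by (simp add: b_def)
  have cont: "continuous_on {-b..T} ?g" for T
    by (intro continuous_intros)
  obtain \<Lambda> where \<Lambda>: "\<Lambda> \<in> region R b"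
    and le0: "(LINT \<theta>|angle. (\<phi> \<theta> - \<psi> \<theta> * ?g (\<Lambda> \<bullet> M \<theta>)) * (\<Lambda> \<bullet> M \<theta>)) \<le> 0"
    and sol: "norm \<Lambda> < R \<Longrightarrow> (\<And>\<theta>. \<theta> \<in> {-pi..pi} \<Longrightarrow> -b < \<Lambda> \<bullet> M \<theta>) \<Longrightarrow> residual ?g \<Lambda> = 0"
    using solution_if_interior[OF cont b R] by blast
  have int: "integrable angle (\<lambda>\<theta>. \<bar>\<Lambda> \<bullet> M \<theta>\<bar>)"
    by (intro integrable_angle_continuous continuous_intros continuous_M)
  have "(LINT \<theta>|angle. lo * \<bar>\<Lambda> \<bullet> M \<theta>\<bar> - K)
      \<le> (LINT \<theta>|angle. (\<phi> \<theta> - \<psi> \<theta> * ?g (\<Lambda> \<bullet> M \<theta>)) * (\<Lambda> \<bullet> M \<theta>))"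
  proof (rule integral_mono)
    show "integrable angle (\<lambda>\<theta>. lo * \<bar>\<Lambda> \<bullet> M \<theta>\<bar> - K)"
      by (intro integrable_angle_continuous continuous_intros continuous_M)
    have "integrable angle (\<lambda>\<theta>. (\<phi> \<theta> - \<psi> \<theta> * ?g (\<Lambda> \<bullet> M \<theta>)) *\<^sub>R (\<Lambda> \<bullet> M \<theta>))"
      using region_range[OF S(2) \<Lambda>]
      by (intro weighted_integrable[OF cont[of "R * S"], where H = "max (R * S) b"]) force+
    then show "integrable angle (\<lambda>\<theta>. (\<phi> \<theta> - \<psi> \<theta> * ?g (\<Lambda> \<bullet> M \<theta>)) * (\<Lambda> \<bullet> M \<theta>))"
      by simp
    fix \<theta> assume "\<theta> \<in> space angle"
    then have *: "\<theta> \<in> {-pi..pi}" by auto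
    show "lo * \<bar>\<Lambda> \<bullet> M \<theta>\<bar> - K \<le> (\<phi> \<theta> - \<psi> \<theta> * ?g (\<Lambda> \<bullet> M \<theta>)) * (\<Lambda> \<bullet> M \<theta>)"
      unfolding K_def using \<phi>_bounds[OF *] \<psi>_bounds[OF *] by (intro exp_gradient_ge lo_pos) auto
  qed
  also note le0
  also have "(LINT \<theta>|angle. lo * \<bar>\<Lambda> \<bullet> M \<theta>\<bar> - K) = lo * (LINT \<theta>|angle. \<bar>\<Lambda> \<bullet> M \<theta>\<bar>) - 2 * pi * K"
    using int integrable_angle_continuous[of "\<lambda>_. K"] by simp
  finally have intC: "(LINT \<theta>|angle. \<bar>\<Lambda> \<bullet> M \<theta>\<bar>) \<le> C"
    using lo_pos by (simp add: C_def field_simps)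
  have "norm \<Lambda> \<le> (1 * C + 2 * pi * 0) / c"
    by (rule norm_le_of_integral_bound[OF c(1) c(2) _ int intC]) (use \<Lambda> in \<open>auto simp: region_def\<close>)
  then have R': "norm \<Lambda> < R" by (simp add: R_def)
  have "-b < \<Lambda> \<bullet> M \<theta>" if "\<theta> \<in> {-pi..pi}" for \<theta>
  proof -
    have "\<bar>\<Lambda> \<bullet> M \<theta>\<bar> \<le> norm \<Lambda> * norm (M \<theta>)"
      by (rule Cauchy_Schwarz_ineq2)
    also have "\<dots> \<le> norm \<Lambda> * S"
      using S(2)[OF that] by (intro mult_left_mono) auto
    also have "\<dots> < b"
      unfolding b_def using R' S by (intro mult_strict_right_mono)
    finally show ?thesis by linarith
  qed
  then show thesis using that sol[OF R'] by blast
qed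

end

section \<open>Filter banks and the moment map\<close>

lemma integral_angle_odd:
  fixes f :: "real \<Rightarrow> real"
  assumes f: "integrable angle f" and odd: "\<And>\<theta>. f (- \<theta>) = - f \<theta>"
  shows "(LINT \<theta>|angle. f \<theta>) = 0"
proof -
  have "integral {-pi..pi} f = integral {-pi..- (-pi)} (\<lambda>\<theta>. f (- \<theta>))"
    by (subst Henstock_Kurzweil_Integration.integral_reflect_real) simp
  also have "\<dots> = - integral {-pi..pi} f"
    by (simp add: odd)
  finally show ?thesis using integral_angle_eq_integral[OF f] by simp
qed

section \<open>Real linear and quadratic forms of complex vectors\<close>

definition re_mult :: "real^'n \<Rightarrow> complex^'n \<Rightarrow> complex" where
  "re_mult x v = (\<Sum>i\<in>UNIV. complex_of_real (x $ i) * v $ i)"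

lemma re_mult_diff_left: "re_mult (x - y) v = re_mult x v - re_mult y v"
  by (simp add: re_mult_def sum_subtractf algebra_simps)

lemma re_mult_scale_left: "re_mult (c *\<^sub>R x) v = complex_of_real c * re_mult x v"
  by (simp add: re_mult_def sum_distrib_left algebra_simps)

lemma norm_re_mult_le: "norm (re_mult (x :: real^'n) v) \<le> CARD('n) * norm x * norm v"
proof -
  have "norm (re_mult x v) \<le> (\<Sum>i\<in>(UNIV :: 'n set). norm x * norm v)"
    unfolding re_mult_def
  proof (rule sum_norm_le)
    fix i
    show "cmod (complex_of_real (x $ i) * v $ i) \<le> norm x * norm v"
      using component_le_norm_cart[of x i] Finite_Cartesian_Product.norm_nth_le[of v i]
      by (auto simp: norm_mult intro!: mult_mono)
  qed
  then show ?thesis by simp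
qed

lemma continuous_on_re_mult [continuous_intros]:
  "continuous_on S f \<Longrightarrow> continuous_on S (\<lambda>t. re_mult x (f t))"
  unfolding re_mult_def by (intro continuous_intros)

definition outer :: "real^'n \<Rightarrow> real^'n^'n" where
  "outer x = (\<chi> i j. x $ i * x $ j)"

text \<open>The real part of v v*. The imaginary part is antisymmetric, hence invisible to real
  quadratic forms, and for v = G it integrates to 0 against symmetric densities. The moment problem
  can thus be posed over real matrices with their Euclidean inner product.\<close>

definition gram :: "complex^'n \<Rightarrow> real^'n^'n" where
  "gram v = (\<chi> i j. Re (v $ i * cnj (v $ j)))"

lemma outer_inner_gram: "outer x \<bullet> gram v = (norm (re_mult x v))\<^sup>2"
proof -
  have "complex_of_real ((norm (re_mult x v))\<^sup>2) = re_mult x v * cnj (re_mult x v)"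
    by (rule complex_norm_square)
  also have "\<dots> = (\<Sum>i\<in>UNIV. \<Sum>j\<in>UNIV. complex_of_real (x $ i * x $ j) * (v $ i * cnj (v $ j)))"
    by (simp add: re_mult_def sum_product algebra_simps)
  finally have "(norm (re_mult x v))\<^sup>2
      = Re (\<Sum>i\<in>UNIV. \<Sum>j\<in>UNIV. complex_of_real (x $ i * x $ j) * (v $ i * cnj (v $ j)))"
    by (metis Re_complex_of_real)
  also have "\<dots> = (\<Sum>i\<in>UNIV. \<Sum>j\<in>UNIV. x $ i * x $ j * Re (v $ i * cnj (v $ j)))"
    by (simp only: Re_sum Re_complex_of_real scaleR_conv_of_real[symmetric] scaleR_complex.sel real_scaleR_def)
  also have "\<dots> = outer x \<bullet> gram v"
    by (simp add: inner_vec_def outer_def gram_def)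
  finally show ?thesis by simp
qed

lemma outer_inner_mat_1: "outer x \<bullet> mat 1 = x \<bullet> x"
proof -
  have "outer x \<bullet> mat 1 = (\<Sum>i\<in>UNIV. \<Sum>j\<in>UNIV. if j = i then x $ i * x $ j else 0)"
    unfolding inner_vec_def by (intro sum.cong refl) (auto simp: outer_def mat_def)
  then show ?thesis by (simp add: inner_vec_def)
qed

text \<open>Polarization: the quadratic form of the difference vanishes, and evaluating it at sums
  of two unit vectors gives twice an entry.\<close>

lemma symmetric_eq_if_outer_inner_eq:
  assumes N: "transpose N = N" and N': "transpose N' = N'" and eq: "\<And>x. outer x \<bullet> N = outer x \<bullet> N'"
  shows "(N :: real^'n^'n) = N'"
proof -
  define D where "D = N - N'"
  have sym: "D $ i $ j = D $ j $ i" for i j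
    using arg_cong[OF N, of "\<lambda>X. X $ i $ j"] arg_cong[OF N', of "\<lambda>X. X $ i $ j"]
    by (simp add: D_def transpose_def)
  define Q where "Q x y = (\<Sum>k\<in>UNIV. \<Sum>l\<in>UNIV. x $ k * y $ l * D $ k $ l)" for x y :: "real^'n"
  have Q: "Q x x = 0" for x
    using eq[of x] by (simp add: Q_def D_def inner_vec_def outer_def right_diff_distrib sum_subtractf)
  have add: "Q (x + y) (x + y) = Q x x + Q x y + Q y x + Q y y" for x y
    by (simp add: Q_def algebra_simps sum.distrib)
  have axis: "Q (axis i 1) (axis j 1) = D $ i $ j" for i j
  proof -
    have "Q (axis i 1) (axis j 1) = (\<Sum>k\<in>UNIV. \<Sum>l\<in>UNIV. if l = j then if k = i then D $ k $ l else 0 else 0)"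
      unfolding Q_def by (intro sum.cong refl) (auto simp: axis_def)
    then show ?thesis by simp
  qed
  have "D $ i $ j = 0" for i j
    using add[of "axis i 1" "axis j 1"] sym[of i j] by (simp only: Q axis)
  then have "D = 0" by (simp add: vec_eq_iff)
  then show ?thesis by (simp add: D_def)
qed

text \<open>What remains of \<open>S_plus\<close> without positivity. It holds for densities and for
  their linear combinations alike, so one set of integrability facts serves both.\<close>

definition bounded_symmetric :: "(complex \<Rightarrow> real) \<Rightarrow> bool" where
  "bounded_symmetric \<Phi> \<longleftrightarrow> (\<lambda>\<theta>. \<Phi> (cis \<theta>)) \<in> borel_measurable angle \<and>
     (\<forall>z. norm z = 1 \<longrightarrow> \<Phi> (cnj z) = \<Phi> z) \<and> (\<exists>C. \<forall>z. norm z = 1 \<longrightarrow> \<bar>\<Phi> z\<bar> \<le> C)"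

lemma bounded_symmetric_S_plus:
  assumes "\<Phi> \<in> S_plus" shows "bounded_symmetric \<Phi>"
proof -
  obtain \<mu> M where "0 < \<mu>" "\<And>z. norm z = 1 \<Longrightarrow> \<mu> \<le> \<Phi> z \<and> \<Phi> z \<le> M"
    using assms by (auto simp: S_plus_def)
  then have "\<forall>z. norm z = 1 \<longrightarrow> \<bar>\<Phi> z\<bar> \<le> M" by force
  then show ?thesis using assms unfolding bounded_symmetric_def S_plus_def by blast
qed

lemma bounded_symmetric_S_plus_span:
  assumes "\<Phi> \<in> S_plus_span" shows "bounded_symmetric \<Phi>"
proof -
  obtain \<F> c where F: "finite \<F>" "\<F> \<subseteq> S_plus" and \<Phi>: "\<Phi> = (\<lambda>z. \<Sum>F\<in>\<F>. c F * F z)"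
    using assms by (auto simp: S_plus_span_def)
  have bs: "bounded_symmetric F" if "F \<in> \<F>" for F
    using that F bounded_symmetric_S_plus by blast
  then obtain C where C: "\<And>F z. F \<in> \<F> \<Longrightarrow> norm z = 1 \<Longrightarrow> \<bar>F z\<bar> \<le> C F"
    unfolding bounded_symmetric_def by metis
  have "\<bar>\<Phi> z\<bar> \<le> (\<Sum>F\<in>\<F>. \<bar>c F\<bar> * C F)" if "norm z = 1" for z
    unfolding \<Phi> using C that
    by (intro order_trans[OF sum_abs] sum_mono) (auto simp: abs_mult intro: mult_left_mono)
  moreover have "\<Phi> (cnj z) = \<Phi> z" if "norm z = 1" for z
    unfolding \<Phi> using bs that by (intro sum.cong) (auto simp: bounded_symmetric_def)
  moreover have "(\<lambda>\<theta>. \<Phi> (cis \<theta>)) \<in> borel_measurable angle"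
    unfolding \<Phi> using bs
    by (intro borel_measurable_sum borel_measurable_times) (auto simp: bounded_symmetric_def)
  ultimately show ?thesis unfolding bounded_symmetric_def by blast
qed

lemma bounded_symmetric_integrable:
  fixes f :: "real \<Rightarrow> 'b::{banach, second_countable_topology}"
  assumes "bounded_symmetric \<Phi>" "continuous_on {-pi..pi} f"
  shows "integrable angle (\<lambda>\<theta>. \<Phi> (cis \<theta>) *\<^sub>R f \<theta>)"
proof -
  have "compact (f ` {-pi..pi})"
    using assms by (intro compact_continuous_image) auto
  then obtain S where S: "\<And>y. y \<in> f ` {-pi..pi} \<Longrightarrow> norm y \<le> S"
    using compact_imp_bounded bounded_iff by metis
  obtain C where C: "\<And>z. norm z = 1 \<Longrightarrow> \<bar>\<Phi> z\<bar> \<le> C"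
    using assms by (auto simp: bounded_symmetric_def)
  show ?thesis
  proof (rule integrable_angle_bounded)
    show "(\<lambda>\<theta>. \<Phi> (cis \<theta>) *\<^sub>R f \<theta>) \<in> borel_measurable angle"
      using assms borel_measurable_angle_continuous
      by (intro borel_measurable_scaleR) (auto simp: bounded_symmetric_def)
    fix \<theta> assume "\<theta> \<in> {-pi..<pi}"
    then have "norm (f \<theta>) \<le> S" using S by auto
    moreover have "\<bar>\<Phi> (cis \<theta>)\<bar> \<le> C" using C by simp
    ultimately show "norm (\<Phi> (cis \<theta>) *\<^sub>R f \<theta>) \<le> C * S"
      unfolding norm_scaleR by (intro mult_mono) (auto intro: order_trans[OF abs_ge_zero])
  qed
qed

section \<open>The transfer function on the unit circle\<close>

lemma norm_smult: "norm (z *s v) = norm z * norm (v :: complex^'n)"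
  by (simp add: norm_vec_def L2_set_def norm_mult power_mult_distrib real_sqrt_mult
      sum_distrib_left[symmetric])

locale stable_filter =
  fixes A :: "real^'n^'n" and B :: "real^'n"
  assumes stable: "eigenvalues_in_unit_disc A"
begin

abbreviation "G \<equiv> transfer_fun A B"

lemma mat_mult: "mat z *v v = (z :: complex) *s v"
proof -
  have "(mat z *v v) $ i = z * v $ i" for i
  proof -
    have "(mat z *v v) $ i = (\<Sum>j\<in>UNIV. mat z $ i $ j * v $ j)"
      by (simp add: matrix_vector_mult_def)
    also have "\<dots> = (\<Sum>j\<in>UNIV. if j = i then z * v $ j else 0)"
      by (intro sum.cong) (auto simp: mat_def)
    finally show ?thesis by simp
  qed
  then show ?thesis by (simp add: vec_eq_iff)
qed

text \<open>No eigenvalue lies on the circle, so the norm is positive on the compact product of the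
  circle with the unit sphere and attains a positive minimum. This one constant yields
  invertibility, uniqueness of the transfer equation, and boundedness and Lipschitz continuity of
  \<open>G\<close>.\<close>

lemma resolvent_lower_bound:
  obtains c where "0 < c" "\<And>z v. norm z = 1 \<Longrightarrow> c * norm v \<le> norm (z *s v - complex_mat A *v v)"
proof -
  define h where "h p = norm (fst p *s snd p - complex_mat A *v snd p)" for p :: "complex \<times> (complex^'n)"
  let ?S = "sphere (0::complex) 1 \<times> sphere (0::complex^'n) 1"
  have "continuous_on ?S h"
    unfolding h_def vector_scalar_mult_def matrix_vector_mult_def by (intro continuous_intros)
  moreover have "compact ?S" by (intro compact_Times) auto
  moreover have "?S \<noteq> {}"
  proof -
    have "(1, axis undefined 1) \<in> ?S" by auto
    then show ?thesis by blast
  qed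
  ultimately obtain p where p: "p \<in> ?S" "\<And>q. q \<in> ?S \<Longrightarrow> h p \<le> h q"
    using continuous_attains_inf by metis
  show thesis
  proof (rule that)
    show "0 < h p"
    proof (rule ccontr)
      assume "\<not> 0 < h p"
      then have "complex_mat A *v snd p = fst p *s snd p" by (simp add: h_def)
      moreover have "snd p \<noteq> 0" using p(1) by auto
      ultimately have "norm (fst p) < 1"
        using stable unfolding eigenvalues_in_unit_disc_def by blast
      then show False using p(1) by auto
    qed
    fix z :: complex and v :: "complex^'n" assume z: "norm z = 1"
    show "h p * norm v \<le> norm (z *s v - complex_mat A *v v)"
    proof (cases "v = 0")
      case False
      define u where "u = (1 / norm v) *\<^sub>R v"
      have "(z, u) \<in> ?S" using z False by (auto simp: u_def)
      then have "h p \<le> norm (z *s u - complex_mat A *v u)"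
        using p(2)[of "(z, u)"] by (simp add: h_def)
      also have "z *s u - complex_mat A *v u = (1 / norm v) *\<^sub>R (z *s v - complex_mat A *v v)"
        unfolding u_def
        by (simp add: vec_eq_iff matrix_vector_mult_def scaleR_diff_right scaleR_sum_right)
      finally have "h p \<le> norm (z *s v - complex_mat A *v v) / norm v"
        by (simp only: norm_scaleR) simp
      then show ?thesis using False by (simp add: field_simps)
    qed simp
  qed
qed

lemma resolvent_invertible:
  assumes "norm z = 1"
  shows "invertible (mat z - complex_mat A)"
proof -
  obtain c where c: "0 < c" "\<And>z v. norm z = 1 \<Longrightarrow> c * norm v \<le> norm (z *s v - complex_mat A *v v)"
    using resolvent_lower_bound by blast
  have "v = 0" if "(mat z - complex_mat A) *v v = 0" for v
  proof -
    have "z *s v - complex_mat A *v v = 0"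
      using that by (simp add: matrix_vector_mult_diff_rdistrib mat_mult)
    then have "c * norm v \<le> 0" using c(2)[OF assms, of v] by simp
    then show ?thesis using c(1) by (simp add: mult_le_0_iff)
  qed
  then show ?thesis
    by (simp add: invertible_left_inverse matrix_left_invertible_ker)
qed

lemma transfer_equation:
  assumes "norm z = 1"
  shows "z *s G z = complex_mat A *v G z + complex_vec B"
proof -
  let ?R = "mat z - complex_mat A"
  have "\<exists>R'. ?R ** R' = mat 1 \<and> R' ** ?R = mat 1"
    using resolvent_invertible[OF assms] by (simp add: invertible_def)
  then have "?R ** matrix_inv ?R = mat 1"
    unfolding matrix_inv_def by (rule someI2_ex) simp
  then have "?R *v G z = complex_vec B"
    by (simp add: transfer_fun_def matrix_vector_mul_assoc)
  then show ?thesis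
    by (simp add: matrix_vector_mult_diff_rdistrib mat_mult algebra_simps)
qed

lemma transfer_unique:
  assumes z: "norm z = 1" and v: "z *s v = complex_mat A *v v + complex_vec B"
  shows "v = G z"
proof -
  obtain c where c: "0 < c" "\<And>z v. norm z = 1 \<Longrightarrow> c * norm v \<le> norm (z *s v - complex_mat A *v v)"
    using resolvent_lower_bound by blast
  have "z *s (v - G z) - complex_mat A *v (v - G z) = 0"
    using v transfer_equation[OF z]
    by (simp add: vector_ssub_ldistrib matrix_vector_mult_diff_distrib algebra_simps)
  then have "c * norm (v - G z) \<le> 0" using c(2)[OF z, of "v - G z"] by simp
  then show ?thesis using c(1) by (simp add: mult_le_0_iff)
qed

text \<open>\<open>A\<close> and \<open>B\<close> are real, so the conjugate of \<open>G z\<close>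
  solves the transfer equation at \<open>cnj z\<close>, and the solution there is unique.\<close>

lemma transfer_cnj:
  assumes z: "norm z = 1"
  shows "G (cnj z) = (\<chi> i. cnj (G z $ i))"
proof (rule transfer_unique[symmetric])
  show "cnj z *s (\<chi> i. cnj (G z $ i)) = complex_mat A *v (\<chi> i. cnj (G z $ i)) + complex_vec B"
    using arg_cong[OF transfer_equation[OF z], of "\<lambda>v. \<chi> i. cnj (v $ i)"]
    by (simp add: vec_eq_iff matrix_vector_mult_def complex_mat_def complex_vec_def)
qed (use z in simp)

lemma transfer_bounded_lipschitz:
  obtains K where "0 < K" "\<And>z. norm z = 1 \<Longrightarrow> norm (G z) \<le> K"
    "\<And>z z'. norm z = 1 \<Longrightarrow> norm z' = 1 \<Longrightarrow> norm (G z - G z') \<le> K * norm (z - z')"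
proof -
  obtain c where c: "0 < c" "\<And>z v. norm z = 1 \<Longrightarrow> c * norm v \<le> norm (z *s v - complex_mat A *v v)"
    using resolvent_lower_bound by blast
  define b where "b = norm (complex_vec B)"
  have bound: "norm (G z) \<le> b / c" if z: "norm z = 1" for z
  proof -
    have "z *s G z - complex_mat A *v G z = complex_vec B"
      using transfer_equation[OF z] by simp
    then show ?thesis
      using c(2)[OF z, of "G z"] c(1) by (simp add: b_def field_simps)
  qed
  have lip: "norm (G z - G z') \<le> b / c\<^sup>2 * norm (z - z')" if z: "norm z = 1" and z': "norm z' = 1" for z z'
  proof -
    \<comment> \<open>Resolvent identity: subtracting the two transfer equations leaves a multiple
      of \<open>G z'\<close>. The lower bound is then used once for the difference and once for
      \<open>G z'\<close>, whence the square of \<open>c\<close>.\<close>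
    have "z *s (G z - G z') - complex_mat A *v (G z - G z') = (z' - z) *s G z'"
      using transfer_equation[OF z] transfer_equation[OF z']
      by (simp add: vector_ssub_ldistrib matrix_vector_mult_diff_distrib vector_sub_rdistrib)
    then have "c * norm (G z - G z') \<le> norm ((z' - z) *s G z')"
      using c(2)[OF z, of "G z - G z'"] by (simp only:)
    also have "\<dots> = norm (z - z') * norm (G z')"
      by (simp add: norm_smult norm_minus_commute del: vector_sub_rdistrib)
    also have "\<dots> \<le> norm (z - z') * (b / c)"
      using bound[OF z'] by (intro mult_left_mono) auto
    finally show ?thesis using c(1) by (simp add: field_simps power2_eq_square)
  qed
  define K where "K = max 1 (max (b / c) (b / c\<^sup>2))"
  show thesis
  proof (rule that[of K])
    show "0 < K" by (simp add: K_def)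
    show "norm (G z) \<le> K" if "norm z = 1" for z
      using bound[OF that] by (simp add: K_def)
    show "norm (G z - G z') \<le> K * norm (z - z')" if "norm z = 1" "norm z' = 1" for z z'
      by (rule order_trans[OF lip[OF that]]) (intro mult_right_mono, auto simp: K_def)
  qed
qed

definition gram_angle :: "real \<Rightarrow> real^'n^'n" where
  "gram_angle \<theta> = gram (G (cis \<theta>))"

lemma norm_cis_diff_le: "norm (cis s - cis t) \<le> \<bar>s - t\<bar>"
proof -
  have "norm (cis s - cis t) = norm (cis t) * norm (cis (s - t) - 1)"
    by (simp only: norm_mult[symmetric] right_diff_distrib cis_mult) simp
  also have "\<dots> = 2 * \<bar>sin ((s - t) / 2)\<bar>"
    using dist_exp_i_1[of "s - t"] by (simp add: cis_conv_exp)
  also have "\<dots> \<le> \<bar>s - t\<bar>"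
    using abs_sin_x_le_abs_x[of "(s - t) / 2"] by simp
  finally show ?thesis .
qed

lemma continuous_on_transfer_cis [continuous_intros]: "continuous_on S (\<lambda>\<theta>. G (cis \<theta>))"
proof -
  obtain K where K: "0 < K"
    "\<And>z z'. norm z = 1 \<Longrightarrow> norm z' = 1 \<Longrightarrow> norm (G z - G z') \<le> K * norm (z - z')"
    using transfer_bounded_lipschitz by metis
  have "K-lipschitz_on S (\<lambda>\<theta>. G (cis \<theta>))"
  proof (rule lipschitz_onI)
    fix s t :: real
    have "norm (G (cis s) - G (cis t)) \<le> K * norm (cis s - cis t)" using K(2) by simp
    also have "\<dots> \<le> K * \<bar>s - t\<bar>" using K(1) norm_cis_diff_le by simp
    finally show "dist (G (cis s)) (G (cis t)) \<le> K * dist s t" by (simp add: dist_norm)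
  qed (use K in simp)
  then show ?thesis by (rule lipschitz_on_continuous_on)
qed

lemma gram_angle_lipschitz: obtains L where "L-lipschitz_on UNIV gram_angle"
proof -
  obtain K where K: "0 < K" "\<And>z. norm z = 1 \<Longrightarrow> norm (G z) \<le> K"
    "\<And>z z'. norm z = 1 \<Longrightarrow> norm z' = 1 \<Longrightarrow> norm (G z - G z') \<le> K * norm (z - z')"
    using transfer_bounded_lipschitz by metis
  have ij: "\<bar>gram_angle s $ i $ j - gram_angle t $ i $ j\<bar> \<le> 2 * K * K * \<bar>s - t\<bar>" for s t i j
  proof -
    define v w where "v = G (cis s)" and "w = G (cis t)"
    have vw: "norm (v $ l) \<le> K" "norm (w $ l) \<le> K" for l
      using K(2)[of "cis s"] K(2)[of "cis t"] unfolding v_def w_def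
      by (auto intro: order_trans[OF Finite_Cartesian_Product.norm_nth_le])
    have d: "norm (v $ l - w $ l) \<le> K * \<bar>s - t\<bar>" for l
    proof -
      have "norm (v $ l - w $ l) \<le> norm (v - w)"
        using Finite_Cartesian_Product.norm_nth_le[of "v - w" l] by simp
      also have "\<dots> \<le> K * norm (cis s - cis t)"
        using K(3)[of "cis s" "cis t"] by (simp add: v_def w_def)
      also have "\<dots> \<le> K * \<bar>s - t\<bar>" using K(1) norm_cis_diff_le by simp
      finally show ?thesis .
    qed
    have "\<bar>gram_angle s $ i $ j - gram_angle t $ i $ j\<bar> = \<bar>Re (v $ i * cnj (v $ j) - w $ i * cnj (w $ j))\<bar>"
      by (simp add: gram_angle_def gram_def v_def w_def)
    also have "\<dots> \<le> norm (v $ i * cnj (v $ j) - w $ i * cnj (w $ j))"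
      by (rule abs_Re_le_cmod)
    also have "v $ i * cnj (v $ j) - w $ i * cnj (w $ j)
        = v $ i * cnj (v $ j - w $ j) + (v $ i - w $ i) * cnj (w $ j)"
      by (simp add: algebra_simps)
    also have "norm \<dots> \<le> norm (v $ i) * norm (v $ j - w $ j) + norm (v $ i - w $ i) * norm (w $ j)"
      by (rule order_trans[OF norm_triangle_ineq]) (simp only: norm_mult complex_mod_cnj order_refl)
    also have "\<dots> \<le> K * (K * \<bar>s - t\<bar>) + (K * \<bar>s - t\<bar>) * K"
      using vw d K(1) by (intro add_mono mult_mono) auto
    finally show ?thesis by (simp add: algebra_simps)
  qed
  have "norm (gram_angle s - gram_angle t) \<le> (\<Sum>i\<in>UNIV. \<Sum>j\<in>UNIV. \<bar>(gram_angle s - gram_angle t) $ i $ j\<bar>)" for s t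
  proof -
    have "norm (gram_angle s - gram_angle t) \<le> (\<Sum>i\<in>UNIV. norm ((gram_angle s - gram_angle t) $ i))"
      unfolding norm_vec_def[of "gram_angle s - gram_angle t"] by (rule L2_set_le_sum) simp
    also have "\<dots> \<le> (\<Sum>i\<in>UNIV. \<Sum>j\<in>UNIV. \<bar>(gram_angle s - gram_angle t) $ i $ j\<bar>)"
      by (intro sum_mono norm_le_l1_cart)
    finally show ?thesis .
  qed
  then have le: "norm (gram_angle s - gram_angle t) \<le> (\<Sum>i\<in>(UNIV::'n set). \<Sum>j\<in>(UNIV::'n set). 2 * K * K * \<bar>s - t\<bar>)" for s t
    by (rule order_trans) (intro sum_mono, simp add: ij)
  show thesis
  proof (rule that, rule lipschitz_onI)
    show "dist (gram_angle s) (gram_angle t) \<le> (real CARD('n) * real CARD('n) * (2 * K * K)) * dist s t" for s t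
      using le[of s t] by (simp add: dist_norm dist_real_def algebra_simps)
  qed (use K in simp)
qed

lemma continuous_on_gram_angle [continuous_intros]: "continuous_on S gram_angle"
  using gram_angle_lipschitz lipschitz_on_continuous_on continuous_on_subset by (metis subset_UNIV)

lemma transpose_gram_angle: "transpose (gram_angle \<theta>) = gram_angle \<theta>"
  by (simp add: gram_angle_def gram_def transpose_def vec_eq_iff algebra_simps)

text \<open>The imaginary part of each entry of G \<Phi> G* is odd in the angle, since \<Phi> is
  even and conjugating z conjugates G. Its integral over a symmetric interval vanishes, and only the
  real moment integral remains.\<close>

lemma Gamma_op_eq:
  assumes \<Phi>: "bounded_symmetric \<Phi>"
  shows "Gamma_op A B \<Phi> = complex_mat ((1 / (2 * pi)) *\<^sub>R (LINT \<theta>|angle. \<Phi> (cis \<theta>) *\<^sub>R gram_angle \<theta>))"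
proof -
  let ?g = "\<lambda>\<theta> i j. G (cis \<theta>) $ i * cnj (G (cis \<theta>) $ j)"
  have eq: "(\<chi> i j. G (cis \<theta>) $ i * complex_of_real (\<Phi> (cis \<theta>)) * cnj (G (cis \<theta>) $ j))
      = \<Phi> (cis \<theta>) *\<^sub>R (\<chi> i j. ?g \<theta> i j)" for \<theta>
    by (simp add: vec_eq_iff scaleR_conv_of_real[where x = "_ :: complex"])
  have int: "integrable angle (\<lambda>\<theta>. \<Phi> (cis \<theta>) *\<^sub>R (\<chi> i j. ?g \<theta> i j))"
    by (intro bounded_symmetric_integrable \<Phi> continuous_intros)
  have intM: "integrable angle (\<lambda>\<theta>. \<Phi> (cis \<theta>) *\<^sub>R gram_angle \<theta>)"
    by (intro bounded_symmetric_integrable \<Phi> continuous_intros)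
  have bl: "bounded_linear (\<lambda>X. X $ i $ j)" for i j
    by (intro bounded_linear_compose[OF bounded_linear_vec_nth] bounded_linear_vec_nth)
  have "(LINT \<theta>|angle. \<Phi> (cis \<theta>) *\<^sub>R (\<chi> i j. ?g \<theta> i j)) $ i $ j
      = complex_of_real ((LINT \<theta>|angle. \<Phi> (cis \<theta>) *\<^sub>R gram_angle \<theta>) $ i $ j)" for i j
  proof -
    have intij: "integrable angle (\<lambda>\<theta>. \<Phi> (cis \<theta>) *\<^sub>R ?g \<theta> i j)"
      by (intro bounded_symmetric_integrable \<Phi> continuous_intros)
    have 1: "(LINT \<theta>|angle. \<Phi> (cis \<theta>) *\<^sub>R (\<chi> i j. ?g \<theta> i j)) $ i $ j = (LINT \<theta>|angle. \<Phi> (cis \<theta>) *\<^sub>R ?g \<theta> i j)"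
      using integral_bounded_linear[OF bl int, of i j] by simp
    have 2: "(LINT \<theta>|angle. \<Phi> (cis \<theta>) *\<^sub>R gram_angle \<theta>) $ i $ j = (LINT \<theta>|angle. \<Phi> (cis \<theta>) * Re (?g \<theta> i j))"
      using integral_bounded_linear[OF bl intM, of i j] by (simp add: gram_angle_def gram_def)
    have 3: "Re (LINT \<theta>|angle. \<Phi> (cis \<theta>) *\<^sub>R ?g \<theta> i j) = (LINT \<theta>|angle. \<Phi> (cis \<theta>) * Re (?g \<theta> i j))"
      using integral_bounded_linear[OF bounded_linear_Re intij] by simp
    have "Im (LINT \<theta>|angle. \<Phi> (cis \<theta>) *\<^sub>R ?g \<theta> i j) = (LINT \<theta>|angle. \<Phi> (cis \<theta>) * Im (?g \<theta> i j))"
      using integral_bounded_linear[OF bounded_linear_Im intij] by simp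
    also have "\<dots> = 0"
    proof (rule integral_angle_odd)
      show "integrable angle (\<lambda>\<theta>. \<Phi> (cis \<theta>) * Im (?g \<theta> i j))"
        using integrable_bounded_linear[OF bounded_linear_Im intij] by simp
      fix \<theta>
      have "\<Phi> (cis (- \<theta>)) = \<Phi> (cis \<theta>)"
        using \<Phi> cis_cnj[of \<theta>] by (metis bounded_symmetric_def norm_cis)
      moreover have "Im (?g (- \<theta>) i j) = - Im (?g \<theta> i j)"
        using transfer_cnj[of "cis \<theta>"] by (simp add: cis_cnj)
      ultimately show "\<Phi> (cis (- \<theta>)) * Im (?g (- \<theta>) i j) = - (\<Phi> (cis \<theta>) * Im (?g \<theta> i j))"
        by (simp only: mult_minus_right)
    qed
    finally show ?thesis using 1 2 3 by (simp add: complex_eq_iff)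
  qed
  then show ?thesis
    unfolding Gamma_op_def circle_int_def eq
    by (simp add: vec_eq_iff complex_mat_def scaleR_conv_of_real[where x = "_ :: complex"])
qed

lemma complex_mat_eq_mat_1_iff: "complex_mat X = mat 1 \<longleftrightarrow> X = mat 1"
  by (auto simp: vec_eq_iff complex_mat_def mat_def)

lemma Gamma_op_eq_mat_1_iff:
  assumes "bounded_symmetric \<Phi>"
  shows "Gamma_op A B \<Phi> = mat 1 \<longleftrightarrow> (LINT \<theta>|angle. \<Phi> (cis \<theta>) *\<^sub>R gram_angle \<theta>) = (2 * pi) *\<^sub>R mat 1"
proof -
  have "(1 / (2 * pi)) *\<^sub>R X = Y \<longleftrightarrow> X = (2 * pi) *\<^sub>R Y" for X Y :: "real^'n^'n"
  proof
    assume "(1 / (2 * pi)) *\<^sub>R X = Y"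
    then have "(2 * pi) *\<^sub>R ((1 / (2 * pi)) *\<^sub>R X) = (2 * pi) *\<^sub>R Y" by simp
    then show "X = (2 * pi) *\<^sub>R Y" by simp
  qed simp
  then show ?thesis
    unfolding Gamma_op_eq[OF assms] complex_mat_eq_mat_1_iff .
qed

end

section \<open>Feasibility\<close>

lemma circle_all_iff_angle:
  "(\<forall>z. norm z = 1 \<longrightarrow> P z) \<longleftrightarrow> (\<forall>\<theta>\<in>{-pi..pi}. P (cis \<theta>))"
proof safe
  fix z :: complex assume P: "\<forall>\<theta>\<in>{-pi..pi}. P (cis \<theta>)" and z: "norm z = 1"
  have "z \<noteq> 0" using z by auto
  then have "z = cis (Arg z)" using z by (simp add: cis_Arg sgn_div_norm)
  moreover have "Arg z \<in> {-pi..pi}" using Arg_bounded[of z] by auto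
  ultimately show "P z" using P by metis
qed simp

text \<open>The successor keeps the frequency nonzero. Powers of \<open>cnj z\<close> are the ones
  that occur in the expansion of \<open>W\<close> below.\<close>

lemma integral_angle_cis_power:
  "(LINT \<theta>|angle. cnj (cis \<theta>) ^ Suc k) = 0"
proof -
  define c where "c = - \<i> * of_nat (Suc k)"
  have c: "c \<noteq> 0" by (simp add: c_def del: of_nat_Suc)
  have eq: "cnj (cis \<theta>) ^ Suc k = exp (c * of_real \<theta>)" for \<theta>
  proof -
    have "cnj (cis \<theta>) ^ Suc k = cis (real (Suc k) * (- \<theta>))"
      by (simp only: cis_cnj Complex.DeMoivre)
    then show ?thesis by (simp add: cis_conv_exp c_def mult.assoc)
  qed
  have int: "integrable angle (\<lambda>\<theta>. cnj (cis \<theta>) ^ Suc k)"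
    by (intro integrable_angle_continuous continuous_intros)
  have "((\<lambda>\<theta>. exp (c * of_real \<theta>)) has_integral
      exp (c * of_real pi) / c - exp (c * of_real (- pi)) / c) {-pi..pi}"
  proof (rule fundamental_theorem_of_calculus)
    fix x :: real
    have "((\<lambda>w. exp (c * w) / c) has_field_derivative exp (c * of_real x)) (at (of_real x))"
      using c by (auto intro!: derivative_eq_intros)
    then have "((\<lambda>t. exp (c * of_real t) / c) has_vector_derivative exp (c * of_real x)) (at x)"
      by (rule has_vector_derivative_real_field)
    then show "((\<lambda>t. exp (c * of_real t) / c) has_vector_derivative exp (c * of_real x))
        (at x within {-pi..pi})"
      by (rule has_vector_derivative_at_within)
  qed simp
  moreover have "exp (c * of_real pi) = exp (c * of_real (- pi))"
  proof -
    have "cis (- pi) = cis pi" by (simp add: complex_eq_iff)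
    then show ?thesis unfolding eq[symmetric] by (simp only:)
  qed
  ultimately have "((\<lambda>\<theta>. cnj (cis \<theta>) ^ Suc k) has_integral 0) {-pi..pi}"
    unfolding eq by simp
  then have "integral {-pi..pi} (\<lambda>\<theta>. cnj (cis \<theta>) ^ Suc k) = 0"
    by (rule integral_unique)
  then show ?thesis
    using integral_angle_eq_integral[OF int] by simp
qed

section \<open>The transposed recursion for the transfer function\<close>

lemma re_mult_smult_right: "re_mult x (z *s v) = z * re_mult x v"
  by (simp add: re_mult_def sum_distrib_left algebra_simps)

lemma re_mult_add_right: "re_mult x (v + w) = re_mult x v + re_mult x w"
  by (simp add: re_mult_def sum.distrib algebra_simps)

lemma re_mult_complex_vec: "re_mult x (complex_vec b) = complex_of_real (x \<bullet> b)"
  by (simp add: re_mult_def complex_vec_def inner_vec_def)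

lemma re_mult_complex_mat: "re_mult x (complex_mat A *v v) = re_mult (transpose A *v x) v"
proof -
  have "re_mult x (complex_mat A *v v)
      = (\<Sum>i\<in>UNIV. \<Sum>j\<in>UNIV. complex_of_real (x $ i * A $ i $ j) * v $ j)"
    by (simp add: re_mult_def matrix_vector_mult_def complex_mat_def sum_distrib_left mult.assoc)
  also have "\<dots> = (\<Sum>j\<in>UNIV. \<Sum>i\<in>UNIV. complex_of_real (x $ i * A $ i $ j) * v $ j)"
    by (rule sum.swap)
  also have "\<dots> = re_mult (transpose A *v x) v"
    by (simp add: re_mult_def matrix_vector_mult_def transpose_def sum_distrib_left algebra_simps)
  finally show ?thesis .
qed

lemma inner_transpose_mult: "(transpose A *v x) \<bullet> y = x \<bullet> (A *v y)" for A :: "real^'n^'m"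
  by (metis dot_lmul_matrix transpose_matrix_vector)

context stable_filter begin

text \<open>Testing the transfer equation with a real vector moves \<open>A\<close> onto that
  vector. At fixed z this is a recursion in \<open>x\<close>, driven by the component of
  \<open>x\<close> along \<open>B\<close>.\<close>

lemma transfer_dual:
  assumes "norm z = 1"
  shows "z * re_mult x (G z) = re_mult (transpose A *v x) (G z) + complex_of_real (x \<bullet> B)"
proof -
  have "re_mult x (z *s G z) = re_mult x (complex_mat A *v G z + complex_vec B)"
    using transfer_equation[OF assms] by simp
  then show ?thesis
    by (simp add: re_mult_smult_right re_mult_add_right re_mult_complex_vec re_mult_complex_mat)
qed

lemma integral_quadratic_form:
  assumes \<Phi>: "bounded_symmetric \<Phi>"
  shows "outer x \<bullet> (LINT \<theta>|angle. \<Phi> (cis \<theta>) *\<^sub>R gram_angle \<theta>)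
    = (LINT \<theta>|angle. \<Phi> (cis \<theta>) * (norm (re_mult x (G (cis \<theta>))))\<^sup>2)"
proof -
  have "integrable angle (\<lambda>\<theta>. \<Phi> (cis \<theta>) *\<^sub>R gram_angle \<theta>)"
    by (intro bounded_symmetric_integrable \<Phi> continuous_intros)
  from integral_inner_right[OF this, of "outer x", symmetric] show ?thesis
    by (simp add: gram_angle_def outer_inner_gram)
qed

end

section \<open>A positive feasible density from an isometry property\<close>

locale normalized_filter = stable_filter A B for A :: "real^'n^'n" and B :: "real^'n" +
  fixes \<Phi>0 :: "complex \<Rightarrow> real"
  assumes reachable: "reachable A B"
    and \<Phi>0: "bounded_symmetric \<Phi>0" "Gamma_op A B \<Phi>0 = mat 1"
begin

definition \<beta> where "\<beta> = B \<bullet> B"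

text \<open>The transpose of \<open>F = \<Pi> A\<close>, where \<open>\<Pi>\<close> is the orthogonal projection onto the complement of \<open>B\<close>.\<close>

definition T where "T x = transpose A *v (x - (x \<bullet> B / \<beta>) *\<^sub>R B)"

lemma \<beta>_pos: "0 < \<beta>"
proof -
  have "B \<noteq> 0"
  proof
    assume "B = 0"
    then have "(((*v) A) ^^ k) B = 0" for k by (induction k) auto
    then have "(\<lambda>k. (((*v) A) ^^ k) B) ` {..<CARD('n)} \<subseteq> {0}" by auto
    then have "span ((\<lambda>k. (((*v) A) ^^ k) B) ` {..<CARD('n)}) \<subseteq> {0}"
      by (metis span_mono span_singleton span_0 span_empty span_insert_0)
    then have "(UNIV :: (real^'n) set) \<subseteq> {0}"
      using reachable by (simp add: reachable_def)
    then have "axis undefined 1 = (0 :: real^'n)" by blast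
    then show False by simp
  qed
  then show ?thesis by (simp add: \<beta>_def)
qed

lemma quadratic_form_\<Phi>0:
  "(LINT \<theta>|angle. \<Phi>0 (cis \<theta>) * (norm (re_mult x (G (cis \<theta>))))\<^sup>2) = 2 * pi * (x \<bullet> x)"
  using integral_quadratic_form[OF \<Phi>0(1), of x] Gamma_op_eq_mat_1_iff[OF \<Phi>0(1)] \<Phi>0(2)
  by (simp add: outer_inner_mat_1)

text \<open>Without the driving term, \<open>transfer_dual\<close> equates the moduli of u'G and
  (A'u)'G at each point of the circle. The weighted integrals then agree whatever the sign of
  \<open>\<Phi>0\<close>, and by normalization they are 2 pi times the squared norms.\<close>

lemma isometry:
  assumes "u \<bullet> B = 0"
  shows "(transpose A *v u) \<bullet> (transpose A *v u) = u \<bullet> u"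
proof -
  have "norm (re_mult (transpose A *v u) (G (cis \<theta>))) = norm (re_mult u (G (cis \<theta>)))" for \<theta>
    using arg_cong[OF transfer_dual[of "cis \<theta>" u], of norm] assms by (simp add: norm_mult)
  then have "2 * pi * ((transpose A *v u) \<bullet> (transpose A *v u)) = 2 * pi * (u \<bullet> u)"
    unfolding quadratic_form_\<Phi>0[symmetric] by simp
  then show ?thesis by simp
qed

lemma projection_orthogonal: "(x - (x \<bullet> B / \<beta>) *\<^sub>R B) \<bullet> B = 0"
  using \<beta>_pos by (simp add: inner_diff_left \<beta>_def)

text \<open>The energy balance behind F F' = \<Pi>: each application of \<open>T\<close> loses
  exactly the component along \<open>B\<close>, and the isometry preserves the rest.\<close>

lemma T_inner: "T x \<bullet> T x = x \<bullet> x - (x \<bullet> B)\<^sup>2 / \<beta>"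
proof -
  let ?u = "x - (x \<bullet> B / \<beta>) *\<^sub>R B"
  have "T x \<bullet> T x = ?u \<bullet> ?u"
    unfolding T_def by (rule isometry[OF projection_orthogonal])
  also have "\<dots> = ?u \<bullet> x"
    using projection_orthogonal[of x] by (simp add: inner_diff_right)
  also have "\<dots> = x \<bullet> x - (x \<bullet> B)\<^sup>2 / \<beta>"
    by (simp add: inner_diff_left inner_commute[of B x] power2_eq_square)
  finally show ?thesis .
qed

lemma norm_T_le: "norm (T x) \<le> norm x"
  using T_inner[of x] \<beta>_pos by (simp add: norm_le)

lemma linear_T: "linear T"
  unfolding T_def
  by (rule linearI) (simp_all add: matrix_vector_right_distrib matrix_vector_mult_diff_distrib
      matrix_vector_mult_scaleR inner_add_left algebra_simps scaleR_add_left add_divide_distrib)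

lemma linear_T_power: "linear (T ^^ k)"
proof (induction k)
  case 0
  then show ?case by (simp add: linear_id id_def[symmetric])
next
  case (Suc k)
  show ?case unfolding funpow.simps by (rule linear_compose[OF Suc linear_T])
qed

lemma norm_T_power_le: "norm ((T ^^ k) x) \<le> norm x"
proof (induction k)
  case (Suc k)
  then show ?case using norm_T_le[of "(T ^^ k) x"] by simp
qed simp

lemma norm_T_power_antimono: "j \<le> k \<Longrightarrow> norm ((T ^^ k) x) \<le> norm ((T ^^ j) x)"
proof (induction k rule: dec_induct)
  case (step k)
  then show ?case using norm_T_le[of "(T ^^ k) x"] by simp
qed simp

text \<open>If n steps lose nothing, the iterates of index below n are all orthogonal to
  \<open>B\<close>, so \<open>T\<close> acts on them as the transpose of \<open>A\<close>. Then
  \<open>x\<close> is orthogonal to B, A B, ..., A^(n-1) B, which span the space by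
  reachability.\<close>

lemma T_power_strict:
  assumes "x \<noteq> 0"
  shows "norm ((T ^^ CARD('n)) x) < norm x"
proof (rule ccontr)
  let ?n = "CARD('n)"
  assume "\<not> norm ((T ^^ ?n) x) < norm x"
  then have eq: "norm ((T ^^ k) x) = norm x" if "k \<le> ?n" for k
    using norm_T_power_antimono[OF that, of x] norm_T_power_le[of k x] by simp
  have orth: "(T ^^ k) x \<bullet> B = 0" if "k < ?n" for k
  proof -
    have "norm (T ((T ^^ k) x)) = norm ((T ^^ k) x)"
      using eq[of k] eq[of "Suc k"] that by simp
    then have "T ((T ^^ k) x) \<bullet> T ((T ^^ k) x) = (T ^^ k) x \<bullet> (T ^^ k) x"
      by (simp add: norm_eq)
    then show ?thesis using T_inner[of "(T ^^ k) x"] \<beta>_pos by simp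
  qed
  have powers: "(T ^^ k) x \<bullet> y = x \<bullet> (((*v) A) ^^ k) y" if "k \<le> ?n" for k y
    using that
  proof (induction k arbitrary: y)
    case (Suc k)
    then have "(T ^^ k) x \<bullet> B = 0" by (intro orth) simp
    then have "(T ^^ Suc k) x = transpose A *v (T ^^ k) x" by (simp add: T_def)
    then have "(T ^^ Suc k) x \<bullet> y = (T ^^ k) x \<bullet> (A *v y)" by (simp only: inner_transpose_mult)
    also have "\<dots> = x \<bullet> (((*v) A) ^^ Suc k) y"
      using Suc by (simp add: funpow_swap1)
    finally show ?case .
  qed simp
  have "orthogonal x y" if "y \<in> span ((\<lambda>k. (((*v) A) ^^ k) B) ` {..<?n})" for y
  proof (rule orthogonal_to_span[OF that])
    fix y assume "y \<in> (\<lambda>k. (((*v) A) ^^ k) B) ` {..<?n}"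
    then obtain k where k: "k < ?n" "y = (((*v) A) ^^ k) B" by auto
    then show "orthogonal x y" using powers[of k B] orth[of k] by (simp add: orthogonal_def)
  qed
  then have "orthogonal x x" using reachable by (simp add: reachable_def)
  then show False using assms by (simp add: orthogonal_def)
qed

lemma T_power_contraction:
  obtains r where "0 \<le> r" "r < 1" "\<And>x. norm ((T ^^ CARD('n)) x) \<le> r * norm x"
proof -
  let ?S = "sphere (0 :: real^'n) 1" and ?n = "CARD('n)"
  have cont: "continuous_on ?S (\<lambda>x. norm ((T ^^ ?n) x))"
    by (intro continuous_on_norm linear_continuous_on)
       (simp add: linear_T_power linear_conv_bounded_linear[symmetric])
  have "?S \<noteq> {}" by simp
  then obtain u where u: "u \<in> ?S" "\<And>x. x \<in> ?S \<Longrightarrow> norm ((T ^^ ?n) x) \<le> norm ((T ^^ ?n) u)"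
    using continuous_attains_sup[OF _ _ cont] by auto
  show thesis
  proof (rule that[of "norm ((T ^^ ?n) u)"])
    have "norm u = 1" using u(1) by simp
    moreover from this have "u \<noteq> 0" by auto
    ultimately show "norm ((T ^^ ?n) u) < 1" using T_power_strict[of u] by simp
    fix x
    show "norm ((T ^^ ?n) x) \<le> norm ((T ^^ ?n) u) * norm x"
    proof (cases "x = 0")
      case True
      then show ?thesis using norm_T_power_le[of ?n 0] by simp
    next
      case False
      then have "norm ((T ^^ ?n) ((1 / norm x) *\<^sub>R x)) \<le> norm ((T ^^ ?n) u)"
        by (intro u(2)) simp
      then show ?thesis
        using False by (simp add: linear_cmul[OF linear_T_power] field_simps)
    qed
  qed simp
qed

text \<open>Iterating the step n m times yields the bound |C| r^m |y|, which tends to 0. The index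
  \<open>k\<close> allows the quantity to change along the recursion. It is applied to values of
  \<open>G\<close> at one point, to Fourier coefficients of \<open>W\<close> and to the defect in
  Parseval's identity.\<close>

lemma nonpos_if_le_T:
  fixes f :: "nat \<Rightarrow> real^'n \<Rightarrow> real"
  assumes step: "\<And>k y. f k y \<le> f (Suc k) (T y)" and bound: "\<And>k y. f k y \<le> C * norm y"
  shows "f k y \<le> 0"
proof -
  obtain r where r: "0 \<le> r" "r < 1" "\<And>x. norm ((T ^^ CARD('n)) x) \<le> r * norm x"
    using T_power_contraction by blast
  have pow: "norm (((T ^^ CARD('n)) ^^ m) y) \<le> r ^ m * norm y" for m
  proof (induction m)
    case (Suc m)
    have "norm (((T ^^ CARD('n)) ^^ Suc m) y) \<le> r * norm (((T ^^ CARD('n)) ^^ m) y)"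
      using r(3) by simp
    also have "\<dots> \<le> r * (r ^ m * norm y)"
      using Suc r(1) by (intro mult_left_mono)
    finally show ?case by (simp add: algebra_simps)
  qed simp
  have steps: "f k y \<le> f (k + m) ((T ^^ m) y)" for m
  proof (induction m)
    case (Suc m)
    then show ?case using step[of "k + m" "(T ^^ m) y"] by simp
  qed simp
  have "f k y \<le> \<bar>C\<bar> * (r ^ m * norm y)" for m
  proof -
    have "f k y \<le> C * norm ((T ^^ (CARD('n) * m)) y)"
      using steps[of "CARD('n) * m"] bound order_trans by blast
    also have "\<dots> \<le> \<bar>C\<bar> * norm (((T ^^ CARD('n)) ^^ m) y)"
      unfolding funpow_mult by (intro mult_right_mono) auto
    also have "\<dots> \<le> \<bar>C\<bar> * (r ^ m * norm y)"
      by (intro mult_left_mono pow) auto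
    finally show ?thesis .
  qed
  moreover have "(\<lambda>m. \<bar>C\<bar> * (r ^ m * norm y)) \<longlonglongrightarrow> \<bar>C\<bar> * (0 * norm y)"
    using r by (intro tendsto_intros LIMSEQ_power_zero) auto
  ultimately have "f k y \<le> \<bar>C\<bar> * (0 * norm y)"
    by (intro LIMSEQ_le_const) auto
  then show ?thesis by simp
qed

lemma re_mult_transfer_eq:
  assumes "norm z = 1"
  shows "re_mult x (G z) = complex_of_real (x \<bullet> B / \<beta>) * re_mult B (G z) + cnj z * re_mult (T x) (G z)"
proof -
  let ?u = "x - (x \<bullet> B / \<beta>) *\<^sub>R B"
  have "z * re_mult ?u (G z) = re_mult (T x) (G z)"
    using transfer_dual[OF assms, of ?u] projection_orthogonal[of x] by (simp add: T_def)
  then have "cnj z * re_mult (T x) (G z) = cnj z * z * re_mult ?u (G z)" by simp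
  also have "cnj z * z = 1"
    using assms by (simp add: complex_norm_square[symmetric] mult.commute)
  finally show ?thesis by (simp add: re_mult_diff_left re_mult_scale_left)
qed

text \<open>At a zero of B'G the recursion loses its inhomogeneous term, so x'G z and (T x)'G z have
  equal modulus for every x. Contraction then forces G z = 0, contradicting the transfer equation
  since \<open>B\<close> is not 0.\<close>

lemma re_mult_B_nonzero:
  assumes z: "norm z = 1"
  shows "re_mult B (G z) \<noteq> 0"
proof
  assume 0: "re_mult B (G z) = 0"
  have "norm (re_mult x (G z)) \<le> 0" for x
  proof (rule nonpos_if_le_T[where f = "\<lambda>_ x. norm (re_mult x (G z))" and C = "CARD('n) * norm (G z)"])
    show "norm (re_mult y (G z)) \<le> norm (re_mult (T y) (G z))" for y
      using re_mult_transfer_eq[OF z, of y] z 0 by (simp add: norm_mult)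
    show "norm (re_mult y (G z)) \<le> CARD('n) * norm (G z) * norm y" for y
      using norm_re_mult_le[of y "G z"] by (simp add: algebra_simps)
  qed
  then have "re_mult x (G z) = 0" for x by simp
  then have "complex_of_real (B \<bullet> B) = 0" using transfer_dual[OF z, of B] by simp
  then have "\<beta> = 0" unfolding \<beta>_def by (simp only: of_real_eq_0_iff)
  then show False using \<beta>_pos by simp
qed

definition W where "W x z = re_mult x (G z) / re_mult B (G z)"

text \<open>Iterated, this is the power series of \<open>W x\<close> in \<open>cnj z\<close>, with
  coefficients (T^k x) \<bullet> B / \<beta>. The proofs below use the recursion itself and so avoid
  questions of convergence.\<close>

lemma W_eq:
  assumes "norm z = 1"
  shows "W x z = complex_of_real (x \<bullet> B / \<beta>) + cnj z * W (T x) z"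
  using re_mult_transfer_eq[OF assms, of x] re_mult_B_nonzero[OF assms]
  by (simp add: W_def field_simps)

lemma continuous_on_W [continuous_intros]: "continuous_on S (\<lambda>\<theta>. W x (cis \<theta>))"
  unfolding W_def using re_mult_B_nonzero by (intro continuous_intros) auto

lemma re_mult_B_bounds:
  obtains m K where "0 < m" "\<And>z. norm z = 1 \<Longrightarrow> m \<le> norm (re_mult B (G z)) \<and> norm (re_mult B (G z)) \<le> K"
proof -
  have cont: "continuous_on {-pi..pi} (\<lambda>\<theta>. norm (re_mult B (G (cis \<theta>))))"
    by (intro continuous_intros)
  obtain s where s: "\<And>\<theta>. \<theta> \<in> {-pi..pi} \<Longrightarrow> norm (re_mult B (G (cis s))) \<le> norm (re_mult B (G (cis \<theta>)))"
    using continuous_attains_inf[OF compact_Icc _ cont] by force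
  obtain t where t: "\<And>\<theta>. \<theta> \<in> {-pi..pi} \<Longrightarrow> norm (re_mult B (G (cis \<theta>))) \<le> norm (re_mult B (G (cis t)))"
    using continuous_attains_sup[OF compact_Icc _ cont] by force
  show thesis
  proof (rule that)
    show "0 < norm (re_mult B (G (cis s)))" using re_mult_B_nonzero[of "cis s"] by simp
    have "\<forall>z. norm z = 1 \<longrightarrow> norm (re_mult B (G (cis s))) \<le> norm (re_mult B (G z))
        \<and> norm (re_mult B (G z)) \<le> norm (re_mult B (G (cis t)))"
      unfolding circle_all_iff_angle using s t by blast
    then show "norm (re_mult B (G (cis s))) \<le> norm (re_mult B (G z))
        \<and> norm (re_mult B (G z)) \<le> norm (re_mult B (G (cis t)))" if "norm z = 1" for z
      using that by blast
  qed
qed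

lemma W_bounded: obtains C where "0 \<le> C" "\<And>x z. norm z = 1 \<Longrightarrow> norm (W x z) \<le> C * norm x"
proof -
  obtain m K where m: "0 < m" "\<And>z. norm z = 1 \<Longrightarrow> m \<le> norm (re_mult B (G z)) \<and> norm (re_mult B (G z)) \<le> K"
    using re_mult_B_bounds by metis
  obtain K' where K': "0 < K'" "\<And>z. norm z = 1 \<Longrightarrow> norm (G z) \<le> K'"
    using transfer_bounded_lipschitz by metis
  show thesis
  proof (rule that[of "CARD('n) * K' / m"])
    fix x and z :: complex assume z: "norm z = 1"
    have "norm (re_mult x (G z)) \<le> CARD('n) * norm x * K'"
      by (rule order_trans[OF norm_re_mult_le]) (intro mult_left_mono K'(2)[OF z], simp)
    then have "norm (W x z) \<le> CARD('n) * norm x * K' / m"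
      unfolding W_def norm_divide using m(1) m(2)[OF z] K'(1) by (intro frac_le) auto
    then show "norm (W x z) \<le> CARD('n) * K' / m * norm x" by (simp add: algebra_simps)
  qed (use m K' in simp)
qed

text \<open>By \<open>W_eq\<close>, raising \<open>k\<close> by one replaces \<open>y\<close> by \<open>T y\<close>, and \<open>T\<close> is power-contractive.\<close>

lemma integral_W_eq_0: "(LINT \<theta>|angle. cnj (cis \<theta>) ^ Suc k * W y (cis \<theta>)) = 0"
proof -
  let ?h = "\<lambda>k y. LINT \<theta>|angle. cnj (cis \<theta>) ^ Suc k * W y (cis \<theta>)"
  have int: "integrable angle (\<lambda>\<theta>. cnj (cis \<theta>) ^ k * W y (cis \<theta>))" for k y
    by (intro integrable_angle_continuous continuous_intros)
  have int': "integrable angle (\<lambda>\<theta>. cnj (cis \<theta>) ^ Suc k * complex_of_real c)" for k c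
    by (intro integrable_angle_continuous continuous_intros)
  have step: "?h k y = ?h (Suc k) (T y)" for k y
  proof -
    have "?h k y = (LINT \<theta>|angle. cnj (cis \<theta>) ^ Suc k * complex_of_real (y \<bullet> B / \<beta>)
        + cnj (cis \<theta>) ^ Suc (Suc k) * W (T y) (cis \<theta>))"
      by (subst W_eq) (simp_all only: norm_cis distrib_left power_Suc2 mult.assoc)
    also have "\<dots> = (LINT \<theta>|angle. cnj (cis \<theta>) ^ Suc k * complex_of_real (y \<bullet> B / \<beta>)) + ?h (Suc k) (T y)"
      by (rule Bochner_Integration.integral_add[OF int' int])
    also have "(LINT \<theta>|angle. cnj (cis \<theta>) ^ Suc k * complex_of_real (y \<bullet> B / \<beta>)) = 0"
      by (subst integral_mult_left_zero) (simp only: integral_angle_cis_power mult_zero_left)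
    finally show ?thesis by (simp only: add_0_left)
  qed
  obtain C where C: "0 \<le> C" "\<And>x z. norm z = 1 \<Longrightarrow> norm (W x z) \<le> C * norm x"
    using W_bounded by blast
  have "norm (?h k y) \<le> 0"
  proof (rule nonpos_if_le_T[where f = "\<lambda>k y. norm (?h k y)"])
    show "norm (?h k y) \<le> norm (?h (Suc k) (T y))" for k y
      by (simp only: step[symmetric] order_refl)
    show "norm (?h k y) \<le> (2 * pi * C) * norm y" for k y
    proof -
      have "norm (?h k y) \<le> (LINT \<theta>|angle. norm (cnj (cis \<theta>) ^ Suc k * W y (cis \<theta>)))"
        by (rule integral_norm_bound)
      also have "\<dots> \<le> (LINT \<theta>|angle. C * norm y)"
      proof (rule integral_mono)
        show "integrable angle (\<lambda>\<theta>. C * norm y)"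
          by (intro integrable_angle_continuous continuous_intros)
        show "norm (cnj (cis \<theta>) ^ Suc k * W y (cis \<theta>)) \<le> C * norm y" for \<theta>
          using C(2)[of "cis \<theta>" y] by (simp add: norm_mult norm_power)
      qed (use int in \<open>rule integrable_norm\<close>)
      also have "\<dots> = (2 * pi * C) * norm y" by simp
      finally show ?thesis .
    qed
  qed
  then show ?thesis by simp
qed

text \<open>Parseval's identity obtained by recursion. Passing from \<open>x\<close> to
  \<open>T x\<close> lowers both sides by 2 pi (x \<bullet> B / \<beta>)^2: the left by
  \<open>W_eq\<close>, where the cross term is a vanishing Fourier coefficient, the right by
  \<open>T_inner\<close>. The defect \<open>E\<close> is therefore invariant under
  \<open>T\<close>.\<close>

lemma integral_W_square: "(LINT \<theta>|angle. (norm (W x (cis \<theta>)))\<^sup>2) = 2 * pi * (x \<bullet> x) / \<beta>"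
proof -
  let ?Q = "\<lambda>x. LINT \<theta>|angle. (norm (W x (cis \<theta>)))\<^sup>2"
  define E where "E x = ?Q x - 2 * pi * (x \<bullet> x) / \<beta>" for x
  have Q: "?Q x = 2 * pi * (x \<bullet> B / \<beta>)\<^sup>2 + ?Q (T x)" for x
  proof -
    let ?a = "x \<bullet> B / \<beta>" and ?w = "\<lambda>\<theta>. cnj (cis \<theta>) ^ Suc 0 * W (T x) (cis \<theta>)"
    have int: "integrable angle ?w"
      by (intro integrable_angle_continuous continuous_intros)
    have ints: "integrable angle (\<lambda>\<theta>. ?a\<^sup>2)" "integrable angle (\<lambda>\<theta>. (norm (W (T x) (cis \<theta>)))\<^sup>2)"
      "integrable angle (\<lambda>\<theta>. 2 * ?a * Re (?w \<theta>))"
      by (intro integrable_angle_continuous continuous_intros)+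
    have "(norm (W x (cis \<theta>)))\<^sup>2 = ?a\<^sup>2 + (norm (W (T x) (cis \<theta>)))\<^sup>2 + 2 * ?a * Re (?w \<theta>)" for \<theta>
    proof -
      have W: "W x (cis \<theta>) = complex_of_real ?a + ?w \<theta>"
        using W_eq[of "cis \<theta>" x] by simp
      have eq: "(norm (complex_of_real a + w))\<^sup>2 = a\<^sup>2 + (norm w)\<^sup>2 + 2 * a * Re w" for a w
        unfolding cmod_power2 by (simp add: power2_eq_square algebra_simps)
      have "norm (?w \<theta>) = norm (W (T x) (cis \<theta>))"
        by (simp add: norm_mult)
      then show ?thesis unfolding W eq by (simp only:)
    qed
    then have "?Q x = (LINT \<theta>|angle. ?a\<^sup>2 + (norm (W (T x) (cis \<theta>)))\<^sup>2 + 2 * ?a * Re (?w \<theta>))"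
      by (simp only:)
    also have "\<dots> = (LINT \<theta>|angle. ?a\<^sup>2) + ?Q (T x) + (LINT \<theta>|angle. 2 * ?a * Re (?w \<theta>))"
      using ints by (simp only: Bochner_Integration.integral_add Bochner_Integration.integrable_add)
    also have "(LINT \<theta>|angle. 2 * ?a * Re (?w \<theta>)) = 2 * ?a * (LINT \<theta>|angle. Re (?w \<theta>))"
      by (rule integral_mult_right_zero)
    also have "(LINT \<theta>|angle. Re (?w \<theta>)) = Re (LINT \<theta>|angle. ?w \<theta>)"
      by (rule integral_bounded_linear[OF bounded_linear_Re int])
    also have "(LINT \<theta>|angle. ?w \<theta>) = 0" by (rule integral_W_eq_0)
    finally show ?thesis by (simp add: integral_angle_const)
  qed
  have E: "E x = E (T x)" for x
    unfolding E_def Q[of x] T_inner[of x] using \<beta>_pos by (simp add: field_simps power2_eq_square)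
  obtain C where C: "0 \<le> C" "\<And>x z. norm z = 1 \<Longrightarrow> norm (W x z) \<le> C * norm x"
    using W_bounded by blast
  define D where "D = 2 * pi * C\<^sup>2 + 2 * pi / \<beta>"
  have D: "0 \<le> D" using \<beta>_pos by (simp add: D_def)
  have bound: "\<bar>E y\<bar> \<le> D * (norm y)\<^sup>2" for y
  proof -
    have "?Q y \<le> (LINT \<theta>|angle. (C * norm y)\<^sup>2)"
    proof (rule integral_mono)
      show "integrable angle (\<lambda>\<theta>. (norm (W y (cis \<theta>)))\<^sup>2)" "integrable angle (\<lambda>\<theta>. (C * norm y)\<^sup>2)"
        by (intro integrable_angle_continuous continuous_intros)+
      show "(norm (W y (cis \<theta>)))\<^sup>2 \<le> (C * norm y)\<^sup>2" for \<theta>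
        using C(2)[of "cis \<theta>" y] by (intro power_mono) auto
    qed
    also have "\<dots> = 2 * pi * C\<^sup>2 * (norm y)\<^sup>2" by (simp add: power_mult_distrib)
    finally have "?Q y \<le> 2 * pi * C\<^sup>2 * (norm y)\<^sup>2" .
    moreover have "0 \<le> ?Q y" by simp
    moreover have "0 \<le> 2 * pi * (y \<bullet> y) / \<beta>" "0 \<le> 2 * pi * C\<^sup>2 * (norm y)\<^sup>2" using \<beta>_pos by auto
    ultimately have "\<bar>E y\<bar> \<le> 2 * pi * C\<^sup>2 * (norm y)\<^sup>2 + 2 * pi * (y \<bullet> y) / \<beta>"
      unfolding E_def by linarith
    then show ?thesis by (simp add: D_def power2_norm_eq_inner algebra_simps)
  qed
  \<comment> \<open>\<open>E\<close> is bounded quadratically in the vector, whereas the contraction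
    argument wants a linear bound; hence the square root.\<close>
  have "sqrt \<bar>E x\<bar> \<le> 0"
  proof (rule nonpos_if_le_T[where f = "\<lambda>_ y. sqrt \<bar>E y\<bar>" and C = "sqrt D"])
    show "sqrt \<bar>E y\<bar> \<le> sqrt \<bar>E (T y)\<bar>" for y by (simp only: E[symmetric] order_refl)
    show "sqrt \<bar>E y\<bar> \<le> sqrt D * norm y" for y
      using real_sqrt_le_mono[OF bound[of y]] by (simp add: real_sqrt_mult)
  qed
  then have "E x = 0" by simp
  then show ?thesis by (simp add: E_def)
qed

text \<open>The maximum entropy density with state covariance \<open>I\<close>.\<close>

definition \<Phi>1 where "\<Phi>1 z = \<beta> / (norm (re_mult B (G z)))\<^sup>2"

lemma \<Phi>1_S_plus: "\<Phi>1 \<in> S_plus"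
proof -
  obtain m K where m: "0 < m" "\<And>z. norm z = 1 \<Longrightarrow> m \<le> norm (re_mult B (G z)) \<and> norm (re_mult B (G z)) \<le> K"
    using re_mult_B_bounds by metis
  have K: "0 < K" using m(1) m(2)[of 1] by simp
  have "\<beta> / K\<^sup>2 \<le> \<Phi>1 z \<and> \<Phi>1 z \<le> \<beta> / m\<^sup>2" if "norm z = 1" for z
    unfolding \<Phi>1_def using m(1) m(2)[OF that] \<beta>_pos
    by (intro conjI divide_left_mono power_mono mult_pos_pos zero_less_power) auto
  moreover have "0 < \<beta> / K\<^sup>2" using \<beta>_pos K by simp
  moreover have "(\<lambda>\<theta>. \<Phi>1 (cis \<theta>)) \<in> borel_measurable angle"
    unfolding \<Phi>1_def using re_mult_B_nonzero
    by (intro borel_measurable_angle_continuous continuous_intros) auto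
  moreover have "\<Phi>1 (cnj z) = \<Phi>1 z" if "norm z = 1" for z
  proof -
    have "re_mult B (G (cnj z)) = cnj (re_mult B (G z))"
      unfolding transfer_cnj[OF that] by (simp add: re_mult_def)
    then show ?thesis by (simp add: \<Phi>1_def)
  qed
  ultimately show ?thesis unfolding S_plus_def by blast
qed

text \<open>\<open>\<Phi>1\<close> is chosen so that its product with |x'G|^2 is \<beta> |W x|^2.
  Parseval gives the quadratic form of the moment matrix, and polarization the matrix
  itself.\<close>

lemma \<Phi>1_feasible: "(LINT \<theta>|angle. \<Phi>1 (cis \<theta>) *\<^sub>R gram_angle \<theta>) = (2 * pi) *\<^sub>R mat 1"
proof (rule symmetric_eq_if_outer_inner_eq)
  have \<Phi>1: "bounded_symmetric \<Phi>1" by (rule bounded_symmetric_S_plus[OF \<Phi>1_S_plus])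
  have int: "integrable angle (\<lambda>\<theta>. \<Phi>1 (cis \<theta>) *\<^sub>R gram_angle \<theta>)"
    by (intro bounded_symmetric_integrable \<Phi>1 continuous_intros)
  have bl: "bounded_linear (transpose :: real^'n^'n \<Rightarrow> real^'n^'n)"
    by (simp add: linear_conv_bounded_linear[symmetric])
       (rule linearI; simp add: transpose_def vec_eq_iff)
  show "transpose (LINT \<theta>|angle. \<Phi>1 (cis \<theta>) *\<^sub>R gram_angle \<theta>) = (LINT \<theta>|angle. \<Phi>1 (cis \<theta>) *\<^sub>R gram_angle \<theta>)"
    using integral_bounded_linear[OF bl int]
    by (simp add: linear_cmul[OF bounded_linear.linear[OF bl]] transpose_gram_angle)
  show "transpose ((2 * pi) *\<^sub>R mat 1) = (2 * pi) *\<^sub>R (mat 1 :: real^'n^'n)"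
    by (simp add: linear_cmul[OF bounded_linear.linear[OF bl]])
  fix x :: "real^'n"
  have "outer x \<bullet> (LINT \<theta>|angle. \<Phi>1 (cis \<theta>) *\<^sub>R gram_angle \<theta>)
      = (LINT \<theta>|angle. \<beta> * (norm (W x (cis \<theta>)))\<^sup>2)"
    unfolding integral_quadratic_form[OF \<Phi>1]
    by (simp add: \<Phi>1_def W_def norm_divide power_divide)
  also have "\<dots> = 2 * pi * (x \<bullet> x)"
    using integral_W_square[of x] \<beta>_pos by simp
  finally show "outer x \<bullet> (LINT \<theta>|angle. \<Phi>1 (cis \<theta>) *\<^sub>R gram_angle \<theta>) = outer x \<bullet> ((2 * pi) *\<^sub>R mat 1)"
    by (simp add: outer_inner_mat_1)
qed

end

section \<open>Rationality\<close>

text \<open>Cancelling the gcd can only lower degrees, so upper bounds may be read from any fraction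
  whose denominator has no zero on the circle.\<close>

lemma rational_on_circle_of_fraction:
  assumes frac: "\<And>z. norm z = 1 \<Longrightarrow> poly q z \<noteq> 0 \<and> complex_of_real (\<Phi> z) = poly p z / poly q z"
    and deg: "degree p \<le> d" "degree q \<le> d"
  shows "rational_on_circle \<Phi> \<and> rational_deg \<Phi> \<le> d"
proof -
  have "q \<noteq> 0" using frac[of 1] by auto
  then have "gcd p q \<noteq> 0" by simp
  then obtain p' q' where pq: "p = p' * gcd p q" "q = q' * gcd p q" "coprime p' q'"
    using gcd_coprime_exists by blast
  have "is_fraction_on_circle \<Phi> p' q'"
    unfolding is_fraction_on_circle_def
  proof (intro conjI allI impI)
    fix z :: complex assume z: "norm z = 1"
    have q: "poly q z = poly q' z * poly (gcd p q) z" and p: "poly p z = poly p' z * poly (gcd p q) z"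
      using arg_cong[OF pq(2), of "\<lambda>r. poly r z"] arg_cong[OF pq(1), of "\<lambda>r. poly r z"] by simp_all
    show "poly q' z \<noteq> 0" using frac[OF z] unfolding q by simp
    show "complex_of_real (\<Phi> z) = poly p' z / poly q' z"
      using frac[OF z] unfolding p q by simp
  qed (use pq in simp)
  moreover have "degree p' \<le> d"
  proof (cases "p = 0")
    case True
    then show ?thesis using pq(1) \<open>gcd p q \<noteq> 0\<close> by simp
  next
    case False
    then show ?thesis using pq(1) deg(1) dvd_imp_degree_le[of p' p] by (metis dvd_triv_left order_trans)
  qed
  moreover have "degree q' \<le> d"
    using pq(2) deg(2) dvd_imp_degree_le[of q' q] \<open>q \<noteq> 0\<close> by (metis dvd_triv_left order_trans)
  ultimately show ?thesis
    using rational_deg_eq[of \<Phi> p' q'] by (auto simp: rational_on_circle_def)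
qed

text \<open>On the circle \<open>cnj z\<close> is 1/z, so reversing and conjugating the coefficients
  does it. Reversal is with respect to a common \<open>n\<close>, not the degree, so that all
  numerators and the denominator of \<open>G\<close> pick up the same factor z^n.\<close>

lemma conj_reflected_poly:
  fixes p :: "complex poly"
  assumes "degree p \<le> n"
  obtains p' where "degree p' \<le> n" "\<And>z. norm z = 1 \<Longrightarrow> poly p' z = z ^ n * cnj (poly p z)"
proof
  let ?p' = "\<Sum>i\<le>n. monom (cnj (coeff p i)) (n - i)"
  show "degree ?p' \<le> n"
    by (intro degree_sum_le) (auto intro: order_trans[OF degree_monom_le])
  fix z :: complex assume z: "norm z = 1"
  have "poly p z = (\<Sum>i\<le>n. coeff p i * z ^ i)"
    unfolding poly_altdef using assms
    by (intro sum.mono_neutral_left) (auto simp: coeff_eq_0)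
  then have "z ^ n * cnj (poly p z) = (\<Sum>i\<le>n. cnj (coeff p i) * (z ^ n * cnj z ^ i))"
    by (simp add: sum_distrib_left algebra_simps)
  also have "\<dots> = (\<Sum>i\<le>n. cnj (coeff p i) * z ^ (n - i))"
  proof (intro sum.cong refl)
    fix i assume "i \<in> {..n}"
    then have "z ^ n = z ^ (n - i) * z ^ i" by (simp flip: power_add)
    moreover have "z ^ i * cnj z ^ i = 1"
      using z by (simp flip: power_mult_distrib complex_norm_square)
    ultimately show "cnj (coeff p i) * (z ^ n * cnj z ^ i) = cnj (coeff p i) * z ^ (n - i)"
      by (simp add: mult.assoc)
  qed
  finally show "poly ?p' z = z ^ n * cnj (poly p z)"
    by (simp add: poly_sum poly_monom)
qed

section \<open>Polynomial representation of the transfer function\<close>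

lemma poly_det: "poly (det R) z = det (\<chi> i j. poly (R $ i $ j) z)" for R :: "complex poly^'n^'n"
proof -
  have "poly (of_int k) z = of_int k" for k :: int
    by (cases k) (simp_all add: of_nat_poly of_int_minus)
  then show ?thesis
    by (simp add: det_def poly_sum poly_prod)
qed

lemma degree_det_le:
  fixes R :: "complex poly^'n^'n"
  assumes "\<And>i j. degree (R $ i $ j) \<le> 1"
  shows "degree (det R) \<le> CARD('n)"
  unfolding det_def
proof (intro degree_sum_le)
  fix p :: "'n \<Rightarrow> 'n" assume "p \<in> {p. p permutes UNIV}"
  have "degree (of_int (sign p) :: complex poly) = 0"
    by (simp add: of_int_poly)
  then have "degree (of_int (sign p) * (\<Prod>i\<in>UNIV. R $ i $ p i)) \<le> degree (\<Prod>i\<in>UNIV. R $ i $ p i)"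
    using degree_mult_le[of "of_int (sign p)" "\<Prod>i\<in>UNIV. R $ i $ p i"] by simp
  also have "\<dots> \<le> (\<Sum>i\<in>(UNIV::'n set). degree (R $ i $ p i))"
    using degree_prod_sum_le[of UNIV "\<lambda>i. R $ i $ p i"] by (simp add: o_def)
  also have "\<dots> \<le> (\<Sum>i\<in>(UNIV::'n set). 1)"
    by (intro sum_mono assms)
  finally show "degree (of_int (sign p) * (\<Prod>i\<in>UNIV. R $ i $ p i)) \<le> CARD('n)" by simp
qed (simp add: finite_permutations)

context stable_filter begin

text \<open>Cramer's rule for the transfer equation: \<open>d\<close> is the determinant of zI - A,
  and \<open>a i\<close> is the same determinant with column i replaced by \<open>B\<close>.\<close>

lemma transfer_polynomials:
  obtains d :: "complex poly" and a :: "'n \<Rightarrow> complex poly" where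
    "degree d \<le> CARD('n)" "\<And>i. degree (a i) \<le> CARD('n)"
    "\<And>z. norm z = 1 \<Longrightarrow> poly d z \<noteq> 0" "\<And>z i. norm z = 1 \<Longrightarrow> poly (a i) z = poly d z * G z $ i"
proof -
  define R :: "complex poly^'n^'n" where
    "R = (\<chi> i j. [:- complex_of_real (A $ i $ j), if i = j then 1 else 0:])"
  define a where "a k = det (\<chi> i j. if j = k then [:complex_of_real (B $ i):] else R $ i $ j)" for k
  have poly_R: "(\<chi> i j. poly (R $ i $ j) z) = mat z - complex_mat A" for z
    by (simp add: R_def vec_eq_iff mat_def complex_mat_def)
  have d: "poly (det R) z = det (mat z - complex_mat A)" for z
    unfolding poly_det poly_R ..
  have a: "poly (a k) z = det (\<chi> i j. if j = k then complex_vec B $ i else (mat z - complex_mat A) $ i $ j)" for k z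
    unfolding a_def poly_det poly_R[symmetric]
    by (intro arg_cong[where f = det]) (simp add: vec_eq_iff complex_vec_def)
  show thesis
  proof (rule that[of "det R" a])
    show "degree (det R) \<le> CARD('n)"
      by (intro degree_det_le) (simp add: R_def)
    show "degree (a i) \<le> CARD('n)" for i
      unfolding a_def by (intro degree_det_le) (simp add: R_def)
    fix z :: complex assume z: "norm z = 1"
    show nz: "poly (det R) z \<noteq> 0"
      using resolvent_invertible[OF z] by (simp add: d invertible_det_nz)
    have "(mat z - complex_mat A) *v G z = complex_vec B"
      using transfer_equation[OF z] by (simp add: matrix_vector_mult_diff_rdistrib mat_mult)
    then have "G z = (\<chi> k. poly (a k) z / poly (det R) z)"
      using cramer[of "mat z - complex_mat A" "G z" "complex_vec B"] nz by (simp add: d a)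
    then have "G z $ i = poly (a i) z / poly (det R) z" for i by (metis vec_lambda_beta)
    then show "poly (a i) z = poly (det R) z * G z $ i" for i using nz by simp
  qed
qed

text \<open>The common denominator is d times its reflection, equal to z^n |d|^2 on the circle; it
  does not depend on \<Lambda>. Each factor has degree at most n, which produces the 2n of the final
  bound.\<close>

lemma gram_polynomials:
  obtains D :: "complex poly" where
    "degree D \<le> 2 * CARD('n)" "\<And>z. norm z = 1 \<Longrightarrow> poly D z \<noteq> 0"
    "\<And>\<Lambda>. \<exists>N. degree N \<le> 2 * CARD('n) \<and>
      (\<forall>z. norm z = 1 \<longrightarrow> poly N z = poly D z * complex_of_real (\<Lambda> \<bullet> gram (G z)))"
proof -
  let ?n = "CARD('n)"
  obtain d :: "complex poly" and a :: "'n \<Rightarrow> complex poly" where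
    d: "degree d \<le> ?n" "\<And>z. norm z = 1 \<Longrightarrow> poly d z \<noteq> 0"
    and a: "\<And>i. degree (a i) \<le> ?n" "\<And>z i. norm z = 1 \<Longrightarrow> poly (a i) z = poly d z * G z $ i"
    using transfer_polynomials by metis
  obtain d' where d': "degree d' \<le> ?n" "\<And>z. norm z = 1 \<Longrightarrow> poly d' z = z ^ ?n * cnj (poly d z)"
    using conj_reflected_poly[OF d(1)] by metis
  have "\<exists>p'. degree p' \<le> ?n \<and> (\<forall>z. norm z = 1 \<longrightarrow> poly p' z = z ^ ?n * cnj (poly (a i) z))" for i
    using conj_reflected_poly[OF a(1)] by metis
  then obtain a' where a': "\<And>i. degree (a' i) \<le> ?n"
    "\<And>i z. norm z = 1 \<Longrightarrow> poly (a' i) z = z ^ ?n * cnj (poly (a i) z)" by metis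
  show thesis
  proof (rule that[of "d * d'"])
    show "degree (d * d') \<le> 2 * ?n"
      using degree_mult_le[of d d'] d(1) d'(1) by simp
    show "poly (d * d') z \<noteq> 0" if "norm z = 1" for z
      using d(2)[OF that] d'(2)[OF that] that by auto
    fix \<Lambda> :: "real^'n^'n"
    \<comment> \<open>The sum of the two products represents a complex number plus its conjugate,
      since \<open>gram\<close> takes real parts; the resulting factor 2 is cancelled by the halved
      coefficients.\<close>
    define N where "N = (\<Sum>i\<in>UNIV. \<Sum>j\<in>UNIV. smult (complex_of_real (\<Lambda> $ i $ j / 2)) (a i * a' j + a' i * a j))"
    have "degree N \<le> 2 * ?n"
      unfolding N_def
    proof (intro degree_sum_le finite_UNIV order_trans[OF degree_smult_le] degree_add_le)
      show "degree (a i * a' j) \<le> 2 * ?n" "degree (a' i * a j) \<le> 2 * ?n" for i j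
        using degree_mult_le[of "a i" "a' j"] degree_mult_le[of "a' i" "a j"] a(1)[of i] a'(1)[of j] a(1)[of j] a'(1)[of i]
        by linarith+
    qed auto
    moreover have "poly N z = poly (d * d') z * complex_of_real (\<Lambda> \<bullet> gram (G z))" if z: "norm z = 1" for z
    proof -
      have "poly (a i * a' j + a' i * a j) z = poly (d * d') z * (2 * complex_of_real (gram (G z) $ i $ j))" for i j
      proof -
        have "2 * complex_of_real (Re w) = w + cnj w" for w by (simp add: complex_add_cnj)
        from this[of "G z $ i * cnj (G z $ j)"]
        have "2 * complex_of_real (gram (G z) $ i $ j) = G z $ i * cnj (G z $ j) + cnj (G z $ i) * G z $ j"
          by (simp add: gram_def)
        then show ?thesis
          using a(2)[OF z] a'(2)[OF z] d'(2)[OF z] by (simp add: algebra_simps)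
      qed
      then have "poly N z = (\<Sum>i\<in>UNIV. \<Sum>j\<in>UNIV. complex_of_real (\<Lambda> $ i $ j / 2) *
          (poly (d * d') z * (2 * complex_of_real (gram (G z) $ i $ j))))"
        by (simp only: N_def poly_sum poly_smult)
      also have "\<dots> = poly (d * d') z * (\<Sum>i\<in>UNIV. \<Sum>j\<in>UNIV. complex_of_real (\<Lambda> $ i $ j * gram (G z) $ i $ j))"
        by (simp add: sum_distrib_left algebra_simps)
      also have "(\<Sum>i\<in>UNIV. \<Sum>j\<in>UNIV. complex_of_real (\<Lambda> $ i $ j * gram (G z) $ i $ j))
          = complex_of_real (\<Lambda> \<bullet> gram (G z))"
        by (simp add: inner_vec_def)
      finally show ?thesis .
    qed
    ultimately show "\<exists>N. degree N \<le> 2 * ?n \<and>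
        (\<forall>z. norm z = 1 \<longrightarrow> poly N z = poly (d * d') z * complex_of_real (\<Lambda> \<bullet> gram (G z)))"
      by blast
  qed
qed

text \<open>On the circle 1 + q/k is E / D with both degrees at most 2n, so \<Phi> is p D^k / (r
  E^k), and numerator and denominator each gain at most 2nk over those of \<Psi>.\<close>

lemma rational_divide_power:
  assumes \<Psi>: "rational_on_circle \<Psi>"
    and w: "\<And>z. norm z = 1 \<Longrightarrow> 1 + \<Lambda> \<bullet> gram (G z) / real k \<noteq> 0"
    and \<Phi>: "\<And>z. norm z = 1 \<Longrightarrow> \<Phi> z = \<Psi> z / (1 + \<Lambda> \<bullet> gram (G z) / real k) ^ k"
  shows "rational_on_circle \<Phi> \<and> rational_deg \<Phi> \<le> rational_deg \<Psi> + 2 * CARD('n) * k"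
proof -
  let ?n = "CARD('n)"
  obtain p r where pr: "is_fraction_on_circle \<Psi> p r" using \<Psi> by (auto simp: rational_on_circle_def)
  obtain D :: "complex poly" where D: "degree D \<le> 2 * ?n" "\<And>z. norm z = 1 \<Longrightarrow> poly D z \<noteq> 0"
    and "\<exists>N. degree N \<le> 2 * ?n \<and>
      (\<forall>z. norm z = 1 \<longrightarrow> poly N z = poly D z * complex_of_real (\<Lambda> \<bullet> gram (G z)))"
    using gram_polynomials by metis
  then obtain N where N: "degree N \<le> 2 * ?n"
    "\<And>z. norm z = 1 \<Longrightarrow> poly N z = poly D z * complex_of_real (\<Lambda> \<bullet> gram (G z))" by metis
  define E where "E = D + smult (complex_of_real (1 / real k)) N"
  have E: "poly E z = poly D z * complex_of_real (1 + \<Lambda> \<bullet> gram (G z) / real k)" if "norm z = 1" for z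
    using N(2)[OF that] by (simp add: E_def algebra_simps)
  have degE: "degree E \<le> 2 * ?n"
    unfolding E_def by (intro degree_add_le D(1) order_trans[OF degree_smult_le N(1)])
  have deg_power: "degree (X ^ k) \<le> 2 * ?n * k" if "degree X \<le> 2 * ?n" for X :: "complex poly"
    using degree_power_le[of X k] that by (meson mult_le_mono1 order_trans)
  show ?thesis
  proof (rule rational_on_circle_of_fraction[where p = "p * D ^ k" and q = "r * E ^ k"])
    fix z :: complex assume z: "norm z = 1"
    have r: "poly r z \<noteq> 0" "complex_of_real (\<Psi> z) = poly p z / poly r z"
      using pr z by (auto simp: is_fraction_on_circle_def)
    have "complex_of_real (1 + \<Lambda> \<bullet> gram (G z) / real k) \<noteq> 0"
      unfolding of_real_eq_0_iff by (rule w[OF z])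
    then have Ez: "poly E z \<noteq> 0" using E[OF z] D(2)[OF z] by simp
    have "complex_of_real (\<Phi> z)
        = (poly p z / poly r z) / complex_of_real (1 + \<Lambda> \<bullet> gram (G z) / real k) ^ k"
      unfolding \<Phi>[OF z] of_real_divide of_real_power r(2) ..
    also have "\<dots> = (poly p z * poly D z ^ k) / (poly r z * poly E z ^ k)"
      unfolding E[OF z] using D(2)[OF z] by (simp add: power_mult_distrib)
    finally show "poly (r * E ^ k) z \<noteq> 0 \<and> complex_of_real (\<Phi> z) = poly (p * D ^ k) z / poly (r * E ^ k) z"
      using r(1) Ez by simp
  next
    show "degree (p * D ^ k) \<le> rational_deg \<Psi> + 2 * ?n * k"
      using degree_mult_le[of p "D ^ k"] deg_power[OF D(1)] rational_deg_eq[OF pr] by linarith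
    show "degree (r * E ^ k) \<le> rational_deg \<Psi> + 2 * ?n * k"
      using degree_mult_le[of r "E ^ k"] deg_power[OF degE] rational_deg_eq[OF pr] by linarith
  qed
qed

end

section \<open>Optimality\<close>

lemma strict_tangent_inequality:
  fixes f f' :: "real \<Rightarrow> real"
  assumes deriv: "\<And>t. 0 < t \<Longrightarrow> (f has_real_derivative f' t) (at t)"
    and mono: "\<And>s t. 0 < s \<Longrightarrow> s < t \<Longrightarrow> f' s < f' t"
    and "0 < x" "0 < y" "x \<noteq> y"
  shows "f x + f' x * (y - x) < f y"
proof (cases "x < y")
  case True
  obtain \<xi> where \<xi>: "x < \<xi>" "\<xi> < y" "f y - f x = (y - x) * f' \<xi>"
    using MVT2[OF True, of f f'] deriv \<open>0 < x\<close> by force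
  have "(y - x) * f' x < (y - x) * f' \<xi>"
    using mono[OF \<open>0 < x\<close> \<xi>(1)] True by simp
  then show ?thesis using \<xi>(3) by (simp add: algebra_simps)
next
  case False
  then have "y < x" using \<open>x \<noteq> y\<close> by simp
  obtain \<xi> where \<xi>: "y < \<xi>" "\<xi> < x" "f x - f y = (x - y) * f' \<xi>"
    using MVT2[OF \<open>y < x\<close>, of f f'] deriv \<open>0 < y\<close> by force
  have "(x - y) * f' \<xi> < (x - y) * f' x"
    using mono[OF _ \<xi>(2)] \<xi>(1) \<open>0 < y\<close> \<open>y < x\<close> by simp
  then show ?thesis using \<xi>(3) by (simp add: algebra_simps)
qed

definition divergence_integrand :: "enat \<Rightarrow> real \<Rightarrow> real \<Rightarrow> real" where
  "divergence_integrand \<nu> x \<psi> = (case \<nu> of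
     \<infinity> \<Rightarrow> x * ln (x / \<psi>) - x + \<psi>
   | enat k \<Rightarrow>
       if k = 1 then \<psi> * ln (\<psi> / x) - \<psi> + x
       else (real k)\<^sup>2 / (1 - real k) * x powr ((real k - 1) / real k) * \<psi> powr (1 / real k)
              + real k * x + real k / (real k - 1) * \<psi>)"

text \<open>The derivative in \<open>x\<close>; the finite formula also covers k = 1, where it is 1
  - \<psi> / x. Setting it equal to -q and solving for \<open>x\<close> gives \<psi> / (1 + q/k)^k,
  respectively \<psi> exp (-q).\<close>

definition divergence_slope :: "enat \<Rightarrow> real \<Rightarrow> real \<Rightarrow> real" where
  "divergence_slope \<nu> x \<psi> = (case \<nu> of
     \<infinity> \<Rightarrow> ln (x / \<psi>)
   | enat k \<Rightarrow> real k * (1 - (\<psi> / x) powr (1 / real k)))"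

lemma S_div_eq: "S_div \<nu> \<Phi> \<Psi> = circle_int (\<lambda>z. divergence_integrand \<nu> (\<Phi> z) (\<Psi> z))"
  by (cases \<nu>) (auto simp: S_div_def KL_div_def divergence_integrand_def)

lemma divergence_integrand_derivative:
  assumes "1 \<le> \<nu>" "0 < x" "0 < \<psi>"
  shows "((\<lambda>x. divergence_integrand \<nu> x \<psi>) has_real_derivative divergence_slope \<nu> x \<psi>) (at x)"
proof (cases \<nu>)
  case infinity
  have "((\<lambda>x. x * ln (x / \<psi>) - x + \<psi>) has_real_derivative ln (x / \<psi>)) (at x)"
    using assms by (auto intro!: derivative_eq_intros)
  then show ?thesis by (simp add: infinity divergence_integrand_def divergence_slope_def)
next
  case (enat k)
  show ?thesis
  proof (cases "k = 1")
    case True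
    have "((\<lambda>x. \<psi> * ln (\<psi> / x) - \<psi> + x) has_real_derivative 1 - \<psi> / x) (at x)"
      using assms by (auto intro!: derivative_eq_intros simp: field_simps power2_eq_square)
    then show ?thesis using assms by (simp add: enat True divergence_integrand_def divergence_slope_def)
  next
    case False
    then have k: "1 < real k" using assms(1) by (auto simp: enat one_enat_def)
    define a where "a = (real k - 1) / real k"
    have "((\<lambda>x. (real k)\<^sup>2 / (1 - real k) * x powr a * \<psi> powr (1 / real k)
        + real k * x + real k / (real k - 1) * \<psi>) has_real_derivative
        (real k)\<^sup>2 / (1 - real k) * (a * x powr (a - 1)) * \<psi> powr (1 / real k) + real k) (at x)"
      using assms(2) k by (auto intro!: derivative_eq_intros)
    moreover have "(real k)\<^sup>2 / (1 - real k) * (a * x powr (a - 1)) * \<psi> powr (1 / real k) + real k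
        = real k * (1 - (\<psi> / x) powr (1 / real k))"
    proof -
      have "a - 1 = - (1 / real k)" using k by (simp add: a_def field_simps)
      then have "x powr (a - 1) * \<psi> powr (1 / real k) = (\<psi> / x) powr (1 / real k)"
        using assms by (simp add: powr_minus_divide powr_divide)
      moreover have "(real k)\<^sup>2 / (1 - real k) * a = - real k"
        using k by (simp add: a_def field_simps power2_eq_square)
      then have "(real k)\<^sup>2 / (1 - real k) * (a * x powr (a - 1)) * \<psi> powr (1 / real k)
          = - real k * (x powr (a - 1) * \<psi> powr (1 / real k))"
        by (metis mult.assoc)
      ultimately show ?thesis by (simp add: algebra_simps)
    qed
    ultimately show ?thesis using False by (simp add: enat divergence_integrand_def divergence_slope_def a_def)
  qed
qed

lemma divergence_slope_strict_mono:
  assumes "1 \<le> \<nu>" "0 < \<psi>" "0 < s" "s < t"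
  shows "divergence_slope \<nu> s \<psi> < divergence_slope \<nu> t \<psi>"
proof (cases \<nu>)
  case infinity
  then show ?thesis using assms by (simp add: divergence_slope_def divide_strict_right_mono)
next
  case (enat k)
  then have k: "0 < real k" using assms(1) by (auto simp: one_enat_def)
  have "\<psi> / t < \<psi> / s" using assms by (intro divide_strict_left_mono) auto
  then have "(\<psi> / t) powr (1 / real k) < (\<psi> / s) powr (1 / real k)"
    using assms k by (intro powr_less_mono2) auto
  then show ?thesis using k by (simp add: enat divergence_slope_def)
qed

lemma divergence_integrand_strict_tangent:
  assumes "1 \<le> \<nu>" "0 < \<psi>" "0 < x" "0 < y" "x \<noteq> y"
  shows "divergence_integrand \<nu> x \<psi> + divergence_slope \<nu> x \<psi> * (y - x) < divergence_integrand \<nu> y \<psi>"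
  using assms
  by (intro strict_tangent_inequality[where f = "\<lambda>x. divergence_integrand \<nu> x \<psi>" and f' = "\<lambda>x. divergence_slope \<nu> x \<psi>"]
      divergence_integrand_derivative divergence_slope_strict_mono) auto

text \<open>Both densities take values in a compact rectangle inside the positive quadrant, where
  the integrand is continuous and hence bounded.\<close>

lemma divergence_integrand_integrable:
  assumes \<Phi>: "\<Phi> \<in> S_plus" and \<Psi>: "\<Psi> \<in> S_plus"
  shows "integrable angle (\<lambda>\<theta>. divergence_integrand \<nu> (\<Phi> (cis \<theta>)) (\<Psi> (cis \<theta>)))"
proof -
  obtain \<mu> M where M: "0 < \<mu>" "\<And>z. norm z = 1 \<Longrightarrow> \<mu> \<le> \<Phi> z \<and> \<Phi> z \<le> M"
    using \<Phi> by (auto simp: S_plus_def)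
  obtain \<mu>' M' where M': "0 < \<mu>'" "\<And>z. norm z = 1 \<Longrightarrow> \<mu>' \<le> \<Psi> z \<and> \<Psi> z \<le> M'"
    using \<Psi> by (auto simp: S_plus_def)
  let ?S = "{\<mu>..M} \<times> {\<mu>'..M'}"
  have "continuous_on ?S (\<lambda>p. divergence_integrand \<nu> (fst p) (snd p))"
  proof (cases \<nu>)
    case infinity
    then show ?thesis using M(1) M'(1)
      unfolding divergence_integrand_def by (auto intro!: continuous_intros)
  next
    case (enat k)
    then show ?thesis using M(1) M'(1)
      unfolding divergence_integrand_def by (cases "k = 1") (auto intro!: continuous_intros)
  qed
  then have "compact ((\<lambda>p. divergence_integrand \<nu> (fst p) (snd p)) ` ?S)"
    by (intro compact_continuous_image compact_Times) auto
  then obtain C where "\<And>y. y \<in> (\<lambda>p. divergence_integrand \<nu> (fst p) (snd p)) ` ?S \<Longrightarrow> norm y \<le> C"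
    using compact_imp_bounded bounded_iff by metis
  then have C: "norm (divergence_integrand \<nu> x y) \<le> C" if "x \<in> {\<mu>..M}" "y \<in> {\<mu>'..M'}" for x y
    using that by force
  have [measurable]: "(\<lambda>\<theta>. \<Phi> (cis \<theta>)) \<in> borel_measurable angle" "(\<lambda>\<theta>. \<Psi> (cis \<theta>)) \<in> borel_measurable angle"
    using \<Phi> \<Psi> by (auto simp: S_plus_def)
  show ?thesis
  proof (rule integrable_angle_bounded)
    show "(\<lambda>\<theta>. divergence_integrand \<nu> (\<Phi> (cis \<theta>)) (\<Psi> (cis \<theta>))) \<in> borel_measurable angle"
    proof (cases \<nu>)
      case infinity
      then show ?thesis unfolding divergence_integrand_def by simp
    next
      case (enat k)
      then show ?thesis unfolding divergence_integrand_def by (cases "k = 1") simp_all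
    qed
    show "norm (divergence_integrand \<nu> (\<Phi> (cis \<theta>)) (\<Psi> (cis \<theta>))) \<le> C" for \<theta>
      using M(2)[of "cis \<theta>"] M'(2)[of "cis \<theta>"] by (intro C) auto
  qed
qed

lemma S_plus_mult:
  assumes \<Psi>: "\<Psi> \<in> S_plus" and cont: "continuous_on {-pi..pi} (\<lambda>\<theta>. c (cis \<theta>))"
    and pos: "\<And>z. norm z = 1 \<Longrightarrow> 0 < c z" and sym: "\<And>z. norm z = 1 \<Longrightarrow> c (cnj z) = c z"
  shows "(\<lambda>z. \<Psi> z * c z) \<in> S_plus"
proof -
  obtain \<mu> M where M: "0 < \<mu>" "\<And>z. norm z = 1 \<Longrightarrow> \<mu> \<le> \<Psi> z \<and> \<Psi> z \<le> M"
    using \<Psi> by (auto simp: S_plus_def)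
  obtain s where s: "\<And>\<theta>. \<theta> \<in> {-pi..pi} \<Longrightarrow> c (cis s) \<le> c (cis \<theta>)"
    using continuous_attains_inf[OF compact_Icc _ cont] by force
  obtain t where t: "\<And>\<theta>. \<theta> \<in> {-pi..pi} \<Longrightarrow> c (cis \<theta>) \<le> c (cis t)"
    using continuous_attains_sup[OF compact_Icc _ cont] by force
  have "\<forall>z. norm z = 1 \<longrightarrow> c (cis s) \<le> c z \<and> c z \<le> c (cis t)"
    unfolding circle_all_iff_angle using s t by blast
  then have "\<mu> * c (cis s) \<le> \<Psi> z * c z \<and> \<Psi> z * c z \<le> M * c (cis t)" if "norm z = 1" for z
    using that M pos[of "cis s"] pos[OF that] M(2)[OF that] by (intro conjI mult_mono) force+
  moreover have "0 < \<mu> * c (cis s)" using M(1) pos by simp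
  moreover have "(\<lambda>\<theta>. \<Psi> (cis \<theta>) * c (cis \<theta>)) \<in> borel_measurable angle"
    using \<Psi> borel_measurable_angle_continuous[OF cont]
    by (intro borel_measurable_times) (auto simp: S_plus_def)
  moreover have "\<Psi> (cnj z) * c (cnj z) = \<Psi> z * c z" if "norm z = 1" for z
    using \<Psi> sym[OF that] that by (auto simp: S_plus_def)
  ultimately show ?thesis unfolding S_plus_def by blast
qed

section \<open>Sufficiency of the stationarity condition\<close>

context stable_filter begin

lemma gram_cnj:
  assumes "norm z = 1"
  shows "gram (G (cnj z)) = gram (G z)"
  unfolding transfer_cnj[OF assms] by (simp add: gram_def vec_eq_iff)

lemma feasible_iff:
  "\<Phi> \<in> feasible A B \<longleftrightarrow> \<Phi> \<in> S_plus \<and> (LINT \<theta>|angle. \<Phi> (cis \<theta>) *\<^sub>R gram_angle \<theta>) = (2 * pi) *\<^sub>R mat 1"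
  using Gamma_op_eq_mat_1_iff bounded_symmetric_S_plus by (auto simp: feasible_def)

text \<open>Strict convexity makes the Lagrangian gap to a competitor nonnegative at each angle, and
  zero only where the two densities agree. On the feasible set the multiplier terms cancel after
  integration, so the integrated gap is 2 pi times the difference of the objectives. A competing
  minimizer has gap 0 almost everywhere.\<close>

lemma optimal_if_stationary:
  assumes \<nu>: "1 \<le> \<nu>" and \<Psi>: "\<Psi> \<in> S_plus" and \<Phi>: "\<Phi> \<in> feasible A B"
    and stationary: "\<And>z. norm z = 1 \<Longrightarrow> divergence_slope \<nu> (\<Phi> z) (\<Psi> z) = - (\<Lambda> \<bullet> gram (G z))"
  shows "is_solution \<nu> A B \<Psi> \<Phi> \<and> (\<forall>\<Phi>'. is_solution \<nu> A B \<Psi> \<Phi>' \<longrightarrow> circle_ae_eq \<Phi>' \<Phi>)"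
proof -
  \<comment> \<open>The multiplier terms are written as inner products with the moment integrands,
    so that each of them integrates to the same constant for feasible densities.\<close>
  define gap where "gap \<Phi>' \<theta> = divergence_integrand \<nu> (\<Phi>' (cis \<theta>)) (\<Psi> (cis \<theta>)) - divergence_integrand \<nu> (\<Phi> (cis \<theta>)) (\<Psi> (cis \<theta>))
      + \<Lambda> \<bullet> (\<Phi>' (cis \<theta>) *\<^sub>R gram_angle \<theta>) - \<Lambda> \<bullet> (\<Phi> (cis \<theta>) *\<^sub>R gram_angle \<theta>)" for \<Phi>' \<theta>
  have pos: "0 < F z" if "F \<in> S_plus" "norm z = 1" for F z
    using that unfolding S_plus_def by (auto intro: less_le_trans)
  have gap_pos: "0 < gap \<Phi>' \<theta>" if "\<Phi>' \<in> S_plus" "\<Phi>' (cis \<theta>) \<noteq> \<Phi> (cis \<theta>)" for \<Phi>' \<theta>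
  proof -
    have "divergence_integrand \<nu> (\<Phi> (cis \<theta>)) (\<Psi> (cis \<theta>)) + - (\<Lambda> \<bullet> gram_angle \<theta>) * (\<Phi>' (cis \<theta>) - \<Phi> (cis \<theta>))
        < divergence_integrand \<nu> (\<Phi>' (cis \<theta>)) (\<Psi> (cis \<theta>))"
      using divergence_integrand_strict_tangent[OF \<nu>, of "\<Psi> (cis \<theta>)" "\<Phi> (cis \<theta>)" "\<Phi>' (cis \<theta>)"]
        pos[OF \<Psi>] pos[of \<Phi>] \<Phi> pos[OF that(1)] that(2) stationary[of "cis \<theta>"]
      by (simp add: feasible_def gram_angle_def)
    then show ?thesis by (simp add: gap_def algebra_simps)
  qed
  have gap_0: "gap \<Phi>' \<theta> = 0" if "\<Phi>' (cis \<theta>) = \<Phi> (cis \<theta>)" for \<Phi>' \<theta>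
    using that by (simp add: gap_def)
  have gap_nonneg: "0 \<le> gap \<Phi>' \<theta>" if "\<Phi>' \<in> S_plus" for \<Phi>' \<theta>
    using gap_pos[OF that] gap_0[of \<Phi>' \<theta>] by (cases "\<Phi>' (cis \<theta>) = \<Phi> (cis \<theta>)") (auto intro: less_imp_le)
  have intM: "integrable angle (\<lambda>\<theta>. F (cis \<theta>) *\<^sub>R gram_angle \<theta>)" if "F \<in> S_plus" for F
    using that by (intro bounded_symmetric_integrable bounded_symmetric_S_plus continuous_intros)
  have intM': "integrable angle (\<lambda>\<theta>. \<Lambda> \<bullet> (F (cis \<theta>) *\<^sub>R gram_angle \<theta>))" if "F \<in> S_plus" for F
    using intM[OF that] by (rule integrable_inner_right)
  note intD = divergence_integrand_integrable[OF _ \<Psi>, of _ \<nu>]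
  have \<Phi>S: "\<Phi> \<in> S_plus" using \<Phi> by (simp add: feasible_def)
  have int: "integrable angle (gap \<Phi>')" if "\<Phi>' \<in> S_plus" for \<Phi>'
    unfolding gap_def using that \<Phi>S
    by (intro Bochner_Integration.integrable_diff Bochner_Integration.integrable_add intD intM')
  have integral_gap: "(LINT \<theta>|angle. gap \<Phi>' \<theta>) = 2 * pi * (S_div \<nu> \<Phi>' \<Psi> - S_div \<nu> \<Phi> \<Psi>)"
    if "\<Phi>' \<in> feasible A B" for \<Phi>'
  proof -
    have \<Phi>': "\<Phi>' \<in> S_plus" using that by (simp add: feasible_def)
    have "(LINT \<theta>|angle. gap \<Phi>' \<theta>)
        = (LINT \<theta>|angle. divergence_integrand \<nu> (\<Phi>' (cis \<theta>)) (\<Psi> (cis \<theta>)))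
        - (LINT \<theta>|angle. divergence_integrand \<nu> (\<Phi> (cis \<theta>)) (\<Psi> (cis \<theta>)))
        + (LINT \<theta>|angle. \<Lambda> \<bullet> (\<Phi>' (cis \<theta>) *\<^sub>R gram_angle \<theta>)) - (LINT \<theta>|angle. \<Lambda> \<bullet> (\<Phi> (cis \<theta>) *\<^sub>R gram_angle \<theta>))"
      unfolding gap_def
      by (simp only: Bochner_Integration.integral_diff Bochner_Integration.integral_add
          Bochner_Integration.integrable_diff Bochner_Integration.integrable_add intD[OF \<Phi>'] intD[OF \<Phi>S]
          intM'[OF \<Phi>'] intM'[OF \<Phi>S])
    also have "(LINT \<theta>|angle. \<Lambda> \<bullet> (\<Phi>' (cis \<theta>) *\<^sub>R gram_angle \<theta>)) = \<Lambda> \<bullet> ((2 * pi) *\<^sub>R mat 1)"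
      using that integral_inner_right[OF intM[OF \<Phi>'], of \<Lambda>] by (simp only: feasible_iff)
    also have "(LINT \<theta>|angle. \<Lambda> \<bullet> (\<Phi> (cis \<theta>) *\<^sub>R gram_angle \<theta>)) = \<Lambda> \<bullet> ((2 * pi) *\<^sub>R mat 1)"
      using \<Phi> integral_inner_right[OF intM[OF \<Phi>S], of \<Lambda>] by (simp only: feasible_iff)
    finally show ?thesis by (simp add: S_div_eq circle_int_def right_diff_distrib)
  qed
  have "\<not> S_div \<nu> \<Phi>' \<Psi> < S_div \<nu> \<Phi> \<Psi>" if "\<Phi>' \<in> feasible A B" for \<Phi>'
  proof -
    have "0 \<le> (LINT \<theta>|angle. gap \<Phi>' \<theta>)"
      using gap_nonneg that by (intro Bochner_Integration.integral_nonneg) (auto simp: feasible_def)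
    then show ?thesis unfolding integral_gap[OF that] using pi_gt_zero by (auto simp: zero_le_mult_iff)
  qed
  moreover have "circle_ae_eq \<Phi>' \<Phi>" if sol: "is_solution \<nu> A B \<Psi> \<Phi>'" for \<Phi>'
  proof -
    have \<Phi>': "\<Phi>' \<in> feasible A B" and "\<not> S_div \<nu> \<Phi> \<Psi> < S_div \<nu> \<Phi>' \<Psi>"
      using sol \<Phi> by (auto simp: is_solution_def is_arg_min_def)
    have \<Phi>'S: "\<Phi>' \<in> S_plus" using \<Phi>' by (simp add: feasible_def)
    have "(LINT \<theta>|angle. gap \<Phi>' \<theta>) \<le> 0"
      unfolding integral_gap[OF \<Phi>'] using \<open>\<not> _\<close> pi_gt_zero by (simp add: mult_le_0_iff)
    moreover have "0 \<le> (LINT \<theta>|angle. gap \<Phi>' \<theta>)"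
      using gap_nonneg[OF \<Phi>'S] by (intro Bochner_Integration.integral_nonneg) auto
    ultimately have "(LINT \<theta>|angle. gap \<Phi>' \<theta>) = 0" by linarith
    then have "AE \<theta> in angle. gap \<Phi>' \<theta> = 0"
      using integral_nonneg_eq_0_iff_AE[OF int[OF \<Phi>'S]] gap_nonneg[OF \<Phi>'S] by simp
    then show ?thesis
      unfolding circle_ae_eq_def by (rule AE_mp) (use gap_pos[OF \<Phi>'S] in \<open>force intro!: AE_I2\<close>)
  qed
  ultimately show ?thesis
    using \<Phi> by (auto simp: is_solution_def is_arg_min_def)
qed

end

theorem mainTheorem1:
  fixes A :: "real^'n^'n" and B :: "real^'n" and \<Psi> :: "complex \<Rightarrow> real" and \<nu> :: enat
  assumes "1 \<le> \<nu>"
    and "\<Psi> \<in> S_plus" and "rational_on_circle \<Psi>"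
    and "filter_bank A B"
    and "mat 1 \<in> Range_Gamma A B"
  shows "\<exists>\<Phi>. is_solution \<nu> A B \<Psi> \<Phi> \<and>
             (\<forall>\<Phi>'. is_solution \<nu> A B \<Psi> \<Phi>' \<longrightarrow> circle_ae_eq \<Phi>' \<Phi>) \<and>
             (\<forall>k. \<nu> = enat k \<longrightarrow>
                rational_on_circle \<Phi> \<and> rational_deg \<Phi> \<le> rational_deg \<Psi> + 2 * CARD('n) * k)"
proof -
  obtain \<Phi>0 where \<Phi>0: "\<Phi>0 \<in> S_plus_span" "Gamma_op A B \<Phi>0 = mat 1"
    using assms(5) by (auto simp: Range_Gamma_def)
  interpret normalized_filter A B \<Phi>0
    using assms(4) \<Phi>0 by unfold_locales (auto simp: filter_bank_def bounded_symmetric_S_plus_span)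
  obtain L where L: "L-lipschitz_on UNIV gram_angle" using gram_angle_lipschitz by blast
  obtain \<mu> M where M: "0 < \<mu>" "\<And>z. norm z = 1 \<Longrightarrow> \<mu> \<le> \<Psi> z \<and> \<Psi> z \<le> M"
    using assms(2) by (auto simp: S_plus_def)
  obtain \<mu>1 M1 where M1: "0 < \<mu>1" "\<And>z. norm z = 1 \<Longrightarrow> \<mu>1 \<le> \<Phi>1 z \<and> \<Phi>1 z \<le> M1"
    using \<Phi>1_S_plus by (auto simp: S_plus_def)
  interpret mp: moment_problem gram_angle "\<lambda>\<theta>. \<Phi>1 (cis \<theta>)" "\<lambda>\<theta>. \<Psi> (cis \<theta>)" L "min \<mu> \<mu>1" "max M M1"
  proof
    show "L-lipschitz_on {-pi..pi} gram_angle" using L by (rule lipschitz_on_subset) simp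
    show "(\<lambda>\<theta>. \<Phi>1 (cis \<theta>)) \<in> borel_measurable angle" "(\<lambda>\<theta>. \<Psi> (cis \<theta>)) \<in> borel_measurable angle"
      using assms(2) \<Phi>1_S_plus by (auto simp: S_plus_def)
    show "0 < min \<mu> \<mu>1" using M(1) M1(1) by simp
    show "min \<mu> \<mu>1 \<le> \<Phi>1 (cis \<theta>) \<and> \<Phi>1 (cis \<theta>) \<le> max M M1" for \<theta>
      using M1(2)[of "cis \<theta>"] by auto
    show "min \<mu> \<mu>1 \<le> \<Psi> (cis \<theta>) \<and> \<Psi> (cis \<theta>) \<le> max M M1" for \<theta>
      using M(2)[of "cis \<theta>"] by auto
  qed
  \<comment> \<open>A vanishing residual says that this density has the same moments as
    \<open>\<Phi>1\<close>, which is feasible.\<close>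
  have feasible: "(\<lambda>z. \<Psi> z * g (\<Lambda> \<bullet> gram (G z))) \<in> feasible A B"
    if S: "(\<lambda>z. \<Psi> z * g (\<Lambda> \<bullet> gram (G z))) \<in> S_plus" and res: "mp.residual g \<Lambda> = 0" for g \<Lambda>
  proof -
    have int: "integrable angle (\<lambda>\<theta>. F (cis \<theta>) *\<^sub>R gram_angle \<theta>)" if "F \<in> S_plus" for F
      using that by (intro bounded_symmetric_integrable bounded_symmetric_S_plus continuous_intros)
    have "mp.residual g \<Lambda> = (LINT \<theta>|angle. \<Phi>1 (cis \<theta>) *\<^sub>R gram_angle \<theta> - (\<Psi> (cis \<theta>) * g (\<Lambda> \<bullet> gram (G (cis \<theta>)))) *\<^sub>R gram_angle \<theta>)"
      by (simp only: mp.residual_def scaleR_diff_left gram_angle_def)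
    also have "\<dots> = (LINT \<theta>|angle. \<Phi>1 (cis \<theta>) *\<^sub>R gram_angle \<theta>)
        - (LINT \<theta>|angle. (\<Psi> (cis \<theta>) * g (\<Lambda> \<bullet> gram (G (cis \<theta>)))) *\<^sub>R gram_angle \<theta>)"
      by (rule Bochner_Integration.integral_diff[OF int[OF \<Phi>1_S_plus] int[OF S]])
    finally show ?thesis using res \<Phi>1_feasible S by (simp add: feasible_iff)
  qed
  have contq: "continuous_on {-pi..pi} (\<lambda>\<theta>. \<Lambda> \<bullet> gram (G (cis \<theta>)))" for \<Lambda>
    using continuous_on_inner[OF continuous_on_const continuous_on_gram_angle] by (simp add: gram_angle_def)
  have \<Psi>_pos: "0 < \<Psi> z" if "norm z = 1" for z using M(1) M(2)[OF that] by simp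
  show ?thesis
  proof (cases \<nu>)
    case infinity
    obtain \<Lambda> where res: "mp.residual (\<lambda>t. exp (- t)) \<Lambda> = 0" using mp.moment_equation_exp by blast
    let ?\<Phi> = "\<lambda>z. \<Psi> z * exp (- (\<Lambda> \<bullet> gram (G z)))"
    have "?\<Phi> \<in> S_plus"
      using assms(2) by (rule S_plus_mult) (auto intro!: continuous_intros contq simp: gram_cnj)
    then have "?\<Phi> \<in> feasible A B" using res by (rule feasible)
    moreover have "divergence_slope \<nu> (?\<Phi> z) (\<Psi> z) = - (\<Lambda> \<bullet> gram (G z))" if "norm z = 1" for z
      using \<Psi>_pos[OF that] by (simp add: infinity divergence_slope_def)
    ultimately have "is_solution \<nu> A B \<Psi> ?\<Phi> \<and> (\<forall>\<Phi>'. is_solution \<nu> A B \<Psi> \<Phi>' \<longrightarrow> circle_ae_eq \<Phi>' ?\<Phi>)"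
      by (rule optimal_if_stationary[OF assms(1,2)])
    then show ?thesis using infinity by blast
  next
    case (enat k)
    then have k: "1 \<le> k" using assms(1) by (simp add: one_enat_def)
    obtain \<Lambda> \<epsilon> where \<epsilon>: "0 < \<epsilon>" "\<And>\<theta>. \<theta> \<in> {-pi..pi} \<Longrightarrow> \<epsilon> \<le> 1 + \<Lambda> \<bullet> gram_angle \<theta> / k"
      and res: "mp.residual (\<lambda>t. 1 / (1 + t / k) ^ k) \<Lambda> = 0"
      using mp.moment_equation_power[OF k] by blast
    have "\<forall>z. norm z = 1 \<longrightarrow> 0 < 1 + \<Lambda> \<bullet> gram (G z) / k"
      unfolding circle_all_iff_angle using \<epsilon> by (auto simp: gram_angle_def intro: less_le_trans)
    then have pos: "0 < 1 + \<Lambda> \<bullet> gram (G z) / k" if "norm z = 1" for z using that by blast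
    let ?\<Phi> = "\<lambda>z. \<Psi> z * (1 / (1 + \<Lambda> \<bullet> gram (G z) / k) ^ k)"
    have "?\<Phi> \<in> S_plus"
      using assms(2)
    proof (rule S_plus_mult)
      show "continuous_on {-pi..pi} (\<lambda>\<theta>. 1 / (1 + \<Lambda> \<bullet> gram (G (cis \<theta>)) / k) ^ k)"
        using k pos[OF norm_cis] by (intro continuous_intros contq) (auto simp: less_le)
    qed (use pos in \<open>simp_all add: gram_cnj\<close>)
    then have "?\<Phi> \<in> feasible A B" using res by (rule feasible)
    moreover have "divergence_slope \<nu> (?\<Phi> z) (\<Psi> z) = - (\<Lambda> \<bullet> gram (G z))" if z: "norm z = 1" for z
    proof -
      let ?w = "1 + \<Lambda> \<bullet> gram (G z) / k"
      \<comment> \<open>The k-th root in the slope undoes the k-th power in the density; positivity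
        of \<open>?w\<close> makes the root equal to \<open>?w\<close>.\<close>
      have "(\<Psi> z / ?\<Phi> z) powr (1 / k) = (?w ^ k) powr (1 / k)"
        using \<Psi>_pos[OF z] by simp
      also have "\<dots> = ?w"
        using pos[OF z] k by (simp add: powr_powr flip: powr_realpow)
      finally show ?thesis using k by (simp add: enat divergence_slope_def algebra_simps)
    qed
    ultimately have "is_solution \<nu> A B \<Psi> ?\<Phi> \<and> (\<forall>\<Phi>'. is_solution \<nu> A B \<Psi> \<Phi>' \<longrightarrow> circle_ae_eq \<Phi>' ?\<Phi>)"
      by (rule optimal_if_stationary[OF assms(1,2)])
    moreover have "rational_on_circle ?\<Phi> \<and> rational_deg ?\<Phi> \<le> rational_deg \<Psi> + 2 * CARD('n) * k"
    proof (rule rational_divide_power[OF assms(3)])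
      show "1 + \<Lambda> \<bullet> gram (G z) / k \<noteq> 0" if "norm z = 1" for z using pos[OF that] by simp
    qed simp
    ultimately show ?thesis using enat by blast
  qed
qed

end
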